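(* Let $n\geq 2$, let $a=\lfloor n/2\rfloor$, let $V=\mathbb{C}^{n+1}$, and let $d=2\delta+1$ with $\delta\ge 1$ an integer. For $\phi\in S^dV$ let $YF_{d,n}(\phi):S^{\delta}V^*\otimes\Lambda^aV\to S^{\delta}V\otimes\Lambda^{a+1}V$ be the linear map which, for $\phi=w^d$ with $w\in V$, is given by $$\alpha^{\delta}\otimes v_1\wedge\cdots\wedge v_a\mapsto (\alpha(w))^{\delta}\,w^{\delta}\otimes w\wedge v_1\wedge\cdots\wedge v_a,$$ and which depends linearly on $\phi$ (equivalently: include $S^dV\subset S^\delta V\otimes S^\delta V\otimes V$ and use the last factor to map $\Lambda^aV\to\Lambda^{a+1}V$ by wedging). Let $YF^r_{d,n}\subset\mathbb{P}S^dV$ be the variety of $[\phi]$ with $\operatorname{rank}YF_{d,n}(\phi)\le \binom{n}{a}r$, i.e. the zero set of the size $\binom{n}{a}r+1$ minors of $YF_{d,n}(\phi)$. If $r\le\binom{\delta+n}{n}$, then $\sigma_r(v_d(\mathbb{P}^n))$ is an irreducible component of $YF^r_{d,n}$. Moreover, when $n=2a$ with $a$ odd, the matrix of $YF_{d,n}(\phi)$ (for any $d$, after identifying $\Lambda^{a+1}V\cong\Lambda^aV^*$ by a volume form) is skew-symmetric, and one may instead use the size $\binom{n}{a}r+2$ sub-Pfaffians of $YF_{d,n}(\phi)$ (so $\sigma_r(v_d(\mathbb{P}^n))$ is an irreducible component of their zero set); when $n=2a$ with $a$ even, $YF_{d,n}(\phi)$ is symmetric.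
   Context: All vector spaces are over $\mathbb{C}$. $S^dV$ is the space of homogeneous degree $d$ polynomials (symmetric tensors); $v_d(\mathbb{P}V)\subset\mathbb{P}S^dV$ is the Veronese variety $\{[w^d]:w\in V\}$. For a projective variety $X\subset\mathbb{P}W$, the $r$-th secant variety $\sigma_r(X)$ is the Zariski closure of the union of the linear spans $\mathbb{P}\langle x_1,\dots,x_r\rangle$ over $x_1,\dots,x_r\in X$; for $X=v_d(\mathbb{P}V)$ it is the closure of the set of sums of $r$ $d$-th powers of linear forms. *)

theory Defs
  imports "Jordan_Normal_Form.Determinant"
begin

definition aff :: "'a set \<Rightarrow> ('a \<Rightarrow> complex) set" where
  "aff I = {f. \<forall>x. x \<notin> I \<longrightarrow> f x = 0}"

inductive_set polyfun :: "'a set \<Rightarrow> (('a \<Rightarrow> complex) \<Rightarrow> complex) set"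
  for I :: "'a set" where
  pconst: "(\<lambda>f. c) \<in> polyfun I"
| pvar: "i \<in> I \<Longrightarrow> (\<lambda>f. f i) \<in> polyfun I"
| padd: "p \<in> polyfun I \<Longrightarrow> q \<in> polyfun I \<Longrightarrow> (\<lambda>f. p f + q f) \<in> polyfun I"
| pmult: "p \<in> polyfun I \<Longrightarrow> q \<in> polyfun I \<Longrightarrow> (\<lambda>f. p f * q f) \<in> polyfun I"

definition zclosed :: "'a set \<Rightarrow> ('a \<Rightarrow> complex) set \<Rightarrow> bool" where
  "zclosed I Z \<longleftrightarrow> (\<exists>P \<subseteq> polyfun I. Z = {f \<in> aff I. \<forall>p\<in>P. p f = 0})"

definition zclosure :: "'a set \<Rightarrow> ('a \<Rightarrow> complex) set \<Rightarrow> ('a \<Rightarrow> complex) set" where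
  "zclosure I X = \<Inter>{Z. zclosed I Z \<and> X \<subseteq> Z}"

definition zirred :: "'a set \<Rightarrow> ('a \<Rightarrow> complex) set \<Rightarrow> bool" where
  "zirred I X \<longleftrightarrow> X \<noteq> {} \<and> X \<subseteq> aff I \<and>
     (\<forall>Z1 Z2. zclosed I Z1 \<and> zclosed I Z2 \<and> X \<subseteq> Z1 \<union> Z2 \<longrightarrow> X \<subseteq> Z1 \<or> X \<subseteq> Z2)"

definition irr_component :: "'a set \<Rightarrow> ('a \<Rightarrow> complex) set \<Rightarrow> ('a \<Rightarrow> complex) set \<Rightarrow> bool" where
  "irr_component I X Y \<longleftrightarrow> X \<subseteq> Y \<and> zirred I X \<and>
     (\<forall>X'. zirred I X' \<and> X \<subseteq> X' \<and> X' \<subseteq> Y \<longrightarrow> X' = X)"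

text \<open>V = C^(n+1) with basis e_0..e_n. V^(tensor d) has coordinates indexed by
lists of length d with entries in {0..n}; S^d V = symmetric tensors.\<close>

definition tidx :: "nat \<Rightarrow> nat \<Rightarrow> nat list set" where
  "tidx d n = {xs. length xs = d \<and> set xs \<subseteq> {..n}}"

definition symT :: "nat \<Rightarrow> nat \<Rightarrow> (nat list \<Rightarrow> complex) set" where
  "symT d n = {\<Phi>. \<Phi> \<in> aff (tidx d n) \<and> (\<forall>xs ys. mset xs = mset ys \<longrightarrow> \<Phi> xs = \<Phi> ys)}"

definition powT :: "nat \<Rightarrow> nat \<Rightarrow> (nat \<Rightarrow> complex) \<Rightarrow> nat list \<Rightarrow> complex" where
  "powT d n w = (\<lambda>xs. if xs \<in> tidx d n then prod_list (map w xs) else 0)"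

text \<open>Affine cone over sigma_r(v_d(P^n)): Zariski closure of sums of r d-th powers.\<close>
definition secant_cone :: "nat \<Rightarrow> nat \<Rightarrow> nat \<Rightarrow> (nat list \<Rightarrow> complex) set" where
  "secant_cone d n r = zclosure (tidx d n)
     {\<Phi>. \<exists>ws :: nat \<Rightarrow> nat \<Rightarrow> complex. \<Phi> = (\<lambda>xs. \<Sum>i<r. powT d n (ws i) xs)}"

definition inversions :: "nat list \<Rightarrow> nat" where
  "inversions xs = card {(i, j). i < j \<and> j < length xs \<and> xs ! i > xs ! j}"

text \<open>Coefficient of e_T (T a finite set, basis vector e_{t1} wedge ... with t1<...)
  in the wedge product e_{x1} wedge ... wedge e_{xm}.\<close>
definition wcoef :: "nat list \<Rightarrow> nat set \<Rightarrow> complex" where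
  "wcoef xs T = (if distinct xs \<and> set xs = T then (-1) ^ inversions xs else 0)"

text \<open>Basis of S^delta: sorted lists (monomial/symmetrized basis).\<close>
definition slists :: "nat \<Rightarrow> nat \<Rightarrow> nat list set" where
  "slists k n = {I. sorted I \<and> length I = k \<and> set I \<subseteq> {..n}}"

definition wsets :: "nat \<Rightarrow> nat \<Rightarrow> nat set set" where
  "wsets k n = {T. T \<subseteq> {..n} \<and> card T = k}"

text \<open>Rows: basis s_I (x) e_T of S^delta V (x) Lambda^(a+1) V;
  columns: basis Sym(e^J) (x) e_S of S^delta V^* (x) Lambda^a V.\<close>
definition YF_rows :: "nat \<Rightarrow> nat \<Rightarrow> nat \<Rightarrow> (nat list \<times> nat set) set" where
  "YF_rows \<delta> n a = slists \<delta> n \<times> wsets (a + 1) n"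

definition YF_cols :: "nat \<Rightarrow> nat \<Rightarrow> nat \<Rightarrow> (nat list \<times> nat set) set" where
  "YF_cols \<delta> n a = slists \<delta> n \<times> wsets a n"

text \<open>Matrix of YF_{d,n}(Phi), d = 2 delta + 1, for a symmetric tensor Phi:
  S^d V in S^delta V (x) S^delta V (x) V, contract the middle factor,
  wedge with the last factor.  For Phi = w^d this is the map of the paper.\<close>
definition YF_mat :: "nat \<Rightarrow> (nat list \<Rightarrow> complex) \<Rightarrow> (nat list \<times> nat set) \<Rightarrow> (nat list \<times> nat set) \<Rightarrow> complex" where
  "YF_mat n \<Phi> = (\<lambda>(I, T) (J, S). \<Sum>k\<le>n. \<Phi> (I @ J @ [k]) * wcoef (k # sorted_list_of_set S) T)"

definition minors_vanish :: "nat \<Rightarrow> 'r set \<Rightarrow> 'c set \<Rightarrow> ('r \<Rightarrow> 'c \<Rightarrow> complex) \<Rightarrow> bool" where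
  "minors_vanish m R C M \<longleftrightarrow> (\<forall>rs cs. length rs = m \<and> length cs = m \<and> distinct rs \<and> distinct cs
      \<and> set rs \<subseteq> R \<and> set cs \<subseteq> C \<longrightarrow> det (mat m m (\<lambda>(i, j). M (rs ! i) (cs ! j))) = 0)"

text \<open>Affine cone over YF^r_{d,n}.\<close>
definition YF_locus :: "nat \<Rightarrow> nat \<Rightarrow> nat \<Rightarrow> (nat list \<Rightarrow> complex) set" where
  "YF_locus \<delta> n r = {\<Phi> \<in> symT (2 * \<delta> + 1) n.
     minors_vanish ((n choose (n div 2)) * r + 1) (YF_rows \<delta> n (n div 2)) (YF_cols \<delta> n (n div 2))
       (YF_mat n \<Phi>)}"

text \<open>Matrix of YF(Phi) after identifying S^delta V = (S^delta V^*)^* and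
  Lambda^(a+1) V = (Lambda^a V)^* via the volume form e_0 wedge ... wedge e_n
  (x paired with beta gives the coefficient of the volume form in x wedge beta).
  Rows and columns both indexed by YF_cols.\<close>
definition YF_pair :: "nat \<Rightarrow> (nat list \<Rightarrow> complex) \<Rightarrow> (nat list \<times> nat set) \<Rightarrow> (nat list \<times> nat set) \<Rightarrow> complex" where
  "YF_pair n \<Phi> = (\<lambda>(I, S') (J, S). \<Sum>k\<le>n. \<Phi> (I @ J @ [k])
       * wcoef (k # sorted_list_of_set S @ sorted_list_of_set S') {..n})"

definition pfaffian :: "nat \<Rightarrow> (nat \<Rightarrow> nat \<Rightarrow> complex) \<Rightarrow> complex" where
  "pfaffian k A = (\<Sum>\<sigma> | \<sigma> permutes {..<k}.
       of_int (sign \<sigma>) * (\<Prod>i<k div 2. A (\<sigma> (2 * i)) (\<sigma> (2 * i + 1))))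
     / (2 ^ (k div 2) * fact (k div 2))"

definition subpfaffians_vanish :: "nat \<Rightarrow> 'r set \<Rightarrow> ('r \<Rightarrow> 'r \<Rightarrow> complex) \<Rightarrow> bool" where
  "subpfaffians_vanish k P M \<longleftrightarrow> (\<forall>ks. length ks = k \<and> distinct ks \<and> set ks \<subseteq> P
      \<longrightarrow> pfaffian k (\<lambda>i j. M (ks ! i) (ks ! j)) = 0)"

definition YF_pf_locus :: "nat \<Rightarrow> nat \<Rightarrow> nat \<Rightarrow> (nat list \<Rightarrow> complex) set" where
  "YF_pf_locus \<delta> n r = {\<Phi> \<in> symT (2 * \<delta> + 1) n.
     subpfaffians_vanish ((n choose (n div 2)) * r + 2) (YF_cols \<delta> n (n div 2)) (YF_pair n \<Phi>)}"

end

theory Submission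
  imports Defs "HOL-Library.Function_Algebras" "HOL-Computational_Algebra.Polynomial"
begin

text \<open>The secant variety is irreducible, being the closure of the image of an affine space. It is
  contained in the locus since the flattening of \<open>w^d\<close> has rank at most \<open>n choose a\<close>. Maximality is a tangent
  space computation at \<open>\<phi> = \<Sum>w^d\<close>, where \<open>w\<close> runs over \<open>r\<close> of the lattice points \<open>\<alpha> \<in> \<nat>^(n+1)\<close> of degree \<open>\<delta>\<close>. These
  points are unisolvent for forms of degree \<open>\<delta>\<close>, with interpolating forms \<open>p_\<alpha> = \<Prod>\<^sub>k \<Prod>j<\<alpha> k. (x\<^sub>k - j h)\<close>,
  \<open>\<delta> h = x\<^sub>0 + \<dots> + x\<^sub>n\<close>, so the kernel of the flattening is spanned by the \<open>p_\<alpha> \<otimes> \<alpha> \<and> \<eta>\<close> (and the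
  \<open>p_\<alpha> \<otimes> \<eta>\<close> for unused \<open>\<alpha>\<close>). A tensor \<open>\<psi>\<close> tangent to the locus hence kills \<open>p_\<alpha> p_\<beta> L\<close> for \<open>\<alpha> \<noteq> \<beta>\<close> and linear forms
  \<open>L\<close> vanishing at \<open>\<alpha>\<close> and \<open>\<beta>\<close>; the syzygies \<open>p_(\<gamma>+k) (x\<^sub>l - \<gamma>\<^sub>l h) = p_(\<gamma>+l) (x\<^sub>k - \<gamma>\<^sub>k h)\<close> then force \<open>\<psi>\<close> to be tangent to
  the secant variety. At such a point a polynomial vanishing on the secant variety lies in all powers of the
  maximal ideal of any irreducible \<open>X\<close> between the two varieties, and so vanishes on \<open>X\<close> by Krull's intersection
  theorem.\<close>

section \<open>Noetherian rings of functions\<close>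

text \<open>No dimension theory enters: maximality is decided locally at the one point \<phi>, so
  \<phi> has to be explicit enough for its tangent equations to be solved by hand. All lattice
  points \<beta> of degree \<delta> lie on h = 1, and there \<open>x\<^sub>k - j h\<close> takes the
  value \<beta> k - j; hence \<open>p_\<alpha>\<close> is the homogenized Lagrange polynomial of
  \<alpha>, a product of falling factorials. There are (\<delta> + n) choose n such points, the
  dimension of \<open>S^\<delta> V\<close>, which is the bound on r. The tangent equations come from
  bordering an invertible block of the flattening by a cokernel and a kernel vector; the corner
  entry is of second order wherever the minors vanish. The linear forms L are the maps x to x \<and>
  \<beta> \<and> A \<and> \<alpha> \<and> B obtained by pairing such vectors, which is why they
  vanish at both points. For n = 2 a with a odd no second tangent computation is made: a
  skew-symmetric matrix has even rank and n choose a is even, so minors and sub-Pfaffians cut out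
  the same set.\<close>

inductive_set sring :: "'b::comm_ring_1 set \<Rightarrow> 'b set" for G where
  sring_gen: "g \<in> G \<Longrightarrow> g \<in> sring G"
| sring_0: "0 \<in> sring G"
| sring_1: "1 \<in> sring G"
| sring_minus: "x \<in> sring G \<Longrightarrow> - x \<in> sring G"
| sring_add: "x \<in> sring G \<Longrightarrow> y \<in> sring G \<Longrightarrow> x + y \<in> sring G"
| sring_mult: "x \<in> sring G \<Longrightarrow> y \<in> sring G \<Longrightarrow> x * y \<in> sring G"

lemma sring_sum: "(\<And>i. i \<in> S \<Longrightarrow> f i \<in> sring G) \<Longrightarrow> sum f S \<in> sring G"
  by (induction S rule: infinite_finite_induct) (auto intro: sring.intros)

lemma sring_power: "x \<in> sring G \<Longrightarrow> x ^ k \<in> sring G"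
  by (induction k) (auto intro: sring.intros)

lemma sring_mono: "G \<subseteq> sring H \<Longrightarrow> sring G \<subseteq> sring H"
proof
  fix x assume "G \<subseteq> sring H" "x \<in> sring G"
  from this(2,1) show "x \<in> sring H" by (induction) (auto intro: sring.intros)
qed

text \<open>Noetherianity is phrased with sequences so that no ideals of the subring have to be formed.\<close>
definition noeth :: "'b::comm_ring_1 set \<Rightarrow> bool" where
  "noeth A \<longleftrightarrow> (\<forall>a::nat \<Rightarrow> 'b. range a \<subseteq> A \<longrightarrow>
     (\<exists>K u. (\<forall>k. u k \<in> A) \<and> a K = (\<Sum>k<K. u k * a k)))"

text \<open>Hilbert's basis theorem relative to the subring \<open>sring G\<close>. From a sequence
  violating the claim one extracts elements of least degree outside growing partial ideals;
  Noetherianity applied to their leading coefficients cancels the leading term of one of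
  them.\<close>

lemma noeth_Hilbert:
  fixes G :: "'b::comm_ring_1 set"
  assumes "noeth (sring G)"
  shows "noeth {P. \<forall>i. coeff P i \<in> sring G}"
  unfolding noeth_def
proof (intro allI impI, rule ccontr)
  let ?AP = "{P. \<forall>i. coeff P i \<in> sring G}"
  fix a :: "nat \<Rightarrow> 'b poly"
  assume a: "range a \<subseteq> ?AP"
    and contra: "\<not> (\<exists>K u. (\<forall>k. u k \<in> ?AP) \<and> a K = (\<Sum>k<K. u k * a k))"
  define I where "I = (\<lambda>N. {\<Sum>k<N. u k * a k | u. \<forall>k. u k \<in> ?AP})"
  define J where "J = (\<Union>N. I N)"
  have AP_mult: "p * q \<in> ?AP" if "p \<in> ?AP" "q \<in> ?AP" for p q
    using that by (auto simp: coeff_mult intro!: sring_sum sring_mult)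
  have AP_diff: "p - q \<in> ?AP" if "p \<in> ?AP" "q \<in> ?AP" for p q
    using that sring_add[OF _ sring_minus] by fastforce
  have AP_0: "0 \<in> ?AP" by (auto intro: sring_0)
  have AP_1: "1 \<in> ?AP" by (auto intro: sring_0 sring_1)
  have AP_add: "p + q \<in> ?AP" if "p \<in> ?AP" "q \<in> ?AP" for p q
    using that sring_add by fastforce
  have AP_monom: "monom c k \<in> ?AP" if "c \<in> sring G" for c k
    using that by (auto simp: sring_0)
  have I_mono: "I N \<subseteq> I N'" if "N \<le> N'" for N N'
  proof
    fix x assume "x \<in> I N"
    then obtain u where u: "\<forall>k. u k \<in> ?AP" "x = (\<Sum>k<N. u k * a k)" by (auto simp: I_def)
    let ?u = "\<lambda>k. if k < N then u k else 0"
    have "x = (\<Sum>k<N'. ?u k * a k)"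
      unfolding u(2) using that by (intro sum.mono_neutral_cong_left) auto
    moreover have "\<forall>k. ?u k \<in> ?AP" using u(1) AP_0 by auto
    ultimately show "x \<in> I N'" unfolding I_def mem_Collect_eq by (intro exI[of _ ?u] conjI)
  qed
  have I_mult: "p * x \<in> I N" if "x \<in> I N" "p \<in> ?AP" for p x N
  proof -
    from that obtain u where u: "\<forall>k. u k \<in> ?AP" "x = (\<Sum>k<N. u k * a k)" by (auto simp: I_def)
    have "p * x = (\<Sum>k<N. (p * u k) * a k)" by (simp add: u(2) sum_distrib_left mult.assoc)
    moreover have "\<forall>k. p * u k \<in> ?AP" using u(1) AP_mult that(2) by blast
    ultimately show ?thesis unfolding I_def mem_Collect_eq by (intro exI[of _ "\<lambda>k. p * u k"] conjI)
  qed
  have I_add: "x + y \<in> I N" if "x \<in> I N" "y \<in> I N" for x y N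
  proof -
    from that obtain u v where u: "\<forall>k. u k \<in> ?AP" "x = (\<Sum>k<N. u k * a k)"
      and v: "\<forall>k. v k \<in> ?AP" "y = (\<Sum>k<N. v k * a k)" unfolding I_def by blast
    have "x + y = (\<Sum>k<N. (u k + v k) * a k)"
      by (simp add: u(2) v(2) sum.distrib distrib_right)
    moreover have "\<forall>k. u k + v k \<in> ?AP" using u(1) v(1) AP_add by blast
    ultimately show ?thesis unfolding I_def mem_Collect_eq by (intro exI[of _ "\<lambda>k. u k + v k"] conjI)
  qed
  have I_0: "0 \<in> I N" for N
    unfolding I_def using AP_0 by (auto intro!: exI[of _ "\<lambda>_. 0"])
  have I_diff: "x - y \<in> I N" if "x \<in> I N" "y \<in> I N" for x y N
  proof -
    have "-1 \<in> ?AP" using AP_diff[OF AP_0 AP_1] by simp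
    from I_mult[OF that(2) this] have "- y \<in> I N" by simp
    with I_add[OF that(1) this] show ?thesis by simp
  qed
  have I_sum: "(\<And>i. i \<in> S \<Longrightarrow> f i \<in> I N) \<Longrightarrow> sum f S \<in> I N" for S :: "nat set" and f N
    by (induction S rule: infinite_finite_induct) (auto intro: I_add I_0)
  have I_AP: "I N \<subseteq> ?AP" for N
  proof
    fix x assume "x \<in> I N"
    then obtain u where u: "\<forall>k. u k \<in> ?AP" "x = (\<Sum>k<N. u k * a k)" unfolding I_def by blast
    have "a k \<in> ?AP" for k using a by blast
    then have "u k * a k \<in> ?AP" for k using AP_mult u(1) by blast
    then have "coeff (u k * a k) i \<in> sring G" for k i by blast
    then show "x \<in> ?AP" unfolding u(2) by (auto simp: coeff_sum intro!: sring_sum)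
  qed
  have a_in: "a N \<in> I (Suc N)" for N
  proof -
    let ?u = "\<lambda>k. if k = N then 1 else (0 :: 'b poly)"
    have "a N = (\<Sum>k<Suc N. ?u k * a k)" by simp
    moreover have "\<forall>k. ?u k \<in> ?AP" using AP_0 AP_1 by presburger
    ultimately show ?thesis unfolding I_def mem_Collect_eq by (intro exI[of _ ?u] conjI)
  qed
  have a_notin: "a N \<notin> I N" for N
  proof
    assume "a N \<in> I N"
    then obtain u where "a N = (\<Sum>k<N. u k * a k)" "\<forall>k. u k \<in> ?AP" unfolding I_def by blast
    then have "(\<forall>k. u k \<in> ?AP) \<and> a N = (\<Sum>k<N. u k * a k)" by (intro conjI)
    then have "\<exists>K u. (\<forall>k. u k \<in> ?AP) \<and> a K = (\<Sum>k<K. u k * a k)" by (intro exI)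
    with contra show False by (rule notE)
  qed
  have ne: "a N \<in> J - I N" for N
    using a_in[of N] a_notin[of N] by (auto simp: J_def)
  define f where "f = (\<lambda>N. arg_min degree (\<lambda>g. g \<in> J - I N))"
  have f: "f N \<in> J - I N" "g \<in> J - I N \<Longrightarrow> degree (f N) \<le> degree g" for N g
    unfolding f_def by (rule arg_min_natI[of "\<lambda>g. g \<in> J - I N", OF ne])
      (rule arg_min_nat_le[of "\<lambda>g. g \<in> J - I N" g degree])
  have "\<exists>N'. N \<le> N' \<and> f N \<in> I N'" for N
  proof -
    from f(1)[of N] obtain N0 where "f N \<in> I N0" by (auto simp: J_def)
    then show ?thesis using I_mono[of N0 "max N N0"] by (intro exI[of _ "max N N0"]) auto
  qed
  then obtain M where M: "\<And>N. N \<le> M N" "\<And>N. f N \<in> I (M N)" by metis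
  \<comment> \<open>Jumping along \<open>M\<close> puts each chosen element into the next partial
    ideal, so combinations of the \<open>g k\<close> with k < K lie in \<open>I (N K)\<close>, which
    \<open>g K\<close> avoids.\<close>
  define N where "N = (\<lambda>m. (M ^^ m) 0)"
  have N_Suc: "N (Suc m) = M (N m)" for m by (simp add: N_def)
  have N_mono: "N m \<le> N m'" if "m \<le> m'" for m m'
    by (rule lift_Suc_mono_le[OF _ that]) (simp add: N_Suc M(1))
  define g where "g = (\<lambda>m. f (N m))"
  have g_in: "g k \<in> I (N K)" if "k < K" for k K
  proof -
    have "g k \<in> I (N (Suc k))" unfolding g_def N_Suc by (rule M(2))
    with I_mono[OF N_mono[of "Suc k" K]] that show ?thesis by auto
  qed
  have g_deg: "degree (g k) \<le> degree (g K)" if "k < K" for k K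
  proof -
    have "g K \<in> J - I (N K)" unfolding g_def by (rule f(1))
    with I_mono[OF N_mono[of k K]] that have "g K \<in> J - I (N k)" by auto
    from f(2)[OF this] show ?thesis by (simp add: g_def)
  qed
  have "range (\<lambda>m. lead_coeff (g m)) \<subseteq> sring G"
    using f(1) I_AP unfolding g_def J_def by fastforce
  with assms[unfolded noeth_def, rule_format, of "\<lambda>m. lead_coeff (g m)"]
  obtain K u where u: "\<And>k. u k \<in> sring G"
    and K: "lead_coeff (g K) = (\<Sum>k<K. u k * lead_coeff (g k))" by blast
  \<comment> \<open>By minimality \<open>g K - h\<close> still has the degree of \<open>g K\<close>,
    but its coefficient there cancels. Hence it is 0, which lies in \<open>I (N K)\<close>.\<close>
  define h where "h = (\<Sum>k<K. monom (u k) (degree (g K) - degree (g k)) * g k)"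
  have h: "h \<in> I (N K)" unfolding h_def using g_in AP_monom[OF u] by (intro I_sum I_mult) auto
  have gK: "g K \<in> J" "g K \<notin> I (N K)" using f(1)[of "N K"] by (auto simp: g_def)
  then obtain L0 where "g K \<in> I L0" by (auto simp: J_def)
  then have "g K \<in> I (max L0 (N K))" using I_mono[of L0 "max L0 (N K)"] by auto
  moreover have "h \<in> I (max L0 (N K))" using h I_mono[of "N K" "max L0 (N K)"] by auto
  ultimately have "g K - h \<in> J" using I_diff unfolding J_def by blast
  moreover have nin: "g K - h \<notin> I (N K)" using I_add[OF _ h, of "g K - h"] gK(2) by auto
  ultimately have le: "degree (g K) \<le> degree (g K - h)" using f(2)[of "g K - h" "N K"] by (simp add: g_def)
  have "degree (monom (u k) (degree (g K) - degree (g k)) * g k) \<le> degree (g K)" if "k < K" for k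
  proof -
    have "degree (monom (u k) (degree (g K) - degree (g k)) * g k) \<le>
      degree (monom (u k) (degree (g K) - degree (g k))) + degree (g k)" by (rule degree_mult_le)
    also have "\<dots> \<le> (degree (g K) - degree (g k)) + degree (g k)"
      by (intro add_mono degree_monom_le) auto
    finally show ?thesis using g_deg[OF that] by simp
  qed
  then have "degree h \<le> degree (g K)" unfolding h_def by (intro degree_sum_le) auto
  then have "degree (g K - h) \<le> degree (g K)" by (intro degree_diff_le) auto
  with le have deg: "degree (g K - h) = degree (g K)" by simp
  have "coeff h (degree (g K)) = lead_coeff (g K)"
    unfolding h_def K coeff_sum using g_deg
    by (intro sum.cong) (auto simp: coeff_monom_mult)
  then have "lead_coeff (g K - h) = 0" by (simp add: deg)
  then have "g K - h = 0" by (simp only: leading_coeff_0_iff)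
  with nin I_0 show False by simp
qed

lemma noeth_hom_image:
  assumes "noeth A" "\<And>x y. h (x + y) = h x + h y" "\<And>x y. h (x * y) = h x * h y" "h 0 = 0"
  shows "noeth (h ` A)"
  unfolding noeth_def
proof (intro allI impI)
  fix a :: "nat \<Rightarrow> 'b" assume "range a \<subseteq> h ` A"
  then have "\<forall>k. \<exists>b \<in> A. a k = h b" by blast
  then obtain b where b: "\<And>k. b k \<in> A" "\<And>k. a k = h (b k)" by metis
  then obtain K u where u: "\<forall>k. u k \<in> A" "b K = (\<Sum>k<K. u k * b k)"
    using assms(1) unfolding noeth_def by (metis image_subsetI)
  have hs: "h (sum f S) = (\<Sum>i\<in>S. h (f i))" for f and S :: "nat set"
    by (induction S rule: infinite_finite_induct) (auto simp: assms)
  show "\<exists>K u. (\<forall>k. u k \<in> h ` A) \<and> a K = (\<Sum>k<K. u k * a k)"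
    using u by (intro exI[of _ K] exI[of _ "h \<circ> u"]) (auto simp: b(2) hs assms)
qed

text \<open>Evaluation at \<open>v\<close> maps the polynomials over \<open>sring G\<close> onto
  \<open>sring (insert v G)\<close>.\<close>

lemma noeth_sring_insert:
  fixes G :: "'b::comm_ring_1 set"
  assumes "noeth (sring G)"
  shows "noeth (sring (insert v G))"
proof -
  let ?AP = "{P. \<forall>i. coeff P i \<in> sring G}"
  have "sring (insert v G) = (\<lambda>P. poly P v) ` ?AP" (is "?L = ?R")
  proof
    have "?R \<subseteq> ?L"
    proof
      fix x assume "x \<in> ?R"
      then obtain P where P: "\<forall>i. coeff P i \<in> sring G" "x = poly P v" by auto
      have "sring G \<subseteq> ?L" by (rule sring_mono) (auto intro: sring_gen)
      then show "x \<in> ?L" unfolding P(2) poly_altdef using P(1)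
        by (intro sring_sum sring_mult sring_power) (auto intro: sring_gen)
    qed
    then show "?R \<subseteq> ?L" .
    show "?L \<subseteq> ?R"
    proof
      fix x assume "x \<in> ?L"
      then show "x \<in> ?R"
      proof induction
        case (sring_gen g)
        show ?case
        proof (cases "g = v")
          case True
          then show ?thesis
            by (intro image_eqI[of _ _ "[:0,1:]"]) (auto simp: coeff_pCons intro: sring_0 sring_1 split: nat.splits)
        next
          case False
          then show ?thesis using sring_gen
            by (intro image_eqI[of _ _ "[:g:]"]) (auto simp: coeff_pCons intro: sring.intros split: nat.splits)
        qed
      next
        case sring_0 show ?case by (intro image_eqI[of _ _ 0]) (auto intro: sring.sring_0)
      next
        case sring_1 show ?case by (intro image_eqI[of _ _ 1]) (auto intro: sring.intros)
      next
        case (sring_minus x)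
        then obtain P where "P \<in> ?AP" "x = poly P v" by auto
        then show ?case by (intro image_eqI[of _ _ "-P"]) (auto intro: sring.intros)
      next
        case (sring_add x y)
        then obtain P Q where "P \<in> ?AP" "x = poly P v" "Q \<in> ?AP" "y = poly Q v" by auto
        then show ?case by (intro image_eqI[of _ _ "P+Q"]) (auto intro: sring.intros)
      next
        case (sring_mult x y)
        then obtain P Q where "P \<in> ?AP" "x = poly P v" "Q \<in> ?AP" "y = poly Q v" by auto
        then show ?case by (intro image_eqI[of _ _ "P*Q"]) (auto simp: coeff_mult intro!: sring_sum sring.sring_mult)
      qed
    qed
  qed
  then show ?thesis using noeth_hom_image[OF noeth_Hilbert[OF assms], of "\<lambda>P. poly P v"] by simp
qed

lemma noeth_sring_finite:
  assumes "noeth (sring G)" "finite F"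
  shows "noeth (sring (F \<union> G))"
  using assms(2,1) by (induction F) (auto intro: noeth_sring_insert)

text \<open>The constants, from which the finite extensions start. In a field two terms of the
  sequence suffice: either the first is 0, the empty sum, or it divides the second.\<close>

lemma noeth_sring_field:
  fixes C :: "'k::field \<Rightarrow> 'b::comm_ring_1"
  assumes "\<And>x y. C (x + y) = C x + C y" "\<And>x y. C (x * y) = C x * C y" "C 1 = 1"
  shows "noeth (sring (range C))"
proof -
  have C0: "C 0 = 0" using assms(1)[of 0 0] by simp
  have Cm: "C (- x) = - C x" for x using assms(1)[of x "-x"] C0 by (simp add: eq_neg_iff_add_eq_0 add.commute)
  have eq: "sring (range C) = range C"
  proof
    show "range C \<subseteq> sring (range C)" by (auto intro: sring_gen)
    show "sring (range C) \<subseteq> range C"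
    proof
      fix x assume "x \<in> sring (range C)"
      then show "x \<in> range C"
        by induction (auto simp flip: assms(1,2) Cm intro: rangeI[of C 0, unfolded C0] rangeI[of C 1, unfolded assms(3)])
    qed
  qed
  show ?thesis unfolding noeth_def eq
  proof (intro allI impI)
    fix a :: "nat \<Rightarrow> 'b" assume "range a \<subseteq> range C"
    then have "\<forall>k. \<exists>c. a k = C c" by blast
    then obtain c where c: "\<And>k. a k = C (c k)" by metis
    show "\<exists>K u. (\<forall>k. u k \<in> range C) \<and> a K = (\<Sum>k<K. u k * a k)"
    proof (cases "c 0 = 0")
      case True
      then show ?thesis using C0 c by (intro exI[of _ 0] exI[of _ "\<lambda>_. C 0"]) auto
    next
      case False
      then have "a 1 = C (c 1 / c 0) * a 0" by (simp add: c flip: assms(2))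
      then show ?thesis by (intro exI[of _ 1] exI[of _ "\<lambda>_. C (c 1 / c 0)"]) auto
    qed
  qed
qed

section \<open>Powers of a maximal ideal and Krull intersection\<close>

lemma polyfun_sum:
  assumes "\<And>x. x \<in> S \<Longrightarrow> p x \<in> polyfun I"
  shows "(\<lambda>f. \<Sum>x\<in>S. p x f) \<in> polyfun I"
  using assms by (induction S rule: infinite_finite_induct) (auto intro: polyfun.intros)

lemma polyfun_prod:
  assumes "\<And>x. x \<in> S \<Longrightarrow> p x \<in> polyfun I"
  shows "(\<lambda>f. \<Prod>x\<in>S. p x f) \<in> polyfun I"
  using assms by (induction S rule: infinite_finite_induct) (auto intro: polyfun.intros)

lemma polyfun_uminus: "p \<in> polyfun I \<Longrightarrow> (\<lambda>f. - p f) \<in> polyfun I"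
  using pmult[OF pconst[of "-1"], of p I] by simp

lemma polyfun_diff: "p \<in> polyfun I \<Longrightarrow> q \<in> polyfun I \<Longrightarrow> (\<lambda>f. p f - q f) \<in> polyfun I"
  using padd[OF _ polyfun_uminus, of p I q] by simp

text \<open>Restriction to a polynomial path reduces questions about polynomial functions to
  univariate polynomials, which have finitely many roots or vanish.\<close>

lemma polyfun_path:
  assumes "p \<in> polyfun I" "\<And>i. i \<in> I \<Longrightarrow> \<exists>P. \<forall>s. x s i = poly P s"
  shows "\<exists>P. \<forall>s. p (x s) = poly P s"
  using assms(1)
proof induction
  case (pconst c)
  show ?case by (rule exI[of _ "[:c:]"]) simp
next
  case (pvar i)
  then show ?case using assms(2) by simp
next
  case (padd p q)
  then obtain P Q where "\<forall>s. p (x s) = poly P s" "\<forall>s. q (x s) = poly Q s" by blast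
  then show ?case by (intro exI[of _ "P + Q"]) simp
next
  case (pmult p q)
  then obtain P Q where "\<forall>s. p (x s) = poly P s" "\<forall>s. q (x s) = poly Q s" by blast
  then show ?case by (intro exI[of _ "P * Q"]) simp
qed

text \<open>\<open>mpow I z k\<close> is the \<open>k\<close>-th power of the maximal ideal of the point \<open>z\<close>.\<close>
fun mpow :: "'a set \<Rightarrow> ('a \<Rightarrow> complex) \<Rightarrow> nat \<Rightarrow> (('a \<Rightarrow> complex) \<Rightarrow> complex) set" where
  "mpow I z 0 = polyfun I"
| "mpow I z (Suc k) = {\<lambda>x. \<Sum>i\<in>I. (x i - z i) * q i x | q. \<forall>i. q i \<in> mpow I z k}"

fun homog :: "'a set \<Rightarrow> nat \<Rightarrow> (('a \<Rightarrow> complex) \<Rightarrow> complex) set" where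
  "homog I 0 = range (\<lambda>c u. c)"
| "homog I (Suc k) = {\<lambda>u. \<Sum>i\<in>I. u i * q i u | q. \<forall>i. q i \<in> homog I k}"

lemma mpow_SucI: "(\<And>i. q i \<in> mpow I z k) \<Longrightarrow> (\<lambda>x. \<Sum>i\<in>I. (x i - z i) * q i x) \<in> mpow I z (Suc k)"
  by auto

lemma homog_SucI: "(\<And>i. q i \<in> homog I k) \<Longrightarrow> (\<lambda>u. \<Sum>i\<in>I. u i * q i u) \<in> homog I (Suc k)"
  by auto

lemma mpow_polyfun: "p \<in> mpow I z k \<Longrightarrow> p \<in> polyfun I"
proof (induction k arbitrary: p)
  case (Suc k)
  then obtain q where "p = (\<lambda>x. \<Sum>i\<in>I. (x i - z i) * q i x)" "\<And>i. q i \<in> polyfun I" by auto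
  then show ?case by (auto intro!: polyfun_sum pmult polyfun_diff pvar pconst)
qed simp

lemma mpow_const_0: "(\<lambda>x. 0) \<in> mpow I z k"
proof (induction k)
  case (Suc k)
  from mpow_SucI[of "\<lambda>_ _. 0", OF Suc] show ?case by simp
qed (simp add: pconst)

lemma mpow_add: "p \<in> mpow I z k \<Longrightarrow> q \<in> mpow I z k \<Longrightarrow> (\<lambda>x. p x + q x) \<in> mpow I z k"
proof (induction k arbitrary: p q)
  case (Suc k)
  then obtain p' q' where "p = (\<lambda>x. \<Sum>i\<in>I. (x i - z i) * p' i x)" "\<And>i. p' i \<in> mpow I z k"
     "q = (\<lambda>x. \<Sum>i\<in>I. (x i - z i) * q' i x)" "\<And>i. q' i \<in> mpow I z k" by auto
  with mpow_SucI[of "\<lambda>i x. p' i x + q' i x" I z k] Suc.IH show ?case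
    by (simp add: sum.distrib distrib_left)
qed (simp add: padd)

lemma mpow_mult_polyfun: "p \<in> polyfun I \<Longrightarrow> q \<in> mpow I z k \<Longrightarrow> (\<lambda>x. p x * q x) \<in> mpow I z k"
proof (induction k arbitrary: q)
  case (Suc k)
  then obtain q' where "q = (\<lambda>x. \<Sum>i\<in>I. (x i - z i) * q' i x)" "\<And>i. q' i \<in> mpow I z k" by auto
  with mpow_SucI[of "\<lambda>i x. p x * q' i x" I z k] Suc.IH Suc.prems show ?case
    by (simp add: sum_distrib_left mult.left_commute)
qed (simp add: pmult)

lemma mpow_cmult: "q \<in> mpow I z k \<Longrightarrow> (\<lambda>x. c * q x) \<in> mpow I z k"
  using mpow_mult_polyfun[OF pconst] .

lemma mpow_sum:
  assumes "\<And>x. x \<in> S \<Longrightarrow> p x \<in> mpow I z k"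
  shows "(\<lambda>f. \<Sum>x\<in>S. p x f) \<in> mpow I z k"
  using assms by (induction S rule: infinite_finite_induct) (auto intro: mpow_const_0 mpow_add)

lemma mpow_mult: "p \<in> mpow I z j \<Longrightarrow> q \<in> mpow I z k \<Longrightarrow> (\<lambda>x. p x * q x) \<in> mpow I z (j + k)"
proof (induction j arbitrary: p)
  case 0
  then show ?case by (simp add: mpow_mult_polyfun)
next
  case (Suc j)
  then obtain p' where "p = (\<lambda>x. \<Sum>i\<in>I. (x i - z i) * p' i x)" "\<And>i. p' i \<in> mpow I z j" by auto
  with mpow_SucI[of "\<lambda>i x. p' i x * q x" I z "j + k"] Suc.IH Suc.prems show ?case
    by (simp add: sum_distrib_right mult.assoc)
qed

lemma mpow_Suc_subset: "mpow I z (Suc k) \<subseteq> mpow I z k"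
proof
  fix p assume "p \<in> mpow I z (Suc k)"
  then show "p \<in> mpow I z k"
  proof (induction k arbitrary: p)
    case 0
    from mpow_polyfun[OF this] show ?case by simp
  next
    case (Suc k)
    from Suc.prems obtain q where q: "p = (\<lambda>x. \<Sum>i\<in>I. (x i - z i) * q i x)" "\<And>i. q i \<in> mpow I z (Suc k)"
      by (subst (asm) (1) mpow.simps(2)) blast
    show ?case unfolding q(1) by (rule mpow_SucI) (rule Suc.IH[OF q(2)])
  qed
qed

lemma mpow_antimono: "j \<le> k \<Longrightarrow> mpow I z k \<subseteq> mpow I z j"
  by (rule lift_Suc_antimono_le[of "mpow I z", OF mpow_Suc_subset])

lemma mpow_var:
  assumes "finite I" "i \<in> I"
  shows "(\<lambda>x. x i - z i) \<in> mpow I z (Suc 0)"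
proof -
  have "(\<lambda>x. \<Sum>j\<in>I. (x j - z j) * (if j = i then 1 else 0)) \<in> mpow I z (Suc 0)"
    by (rule mpow_SucI[of "\<lambda>j x. if j = i then 1 else 0"]) (auto intro: pconst)
  then show ?thesis using assms by (simp add: if_distrib[of "\<lambda>x. _ * x"] cong: if_cong)
qed

lemma polyfun_minus_value_mpow:
  assumes "finite I" "p \<in> polyfun I"
  shows "(\<lambda>x. p x - p z) \<in> mpow I z (Suc 0)"
  using assms(2)
proof induction
  case (pconst c)
  then show ?case by (simp only: diff_self mpow_const_0)
next
  case (pvar i)
  then show ?case using mpow_var[OF assms(1)] by simp
next
  case (padd p q)
  from mpow_add[OF padd.IH] show ?case by (simp add: algebra_simps)
next
  case (pmult p q)
  from mpow_add[OF mpow_mult_polyfun[OF pmult.hyps(1) pmult.IH(2)] mpow_cmult[OF pmult.IH(1), of "q z"]]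
  show ?case by (simp add: algebra_simps)
qed

lemma homog_polyfun: "h \<in> homog I k \<Longrightarrow> h \<in> polyfun I"
proof (induction k arbitrary: h)
  case (Suc k)
  then obtain q where "h = (\<lambda>x. \<Sum>i\<in>I. x i * q i x)" "\<And>i. q i \<in> polyfun I" by auto
  then show ?case by (auto intro!: polyfun_sum pmult pvar)
qed (auto intro: pconst)

lemma homog_scale: "h \<in> homog I k \<Longrightarrow> h (\<lambda>i. s * u i) = s ^ k * h u"
proof (induction k arbitrary: h)
  case (Suc k)
  then obtain q where "h = (\<lambda>x. \<Sum>i\<in>I. x i * q i x)" "\<And>i. q i \<in> homog I k" by auto
  then show ?case by (auto simp: Suc.IH sum_distrib_left mult_ac)
qed auto

lemma homog_shift_mpow: "h \<in> homog I k \<Longrightarrow> (\<lambda>x. h (\<lambda>i. x i - z i)) \<in> mpow I z k"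
proof (induction k arbitrary: h)
  case 0
  then show ?case by (auto intro: pconst)
next
  case (Suc k)
  then obtain q where "h = (\<lambda>x. \<Sum>i\<in>I. x i * q i x)" "\<And>i. q i \<in> homog I k" by auto
  then show ?case using mpow_SucI[of "\<lambda>i x. q i (\<lambda>i. x i - z i)"] Suc.IH by blast
qed

text \<open>The lowest term of the Taylor expansion at \<open>z\<close>. The smooth point argument
  removes it on X, raising the order of vanishing by one.\<close>

lemma mpow_leading_form:
  assumes "finite I" "g \<in> mpow I z k"
  shows "\<exists>h \<in> homog I k. (\<lambda>x. g x - h (\<lambda>i. x i - z i)) \<in> mpow I z (Suc k)"
  using assms(2)
proof (induction k arbitrary: g)
  case 0
  then have "g \<in> polyfun I" by simp
  from polyfun_minus_value_mpow[OF assms(1) this] show ?case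
    by (intro bexI[of _ "\<lambda>_. g z"]) auto
next
  case (Suc k)
  then obtain q where q: "g = (\<lambda>x. \<Sum>i\<in>I. (x i - z i) * q i x)" "\<And>i. q i \<in> mpow I z k" by auto
  from Suc.IH[OF q(2)] obtain h where h: "\<And>i. h i \<in> homog I k"
    "\<And>i. (\<lambda>x. q i x - h i (\<lambda>i. x i - z i)) \<in> mpow I z (Suc k)" by metis
  have "(\<lambda>u. \<Sum>i\<in>I. u i * h i u) \<in> homog I (Suc k)" by (rule homog_SucI) (rule h(1))
  moreover have "(\<lambda>x. \<Sum>i\<in>I. (x i - z i) * (q i x - h i (\<lambda>i. x i - z i))) \<in> mpow I z (Suc (Suc k))"
    by (rule mpow_SucI) (rule h(2))
  ultimately show ?case
    by (intro bexI[of _ "\<lambda>u. \<Sum>i\<in>I. u i * h i u"])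
      (simp_all add: q(1) sum_subtractf right_diff_distrib del: mpow.simps homog.simps)
qed

lemma zirredD:
  assumes "zirred I X" "zclosed I Z1" "zclosed I Z2" "X \<subseteq> Z1 \<union> Z2"
  shows "X \<subseteq> Z1 \<or> X \<subseteq> Z2"
  using assms unfolding zirred_def by metis

lemma fun_sum_apply: "(\<Sum>i\<in>S. f i) x = (\<Sum>i\<in>S. f i x)"
  by (induction S rule: infinite_finite_induct) auto

text \<open>Composition with the retraction \<open>\<iota>\<close> replaces the quotient by the ideal of \<open>X\<close>. In the Rees algebra, which
  is noetherian, some \<open>f t^K\<close> is a combination of the \<open>f t^k\<close> with \<open>k < K\<close>; comparing coefficients of \<open>t^K\<close> gives
  \<open>f = y f\<close> with \<open>y\<close> in the maximal ideal.\<close>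
lemma Krull_intersection:
  fixes I :: "'a set"
  assumes I: "finite I" and X: "zirred I X" and z: "z \<in> X" and f: "f \<in> polyfun I"
    and van: "\<And>k. \<exists>g \<in> mpow I z k. \<forall>x\<in>X. f x = g x"
    and x: "x \<in> X"
  shows "f x = 0"
proof -
  define \<iota> where "\<iota> = (\<lambda>x. if x \<in> X then x else z)"
  have \<iota>: "\<iota> x \<in> X" for x using z by (simp add: \<iota>_def)
  define u :: "'a \<Rightarrow> ('a \<Rightarrow> complex) \<Rightarrow> complex" where "u = (\<lambda>i x. \<iota> x i - z i)"
  define C :: "complex \<Rightarrow> (('a \<Rightarrow> complex) \<Rightarrow> complex) poly" where "C = (\<lambda>c. [:\<lambda>_. c:])"
  define G where "G = (\<lambda>i. [:u i:]) ` I \<union> (\<lambda>i. monom (u i) 1) ` I"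
  let ?R = "sring (G \<union> range C)"
  have "[:\<lambda>_. 1:] = (1 :: (('a \<Rightarrow> complex) \<Rightarrow> complex) poly)"
    using pCons_one[where 'a = "('a \<Rightarrow> complex) \<Rightarrow> complex"] by (simp only: one_fun_def)
  then have noe: "noeth ?R"
    using I by (intro noeth_sring_finite noeth_sring_field)
      (auto simp: C_def G_def fun_eq_iff plus_fun_def times_fun_def)
  have R_const: "[:\<lambda>_. c:] \<in> ?R" for c by (rule sring_gen) (auto simp: C_def)
  have R_u: "[:u i:] \<in> ?R" if "i \<in> I" for i using that by (auto simp: G_def intro: sring_gen)
  have R_t: "monom (u i) 1 \<in> ?R" if "i \<in> I" for i using that by (auto simp: G_def intro!: sring_gen)
  have poly_R: "[:p \<circ> \<iota>:] \<in> ?R" if "p \<in> polyfun I" for p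
    using that
  proof induction
    case (pconst c)
    then show ?case using R_const by (simp add: comp_def)
  next
    case (pvar i)
    from sring_add[OF R_u[OF pvar] R_const[of "z i"]] show ?case
      by (simp add: u_def comp_def plus_fun_def)
  next
    case (padd p q)
    from sring_add[OF padd.IH] show ?case by (simp add: comp_def plus_fun_def)
  next
    case (pmult p q)
    from sring_mult[OF pmult.IH] show ?case by (simp add: comp_def times_fun_def mult.commute)
  qed
  have mpow_R: "monom (p \<circ> \<iota>) k \<in> ?R" if "p \<in> mpow I z k" for p k
    using that
  proof (induction k arbitrary: p)
    case 0
    then show ?case using poly_R[of p] by (simp add: monom_0 comp_def)
  next
    case (Suc k)
    then obtain q where q: "p = (\<lambda>x. \<Sum>i\<in>I. (x i - z i) * q i x)" "\<And>i. q i \<in> mpow I z k" by auto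
    have "monom (p \<circ> \<iota>) (Suc k) = (\<Sum>i\<in>I. monom (u i) 1 * monom (q i \<circ> \<iota>) k)"
    proof -
      have "p \<circ> \<iota> = (\<Sum>i\<in>I. u i * (q i \<circ> \<iota>))"
        by (rule ext) (simp add: q(1) u_def fun_sum_apply)
      then show ?thesis by (simp add: mult_monom monom_sum)
    qed
    also have "\<dots> \<in> ?R" using Suc.IH[OF q(2)] R_t by (intro sring_sum sring_mult)
    finally show ?case .
  qed
  \<comment> \<open>The variable t enters the Rees algebra only with a factor \<open>u i\<close>,
    and these vanish at \<open>z\<close>.\<close>
  have R_coeff: "coeff P (Suc k) z = 0" if "P \<in> ?R" for P k
    using that
  proof (induction arbitrary: k)
    case (sring_gen g)
    have "\<iota> z = z" using z by (simp add: \<iota>_def)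
    then show ?case using sring_gen by (auto simp: G_def C_def u_def)
  next
    case (sring_mult P Q)
    have "coeff P i z * coeff Q (Suc k - i) z = 0" if "i \<le> Suc k" for i
      using sring_mult.IH by (cases i; cases "Suc k - i") auto
    then have "(\<Sum>i\<le>Suc k. coeff P i z * coeff Q (Suc k - i) z) = 0"
      by (intro sum.neutral) auto
    then show ?case by (simp add: coeff_mult fun_sum_apply del: sum.atMost_Suc)
  qed auto
  have "range (\<lambda>k. monom (f \<circ> \<iota>) k) \<subseteq> ?R"
  proof safe
    fix k
    obtain g where g: "g \<in> mpow I z k" "\<forall>x\<in>X. f x = g x" using van by blast
    have "f \<circ> \<iota> = g \<circ> \<iota>" using g(2) \<iota> by auto
    with mpow_R[OF g(1)] show "monom (f \<circ> \<iota>) k \<in> ?R" by simp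
  qed
  with noe obtain K w where w: "\<And>k. w k \<in> ?R"
    and K: "monom (f \<circ> \<iota>) K = (\<Sum>k<K. w k * monom (f \<circ> \<iota>) k)" unfolding noeth_def by blast
  define y where "y = (\<Sum>k<K. coeff (w k) (K - k))"
  have "f \<circ> \<iota> = coeff (monom (f \<circ> \<iota>) K) K" by simp
  also have "\<dots> = (\<Sum>k<K. coeff (w k) (K - k) * (f \<circ> \<iota>))"
    unfolding K coeff_sum
  proof (intro sum.cong refl)
    fix k assume "k \<in> {..<K}"
    then show "coeff (w k * monom (f \<circ> \<iota>) k) K = coeff (w k) (K - k) * (f \<circ> \<iota>)"
      by (subst mult.commute[of "w k"], subst coeff_monom_mult) (simp add: mult.commute)
  qed
  also have "\<dots> = y * (f \<circ> \<iota>)" by (simp add: y_def sum_distrib_right)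
  finally have yf: "f \<circ> \<iota> = y * (f \<circ> \<iota>)" .
  have fy: "f x = y x * f x" if "x \<in> X" for x
    using fun_cong[OF yf, of x] that by (simp add: \<iota>_def)
  have yz: "y z = 0" unfolding y_def fun_sum_apply
  proof (intro sum.neutral ballI)
    fix k assume "k \<in> {..<K}"
    then obtain j where "K - k = Suc j" by (metis Suc_diff_Suc lessThan_iff)
    then show "coeff (w k) (K - k) z = 0" using R_coeff[OF w] by simp
  qed
  \<comment> \<open>Coefficients in the Rees algebra are functions composed with \<iota>; on X they
    agree with polynomials, so that 1 - y defines a closed set.\<close>
  have R_poly: "\<exists>p \<in> polyfun I. \<forall>x\<in>X. coeff P k x = p x" if "P \<in> ?R" for P k
    using that
  proof (induction arbitrary: k)
    case (sring_gen g)
    have "(\<lambda>x. x i - z i) \<in> polyfun I" if "i \<in> I" for i using that by (intro polyfun_diff pvar pconst)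
    moreover have "\<forall>x\<in>X. u i x = x i - z i" for i by (simp add: u_def \<iota>_def)
    ultimately have ui: "\<exists>p \<in> polyfun I. \<forall>x\<in>X. u i x = p x" if "i \<in> I" for i
      using that by (intro bexI[of _ "\<lambda>x. x i - z i"]) auto
    consider "coeff g k = 0" | i where "i \<in> I" "coeff g k = u i" | c where "coeff g k = (\<lambda>_. c)"
      using sring_gen by (cases k; cases "Suc 0 = k"; auto simp: G_def C_def)
    then show ?case
    proof cases
      case 1
      then show ?thesis by (intro bexI[OF _ pconst[of 0]]) simp
    next
      case 2
      then show ?thesis using ui by simp
    next
      case (3 c)
      then show ?thesis by (intro bexI[OF _ pconst[of c]]) simp
    qed
  next
    case sring_0 show ?case by (rule bexI[OF _ pconst[of 0]]) simp
  next
    case sring_1 show ?case by (rule bexI[OF _ pconst[of "of_bool (k = 0)"]]) (simp add: one_fun_def)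
  next
    case (sring_minus P)
    then obtain p where "p \<in> polyfun I" "\<forall>x\<in>X. coeff P k x = p x" by blast
    then show ?case using polyfun_uminus by (intro bexI[of _ "\<lambda>x. - p x"]) auto
  next
    case (sring_add P Q)
    from sring_add.IH[of k] obtain p q where "p \<in> polyfun I" "\<forall>x\<in>X. coeff P k x = p x"
      "q \<in> polyfun I" "\<forall>x\<in>X. coeff Q k x = q x" by blast
    then show ?case using padd by (intro bexI[of _ "\<lambda>x. p x + q x"]) auto
  next
    case (sring_mult P Q)
    then obtain p q where "\<And>k. p k \<in> polyfun I" "\<And>k. \<forall>x\<in>X. coeff P k x = p k x"
      "\<And>k. q k \<in> polyfun I" "\<And>k. \<forall>x\<in>X. coeff Q k x = q k x" by metis
    then show ?case
      by (intro bexI[of _ "\<lambda>x. \<Sum>i\<le>k. p i x * q (k - i) x"])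
        (auto simp: coeff_mult fun_sum_apply intro!: polyfun_sum pmult)
  qed
  have "\<forall>k. \<exists>p \<in> polyfun I. \<forall>x\<in>X. coeff (w k) (K - k) x = p x" using R_poly[OF w] by blast
  then obtain p where p: "\<And>k. p k \<in> polyfun I" "\<And>k. \<forall>x\<in>X. coeff (w k) (K - k) x = p k x" by metis
  let ?Y = "\<lambda>x. 1 - (\<Sum>k<K. p k x)"
  have Y: "y x = (\<Sum>k<K. p k x)" if "x \<in> X" for x using that p(2) by (simp add: y_def fun_sum_apply)
  \<comment> \<open>From f (1 - y) = 0 on X, the zeros of f and those of 1 - y cover X.
    Irreducibility selects the former because y vanishes at \<open>z\<close>.\<close>
  let ?Z1 = "{x \<in> aff I. \<forall>q\<in>{f}. q x = 0}" and ?Z2 = "{x \<in> aff I. \<forall>q\<in>{?Y}. q x = 0}"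
  have "zclosed I ?Z1" unfolding zclosed_def using f by blast
  moreover have "zclosed I ?Z2" unfolding zclosed_def
    using polyfun_diff[OF pconst[of 1] polyfun_sum[of "{..<K}" p, OF p(1)]] by blast
  moreover have "X \<subseteq> aff I" using X by (simp add: zirred_def)
  moreover from this have "X \<subseteq> ?Z1 \<union> ?Z2" using fy Y by fastforce
  ultimately have "X \<subseteq> ?Z1 \<or> X \<subseteq> ?Z2" by (intro zirredD[OF X])
  moreover have "z \<notin> ?Z2" using yz Y[OF z] by simp
  ultimately have "x \<in> ?Z1" using z x by (meson subsetD)
  then show ?thesis by simp
qed

section \<open>Smooth points\<close>

text \<open>Gaussian elimination, one coordinate at a time. \<open>P\<close> sends every vector into
  the common kernel of \<Lambda>, and the rows of the identity minus \<open>P\<close> lie in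
  \<Lambda>; so modulo \<Lambda> each coordinate equals its projected one.\<close>

lemma exists_retraction_onto_common_kernel:
  fixes \<Lambda> :: "('a \<Rightarrow> complex) set"
  assumes "finite I"
    and "\<And>c d. c \<in> \<Lambda> \<Longrightarrow> d \<in> \<Lambda> \<Longrightarrow> (\<lambda>i. c i + d i) \<in> \<Lambda>"
    and "\<And>s c. c \<in> \<Lambda> \<Longrightarrow> (\<lambda>i. s * c i) \<in> \<Lambda>"
    and "(\<lambda>i. 0) \<in> \<Lambda>"
    and "\<And>c i. c \<in> \<Lambda> \<Longrightarrow> i \<notin> I \<Longrightarrow> c i = 0"
  shows "\<exists>P. (\<forall>i\<in>I. (\<lambda>j. of_bool (j = i) - P i j) \<in> \<Lambda>) \<and>
     (\<forall>c\<in>\<Lambda>. \<forall>u. (\<Sum>i\<in>I. c i * (\<Sum>j\<in>I. P i j * u j)) = 0)"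
  using assms
proof (induction I arbitrary: \<Lambda>)
  case empty
  then show ?case by simp
next
  case (insert k I)
  note add = insert.prems(1) and scale = insert.prems(2) and zero = insert.prems(3) and supp = insert.prems(4)
  have diff: "(\<lambda>i. c i - s * d i) \<in> \<Lambda>" if "c \<in> \<Lambda>" "d \<in> \<Lambda>" for c d s
    using add[OF that(1) scale[OF that(2), of "-s"]] by simp
  have sum: "(\<lambda>j. \<Sum>i\<in>S. s i * d i j) \<in> \<Lambda>" if "finite S" "\<And>i. i \<in> S \<Longrightarrow> d i \<in> \<Lambda>" for S :: "'a set" and s d
    using that
  proof (induction S)
    case empty
    show ?case using zero by simp
  next
    case (insert x F)
    then have "(\<lambda>j. s x * d x j) \<in> \<Lambda>" "(\<lambda>j. \<Sum>i\<in>F. s i * d i j) \<in> \<Lambda>" by (auto intro: scale)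
    from add[OF this] insert.hyps show ?case by simp
  qed
  define \<Lambda>' where "\<Lambda>' = {c \<in> \<Lambda>. c k = 0}"
  have supp': "c i = 0" if "c \<in> \<Lambda>'" "i \<notin> I" for c i
    using that supp[of c i] by (cases "i = k") (auto simp: \<Lambda>'_def)
  have "\<exists>P. (\<forall>i\<in>I. (\<lambda>j. of_bool (j = i) - P i j) \<in> \<Lambda>') \<and>
     (\<forall>c\<in>\<Lambda>'. \<forall>u. (\<Sum>i\<in>I. c i * (\<Sum>j\<in>I. P i j * u j)) = 0)"
  proof (rule insert.IH)
    show "c i = 0" if "c \<in> \<Lambda>'" "i \<notin> I" for c i using supp'[OF that] .
  qed (auto simp: \<Lambda>'_def intro: add scale zero)
  then obtain P where P0: "(\<forall>i\<in>I. (\<lambda>j. of_bool (j = i) - P i j) \<in> \<Lambda>') \<and>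
     (\<forall>c\<in>\<Lambda>'. \<forall>u. (\<Sum>i\<in>I. c i * (\<Sum>j\<in>I. P i j * u j)) = 0)" by (elim exE)
  note P = conjunct1[OF P0, rule_format] and ker = conjunct2[OF P0, rule_format]
  have Pk: "P i k = 0" if "i \<in> I" for i using P[OF that] insert.hyps that by (cases "k = i") (auto simp: \<Lambda>'_def)
  show ?case
  proof (cases "\<exists>l\<in>\<Lambda>. l k \<noteq> 0")
    case False
    \<comment> \<open>No functional involves coordinate \<open>k\<close>, which therefore stays
      free.\<close>
    define Q where "Q = (\<lambda>i j. if i = k then of_bool (j = k) else P i j)"
    have "(\<lambda>j. of_bool (j = i) - Q i j) \<in> \<Lambda>" if "i \<in> insert k I" for i
      using that P[of i] zero insert.hyps by (cases "i = k") (auto simp: Q_def \<Lambda>'_def)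
    moreover have "(\<Sum>i\<in>insert k I. c i * (\<Sum>j\<in>insert k I. Q i j * u j)) = 0" if "c \<in> \<Lambda>" for c u
    proof -
      have ck: "c k = 0" using False that by blast
      then have "(\<Sum>i\<in>insert k I. c i * (\<Sum>j\<in>insert k I. Q i j * u j)) = (\<Sum>i\<in>I. c i * (\<Sum>j\<in>I. P i j * u j))"
        using insert.hyps Pk by (auto simp: Q_def intro!: sum.cong)
      also have "\<dots> = 0" using ker[of c u] that ck by (auto simp: \<Lambda>'_def)
      finally show ?thesis .
    qed
    ultimately show ?thesis by blast
  next
    case True
    then obtain l' where "l' \<in> \<Lambda>" "l' k \<noteq> 0" by blast
    define l where "l = (\<lambda>i. inverse (l' k) * l' i)"
    have l: "l \<in> \<Lambda>" "l k = 1" using \<open>l' \<in> \<Lambda>\<close> \<open>l' k \<noteq> 0\<close> scale by (auto simp: l_def)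
    \<comment> \<open>The functional \<open>l\<close>, normalized to 1 at \<open>k\<close>,
      determines coordinate \<open>k\<close> from the others.\<close>
    define Q where "Q = (\<lambda>i j. if i = k then - (\<Sum>m\<in>I. l m * P m j) else P i j)"
    have "(\<lambda>j. of_bool (j = i) - Q i j) \<in> \<Lambda>" if i: "i \<in> insert k I" for i
    proof (cases "i = k")
      case False
      then show ?thesis using i P[of i] by (auto simp: Q_def \<Lambda>'_def)
    next
      case True
      have "(\<lambda>j. l j - 1 * (\<Sum>m\<in>I. l m * (of_bool (j = m) - P m j))) \<in> \<Lambda>"
        using P insert.hyps by (intro diff l sum) (auto simp: \<Lambda>'_def)
      also have "(\<lambda>j. l j - 1 * (\<Sum>m\<in>I. l m * (of_bool (j = m) - P m j))) = (\<lambda>j. of_bool (j = i) - Q i j)"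
      proof
        fix j
        have "(\<Sum>m\<in>I. l m * of_bool (j = m)) = (if j \<in> I then l j else 0)"
          using insert.hyps by (simp add: of_bool_def if_distrib[of "\<lambda>x. _ * x"] cong: if_cong)
        also have "\<dots> = l j - of_bool (j = k)" using supp[OF l(1), of j] l(2) insert.hyps by auto
        finally show "l j - 1 * (\<Sum>m\<in>I. l m * (of_bool (j = m) - P m j)) = of_bool (j = i) - Q i j"
          using True by (simp add: Q_def right_diff_distrib sum_subtractf)
      qed
      finally show ?thesis .
    qed
    moreover have "(\<Sum>i\<in>insert k I. c i * (\<Sum>j\<in>insert k I. Q i j * u j)) = 0" if c: "c \<in> \<Lambda>" for c u
    proof -
      define Pu where "Pu = (\<lambda>i. \<Sum>j\<in>I. P i j * u j)"
      have Qi: "(\<Sum>j\<in>insert k I. Q i j * u j) = Pu i" if "i \<in> I" for i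
        using that insert.hyps Pk[OF that] by (auto simp: Q_def Pu_def intro!: sum.cong)
      have Qk: "(\<Sum>j\<in>insert k I. Q k j * u j) = - (\<Sum>m\<in>I. l m * Pu m)"
      proof -
        have "(\<Sum>j\<in>insert k I. Q k j * u j) = (\<Sum>j\<in>I. - (\<Sum>m\<in>I. l m * P m j) * u j)"
          using insert.hyps Pk by (simp add: Q_def)
        also have "\<dots> = - (\<Sum>m\<in>I. \<Sum>j\<in>I. l m * P m j * u j)"
          by (subst sum.swap) (simp add: sum_negf sum_distrib_right)
        finally show ?thesis by (simp add: Pu_def sum_distrib_left mult.assoc)
      qed
      have "(\<Sum>i\<in>insert k I. c i * (\<Sum>j\<in>insert k I. Q i j * u j)) = c k * - (\<Sum>m\<in>I. l m * Pu m) + (\<Sum>i\<in>I. c i * Pu i)"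
        using insert.hyps Qi Qk by simp
      also have "\<dots> = (\<Sum>i\<in>I. (c i - c k * l i) * Pu i)"
        by (simp add: left_diff_distrib sum_subtractf sum_distrib_left mult.assoc)
      also have "\<dots> = 0" unfolding Pu_def using diff[OF c l(1), of "c k"] l(2)
        by (intro ker) (auto simp: \<Lambda>'_def)
      finally show ?thesis .
    qed
    ultimately show ?thesis by blast
  qed
qed

text \<open>The forms \<open>\<Sum>c\<^sub>i (x\<^sub>i - z\<^sub>i)\<close> that lie in the square of the maximal ideal are the equations of the Zariski
  tangent space of \<open>X\<close> at \<open>z\<close>; each tangent vector has to be the velocity of a polynomial path in \<open>A\<close>. If \<open>f\<close>
  vanishes on \<open>A\<close>, its leading form vanishes along these paths, hence on the tangent space, and so the order of
  vanishing can be increased indefinitely.\<close>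
lemma vanishing_near_smooth_point:
  fixes I :: "'a set" and X A :: "('a \<Rightarrow> complex) set"
  assumes I: "finite I" and X: "zirred I X" and AX: "A \<subseteq> X" and z: "z \<in> A" and f: "f \<in> polyfun I"
    and fA: "\<And>x. x \<in> A \<Longrightarrow> f x = 0"
    and paths: "\<And>v. v \<in> aff I \<Longrightarrow>
      (\<And>c. \<exists>g \<in> mpow I z 2. \<forall>x\<in>X. (\<Sum>i\<in>I. c i * (x i - z i)) = g x \<Longrightarrow> (\<Sum>i\<in>I. c i * v i) = 0) \<Longrightarrow>
      \<exists>e. (\<forall>i\<in>I. e i 0 = v i) \<and> (\<forall>i\<in>I. \<exists>P. \<forall>s. e i s = poly P s) \<and>
          (\<forall>s. \<exists>x\<in>A. \<forall>i\<in>I. x i = z i + s * e i s)"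
    and x: "x \<in> X"
  shows "f x = 0"
proof (rule Krull_intersection[OF I X _ f _ x])
  show "z \<in> X" using z AX by blast
  define eqv where "eqv = (\<lambda>k f. \<exists>g \<in> mpow I z k. \<forall>x\<in>X. f x = g x)"
  have eqv_mpow: "eqv k f" if "f \<in> mpow I z k" for k f using that by (auto simp: eqv_def)
  have eqv_add: "eqv k (\<lambda>x. f x + g x)" if "eqv k f" "eqv k g" for k f g
    using that mpow_add unfolding eqv_def by (metis (no_types, lifting))
  have eqv_mult: "eqv (j + k) (\<lambda>x. f x * g x)" if "eqv j f" "eqv k g" for j k f g
    using that mpow_mult unfolding eqv_def by (metis (no_types, lifting))
  have eqv_0: "eqv k (\<lambda>x. 0)" for k using eqv_mpow[OF mpow_const_0] .
  have eqv_sum: "eqv k (\<lambda>x. \<Sum>i\<in>S. f i x)" if "\<And>i. i \<in> S \<Longrightarrow> eqv k (f i)" for k f and S :: "'a set"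
    using that by (induction S rule: infinite_finite_induct) (auto intro: eqv_add eqv_0)
  have eqv_mono: "eqv j f" if "eqv k f" "j \<le> k" for j k f
    using that mpow_antimono unfolding eqv_def by blast
  define \<Lambda> where "\<Lambda> = {c. (\<forall>i. i \<notin> I \<longrightarrow> c i = 0) \<and> eqv 2 (\<lambda>x. \<Sum>i\<in>I. c i * (x i - z i))}"
  have "\<exists>P. (\<forall>i\<in>I. (\<lambda>j. of_bool (j = i) - P i j) \<in> \<Lambda>) \<and>
     (\<forall>c\<in>\<Lambda>. \<forall>u. (\<Sum>i\<in>I. c i * (\<Sum>j\<in>I. P i j * u j)) = 0)"
  proof (rule exists_retraction_onto_common_kernel[OF I])
    fix c d assume "c \<in> \<Lambda>" "d \<in> \<Lambda>"
    then show "(\<lambda>i. c i + d i) \<in> \<Lambda>"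
      using eqv_add[of 2 "\<lambda>x. \<Sum>i\<in>I. c i * (x i - z i)" "\<lambda>x. \<Sum>i\<in>I. d i * (x i - z i)"]
      by (simp add: \<Lambda>_def distrib_right sum.distrib)
  next
    fix s c assume "c \<in> \<Lambda>"
    then show "(\<lambda>i. s * c i) \<in> \<Lambda>"
      using eqv_mult[OF eqv_mpow[of "\<lambda>_. s" 0], of 2 "\<lambda>x. \<Sum>i\<in>I. c i * (x i - z i)"]
      by (simp add: \<Lambda>_def sum_distrib_left mult.assoc pconst numeral_2_eq_2)
  qed (auto simp: \<Lambda>_def eqv_0)
  then obtain P where P0: "(\<forall>i\<in>I. (\<lambda>j. of_bool (j = i) - P i j) \<in> \<Lambda>) \<and>
     (\<forall>c\<in>\<Lambda>. \<forall>u. (\<Sum>i\<in>I. c i * (\<Sum>j\<in>I. P i j * u j)) = 0)" by (elim exE)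
  note P = conjunct1[OF P0, rule_format] and ker = conjunct2[OF P0, rule_format]
  define \<pi> where "\<pi> = (\<lambda>u i. if i \<in> I then \<Sum>j\<in>I. P i j * u j else 0)"
  have \<pi>_eqv: "eqv 2 (\<lambda>x. (x i - z i) - \<pi> (\<lambda>i. x i - z i) i)" if "i \<in> I" for i
  proof -
    have "(\<Sum>j\<in>I. (of_bool (j = i) - P i j) * (x j - z j)) = (x i - z i) - \<pi> (\<lambda>i. x i - z i) i" for x
    proof -
      have "(\<Sum>j\<in>I. of_bool (j = i) * (x j - z j)) = x i - z i"
        using that I by (simp add: of_bool_def if_distrib[of "\<lambda>x. x * _"] cong: if_cong)
      then show ?thesis using that by (simp add: \<pi>_def left_diff_distrib[of _ _ "x _ - z _"] sum_subtractf)
    qed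
    then show ?thesis using P[OF that] by (simp add: \<Lambda>_def)
  qed
  have \<pi>_van: "(\<lambda>x. \<pi> (\<lambda>i. x i - z i) i) \<in> mpow I z 1" if "i \<in> I" for i
    using that I by (auto simp: \<pi>_def intro!: mpow_sum mpow_cmult mpow_var simp del: mpow.simps)
  \<comment> \<open>Coordinates differ from their projections by terms of second order on X, so a
    form may be evaluated at the projected vector at the cost of terms of one higher order.\<close>
  have homog_eqv: "eqv (Suc k) (\<lambda>x. h (\<lambda>i. x i - z i) - h (\<pi> (\<lambda>i. x i - z i)))
      \<and> (\<lambda>x. h (\<pi> (\<lambda>i. x i - z i))) \<in> mpow I z k" if "h \<in> homog I k" for h k
    using that
  proof (induction k arbitrary: h)
    case 0
    then show ?case using eqv_0 by (auto intro: pconst)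
  next
    case (Suc k)
    then obtain q where q: "h = (\<lambda>x. \<Sum>i\<in>I. x i * q i x)" "\<And>i. q i \<in> homog I k" by auto
    note IH = Suc.IH[OF q(2)]
    let ?u = "\<lambda>x i. x i - z i"
    have "eqv (Suc (Suc k)) (\<lambda>x. \<Sum>i\<in>I. (?u x i - \<pi> (?u x) i) * q i (?u x)
        + \<pi> (?u x) i * (q i (?u x) - q i (\<pi> (?u x))))"
    proof (intro eqv_sum eqv_add)
      fix i assume i: "i \<in> I"
      show "eqv (Suc (Suc k)) (\<lambda>x. (?u x i - \<pi> (?u x) i) * q i (?u x))"
        using eqv_mult[OF \<pi>_eqv[OF i] eqv_mpow[OF homog_shift_mpow[OF q(2)]]] by simp
      show "eqv (Suc (Suc k)) (\<lambda>x. \<pi> (?u x) i * (q i (?u x) - q i (\<pi> (?u x))))"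
        using eqv_mult[OF eqv_mpow[OF \<pi>_van[OF i]] conjunct1[OF IH]] by simp
    qed
    moreover have "(\<lambda>x. \<Sum>i\<in>I. \<pi> (?u x) i * q i (\<pi> (?u x))) \<in> mpow I z (Suc k)"
      using mpow_mult[OF \<pi>_van conjunct2[OF IH]] by (intro mpow_sum) (simp del: mpow.simps)
    ultimately show ?case by (simp add: q(1) algebra_simps sum_subtractf sum.distrib del: mpow.simps)
  qed
  have leading_0: "h (\<pi> u) = 0"
    if h: "h \<in> homog I k" and g: "g \<in> mpow I z k" and gA: "\<And>x. x \<in> A \<Longrightarrow> g x = 0"
      and gh: "(\<lambda>x. g x - h (\<lambda>i. x i - z i)) \<in> mpow I z (Suc k)" for h g u k
  proof -
    have "\<exists>e. (\<forall>i\<in>I. e i 0 = \<pi> u i) \<and> (\<forall>i\<in>I. \<exists>P. \<forall>s. e i s = poly P s) \<and>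
          (\<forall>s. \<exists>x\<in>A. \<forall>i\<in>I. x i = z i + s * e i s)"
    proof (rule paths)
      show "\<pi> u \<in> aff I" by (simp add: aff_def \<pi>_def)
      fix c assume "\<exists>g \<in> mpow I z 2. \<forall>x\<in>X. (\<Sum>i\<in>I. c i * (x i - z i)) = g x"
      then have "(\<lambda>i. if i \<in> I then c i else 0) \<in> \<Lambda>" by (simp add: \<Lambda>_def eqv_def cong: sum.cong)
      from ker[OF this, of u] show "(\<Sum>i\<in>I. c i * \<pi> u i) = 0"
        by (simp add: \<pi>_def cong: sum.cong)
    qed
    then obtain e where e0: "\<And>i. i \<in> I \<Longrightarrow> e i 0 = \<pi> u i" and ep: "\<And>i. i \<in> I \<Longrightarrow> \<exists>P. \<forall>s. e i s = poly P s"
      and eA: "\<And>s. \<exists>x\<in>A. \<forall>i\<in>I. x i = z i + s * e i s" by metis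
    have cong: "p x = p y" if "p \<in> polyfun I" "\<And>i. i \<in> I \<Longrightarrow> x i = y i" for p x y
      using that by induction auto
    have hp: "\<exists>P. \<forall>s. h (\<lambda>i. e i s) = poly P s"
      by (rule polyfun_path[OF homog_polyfun[OF h]]) (rule ep)
    have order: "\<exists>P. \<forall>s. p (\<lambda>i. z i + s * e i s) = s ^ m * poly P s" if "p \<in> mpow I z m" for p m
      using that
    proof (induction m arbitrary: p)
      case 0
      have "\<exists>P. \<forall>s. z i + s * e i s = poly P s" if i: "i \<in> I" for i
      proof -
        obtain P where "\<forall>s. e i s = poly P s" using ep[OF i] by blast
        then show ?thesis by (intro exI[of _ "[:z i:] + [:0,1:] * P"]) simp
      qed
      with polyfun_path[of p I "\<lambda>s i. z i + s * e i s"] 0 show ?case by simp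
    next
      case (Suc m)
      then obtain q where q: "p = (\<lambda>x. \<Sum>i\<in>I. (x i - z i) * q i x)" "\<And>i. q i \<in> mpow I z m" by auto
      from Suc.IH[OF q(2)] obtain Q where Q: "\<And>i s. q i (\<lambda>i. z i + s * e i s) = s ^ m * poly (Q i) s" by metis
      from ep obtain E where E: "\<And>i s. i \<in> I \<Longrightarrow> e i s = poly (E i) s" by metis
      show ?case by (rule exI[of _ "\<Sum>i\<in>I. E i * Q i"])
        (simp add: q(1) Q E poly_sum sum_distrib_left mult_ac cong: sum.cong)
    qed
    obtain H where H: "\<And>s. h (\<lambda>i. e i s) = poly H s" using hp by blast
    obtain W where W: "\<And>s. g (\<lambda>i. z i + s * e i s) - h (\<lambda>i. s * e i s) = s ^ Suc k * poly W s"
      using order[OF gh] by auto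
    have g0: "g (\<lambda>i. z i + s * e i s) = 0" for s
    proof -
      obtain x where "x \<in> A" "\<forall>i\<in>I. x i = z i + s * e i s" using eA by blast
      then show ?thesis using cong[OF mpow_polyfun[OF g], of "\<lambda>i. z i + s * e i s" x] gA by simp
    qed
    \<comment> \<open>Dividing by \<open>s ^ k\<close> requires s \<noteq> 0. A polynomial with
      infinitely many roots is zero, so the identity extends to s = 0, where it gives the leading
      form at the tangent vector.\<close>
    have "poly (H + [:0,1:] * W) s = 0" if "s \<noteq> 0" for s
    proof -
      have "s ^ k * (poly H s + s * poly W s) = 0"
      proof -
        have "- (s ^ k * poly H s) = s ^ Suc k * poly W s"
          using W[of s] g0[of s] homog_scale[OF h, of s "\<lambda>i. e i s"] by (simp add: H)
        then have "s ^ k * poly H s + s ^ Suc k * poly W s = 0" by (simp only: neg_eq_iff_add_eq_0)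
        then show ?thesis by (simp add: algebra_simps)
      qed
      with that show ?thesis by simp
    qed
    then have "infinite {s. poly (H + [:0,1:] * W) s = 0}"
      using infinite_super[of "UNIV - {0}" "{s. poly (H + [:0,1:] * W) s = 0}"]
      by (simp add: infinite_UNIV_char_0 subset_iff)
    then have "H + [:0,1:] * W = 0" using poly_roots_finite by blast
    then have "poly (H + [:0,1:] * W) 0 = 0" by simp
    then have "h (\<lambda>i. e i 0) = 0" by (simp add: H)
    moreover have "h (\<lambda>i. e i 0) = h (\<pi> u)" by (rule cong[OF homog_polyfun[OF h]]) (rule e0)
    ultimately show ?thesis by simp
  qed
  show "\<exists>g\<in>mpow I z k. \<forall>x\<in>X. f x = g x" for k
  proof (induction k)
    case 0
    show ?case using f by auto
  next
    case (Suc k)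
    then obtain g where g: "g \<in> mpow I z k" "\<forall>x\<in>X. f x = g x" by blast
    from mpow_leading_form[OF I g(1)] obtain h where h: "h \<in> homog I k"
      "(\<lambda>x. g x - h (\<lambda>i. x i - z i)) \<in> mpow I z (Suc k)" by blast
    have "g x = 0" if "x \<in> A" for x using that g(2) fA[OF that] AX by (metis subsetD)
    then have "h (\<pi> u) = 0" for u by (rule leading_0[OF h(1) g(1) _ h(2)])
    with homog_eqv[OF h(1)] have "eqv (Suc k) (\<lambda>x. h (\<lambda>i. x i - z i))" by simp
    from eqv_add[OF this eqv_mpow[OF h(2)]] have "eqv (Suc k) g" by simp
    then show ?case using g(2) unfolding eqv_def by (auto simp del: mpow.simps)
  qed
qed

section \<open>Minors and Pfaffians\<close>

text \<open>Multilinearity in the rows. The choice functions include non-injective ones, whose terms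
  are disposed of by \<open>det_mat_repeated_row\<close>.\<close>

lemma det_rows_combination:
  fixes q :: "nat \<Rightarrow> 'x \<Rightarrow> 'a::comm_ring_1"
  assumes "finite R"
  shows "det (mat m m (\<lambda>(i, j). \<Sum>x\<in>R. q i x * N x j))
    = (\<Sum>f\<in>{0..<m} \<rightarrow>\<^sub>E R. (\<Prod>i<m. q i (f i)) * det (mat m m (\<lambda>(i, j). N (f i) j)))"
proof -
  have "det (mat m m (\<lambda>(i, j). \<Sum>x\<in>R. q i x * N x j))
    = (\<Sum>p | p permutes {0..<m}. signof p * (\<Prod>i = 0..<m. \<Sum>x\<in>R. q i x * N x (p i)))"
    by (subst det_def'[of _ m]) (auto intro!: sum.cong prod.cong)
  also have "\<dots> = (\<Sum>p | p permutes {0..<m}. \<Sum>f\<in>{0..<m} \<rightarrow>\<^sub>E R. signof p * (\<Prod>i = 0..<m. q i (f i) * N (f i) (p i)))"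
    using assms by (simp add: prod_sum_PiE sum_distrib_left)
  also have "\<dots> = (\<Sum>f\<in>{0..<m} \<rightarrow>\<^sub>E R. (\<Prod>i<m. q i (f i)) * (\<Sum>p | p permutes {0..<m}. signof p * (\<Prod>i = 0..<m. N (f i) (p i))))"
    by (subst sum.swap) (simp add: sum_distrib_left prod.distrib atLeast0LessThan mult_ac)
  also have "\<dots> = (\<Sum>f\<in>{0..<m} \<rightarrow>\<^sub>E R. (\<Prod>i<m. q i (f i)) * det (mat m m (\<lambda>(i, j). N (f i) j)))"
  proof (intro sum.cong refl arg_cong2[of _ _ _ _ "(*)"])
    fix f
    show "(\<Sum>p | p permutes {0..<m}. signof p * (\<Prod>i = 0..<m. N (f i) (p i))) = det (mat m m (\<lambda>(i, j). N (f i) j))"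
      by (subst det_def'[of _ m]) (auto intro!: sum.cong prod.cong)
  qed
  finally show ?thesis .
qed

lemma det_mat_repeated_row:
  assumes "\<not> inj_on f {..<m}"
  shows "det (mat m m (\<lambda>(i, j). N (f i) j)) = (0 :: 'a::comm_ring_1)"
proof -
  from assms obtain i j where "i < m" "j < m" "i \<noteq> j" "f i = f j" by (auto simp: inj_on_def)
  then show ?thesis by (intro det_identical_rows[of _ m i j]) auto
qed

lemma det_mat_transpose:
  "det (mat m m (\<lambda>(i, j). N i j)) = det (mat m m (\<lambda>(i, j). N j i) :: 'a::comm_ring_1 mat)"
proof -
  have "transpose_mat (mat m m (\<lambda>(i, j). N i j)) = mat m m (\<lambda>(i, j). N j i)" by auto
  then show ?thesis using det_transpose[of "mat m m (\<lambda>(i, j). N i j)" m] by simp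
qed

text \<open>A matrix factoring through \<open>X\<close> has rank at most the size of
  \<open>X\<close>: by the pigeonhole principle every term of the expansion repeats a row of the
  right factor.\<close>

lemma minors_vanish_factorization:
  assumes "finite X" "card X < m"
    and "\<And>x y. x \<in> R \<Longrightarrow> y \<in> C \<Longrightarrow> M x y = (\<Sum>z\<in>X. L x z * N z y)"
  shows "minors_vanish m R C M"
  unfolding minors_vanish_def
proof (intro allI impI, elim conjE)
  fix rs cs assume len: "length rs = m" "length cs = m" and sub: "set rs \<subseteq> R" "set cs \<subseteq> C"
  have "mat m m (\<lambda>(i, j). M (rs ! i) (cs ! j)) = mat m m (\<lambda>(i, j). \<Sum>z\<in>X. L (rs ! i) z * N z (cs ! j))"
  proof (rule cong_mat)
    fix i j assume "i < m" "j < m"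
    then have "rs ! i \<in> R" "cs ! j \<in> C" using len sub nth_mem by auto
    then show "(case (i, j) of (i, j) \<Rightarrow> M (rs ! i) (cs ! j)) = (case (i, j) of (i, j) \<Rightarrow> \<Sum>z\<in>X. L (rs ! i) z * N z (cs ! j))"
      using assms(3) by simp
  qed auto
  then have "det (mat m m (\<lambda>(i, j). M (rs ! i) (cs ! j)))
    = (\<Sum>f\<in>{0..<m} \<rightarrow>\<^sub>E X. (\<Prod>i<m. L (rs ! i) (f i)) * det (mat m m (\<lambda>(i, j). N (f i) (cs ! j))))"
    using det_rows_combination[OF assms(1), of m "\<lambda>i. L (rs ! i)" "\<lambda>z j. N z (cs ! j)"] by simp
  also have "\<dots> = 0"
  proof (rule sum.neutral, rule ballI)
    fix f assume f: "f \<in> {0..<m} \<rightarrow>\<^sub>E X"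
    have "\<not> inj_on f {..<m}"
    proof
      assume "inj_on f {..<m}"
      moreover have "f ` {..<m} \<subseteq> X" using f by auto
      ultimately have "card {..<m} \<le> card X" using assms(1) by (rule card_inj_on_le)
      with assms(2) show False by simp
    qed
    from det_mat_repeated_row[OF this, of "\<lambda>z j. N z (cs ! j)"]
    show "(\<Prod>i<m. L (rs ! i) (f i)) * det (mat m m (\<lambda>(i, j). N (f i) (cs ! j))) = 0" by simp
  qed
  finally show "det (mat m m (\<lambda>(i, j). M (rs ! i) (cs ! j))) = 0" .
qed

text \<open>The rank bound is independent of the bases: minors may be formed with arbitrary row
  vectors \<open>q i\<close> and column vectors \<open>p j\<close>. This permits testing the
  flattening on vectors adapted to the lattice points.\<close>

lemma minors_vanish_combination:
  assumes fin: "finite R" "finite C" and van: "minors_vanish m R C M"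
  shows "det (mat m m (\<lambda>(i, j). \<Sum>x\<in>R. \<Sum>y\<in>C. q i x * M x y * p j y)) = 0"
proof -
  have "det (mat m m (\<lambda>(i, j). \<Sum>x\<in>R. \<Sum>y\<in>C. q i x * M x y * p j y))
      = det (mat m m (\<lambda>(i, j). \<Sum>x\<in>R. q i x * (\<Sum>y\<in>C. p j y * M x y)))"
    by (simp add: sum_distrib_left mult_ac)
  also have "\<dots> = 0"
    unfolding det_rows_combination[OF fin(1)]
  proof (rule sum.neutral, rule ballI)
    fix f assume f: "f \<in> {0..<m} \<rightarrow>\<^sub>E R"
    have "det (mat m m (\<lambda>(i, j). \<Sum>y\<in>C. p j y * M (f i) y))
        = det (mat m m (\<lambda>(j, i). \<Sum>y\<in>C. p j y * M (f i) y))"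
      by (rule det_mat_transpose)
    also have "\<dots> = 0"
      unfolding det_rows_combination[OF fin(2)]
    proof (rule sum.neutral, rule ballI)
      fix g assume g: "g \<in> {0..<m} \<rightarrow>\<^sub>E C"
      have "det (mat m m (\<lambda>(j, i). M (f i) (g j))) = 0"
      proof (cases "inj_on f {..<m} \<and> inj_on g {..<m}")
        case True
        have "det (mat m m (\<lambda>(i, j). M (map f [0..<m] ! i) (map g [0..<m] ! j))) = 0"
          using van True f g unfolding minors_vanish_def
          by (elim allE[of _ "map f [0..<m]"] allE[of _ "map g [0..<m]"])
            (auto simp: distinct_map atLeast0LessThan)
        also have "mat m m (\<lambda>(i, j). M (map f [0..<m] ! i) (map g [0..<m] ! j)) = mat m m (\<lambda>(i, j). M (f i) (g j))"
          by auto
        finally show ?thesis using det_mat_transpose[of m "\<lambda>i j. M (f i) (g j)"] by simp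
      next
        case False
        then show ?thesis
          using det_mat_repeated_row[of g m "\<lambda>y i. M (f i) y"] det_mat_repeated_row[of f m "\<lambda>x j. M x (g j)"]
            det_mat_transpose[of m "\<lambda>i j. M (f i) (g j)"] by auto
      qed
      then show "(\<Prod>i<m. p i (g i)) * det (mat m m (\<lambda>(i, j). M (f j) (g i))) = 0" by simp
    qed
    finally show "(\<Prod>i<m. q i (f i)) * det (mat m m (\<lambda>(i, j). \<Sum>y\<in>C. p j y * M (f i) y)) = 0" by simp
  qed
  finally show ?thesis .
qed

lemma minors_vanish_Suc:
  assumes "minors_vanish m R C M"
  shows "minors_vanish (Suc m) R C M"
  unfolding minors_vanish_def
proof (intro allI impI, elim conjE)
  fix rs cs assume len: "length rs = Suc m" "length cs = Suc m" and dist: "distinct rs" "distinct cs"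
    and sub: "set rs \<subseteq> R" "set cs \<subseteq> C"
  let ?A = "mat (Suc m) (Suc m) (\<lambda>(i, j). M (rs ! i) (cs ! j))"
  have "cofactor ?A 0 j = 0" if j: "j < Suc m" for j
  proof -
    let ?r = "tl rs" and ?c = "take j cs @ drop (Suc j) cs"
    have "length ?r = m" "length ?c = m" using len j by auto
    moreover have "distinct ?r" using dist by (simp add: distinct_tl)
    moreover have "distinct ?c"
    proof -
      have "distinct (take j cs @ cs ! j # drop (Suc j) cs)"
        using dist(2) id_take_nth_drop[of j cs] j len by simp
      then show ?thesis by auto
    qed
    moreover have "set ?r \<subseteq> R" using sub len by (cases rs) auto
    moreover have "set ?c \<subseteq> C" using sub set_take_subset set_drop_subset by fastforce
    ultimately have "det (mat m m (\<lambda>(i, j). M (?r ! i) (?c ! j))) = 0"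
      using assms unfolding minors_vanish_def by blast
    also have "mat m m (\<lambda>(i, j). M (?r ! i) (?c ! j)) = mat_delete ?A 0 j"
    proof (rule eq_matI)
      fix i' j' assume "i' < dim_row (mat_delete ?A 0 j)" "j' < dim_col (mat_delete ?A 0 j)"
      then have b: "i' < m" "j' < m" by (auto simp: mat_delete_def)
      have "?c ! j' = cs ! (if j' < j then j' else Suc j')" using b j len by (auto simp: nth_append min_def)
      moreover have "?r ! i' = rs ! Suc i'" using b len by (simp add: nth_tl)
      ultimately show "mat m m (\<lambda>(i, j). M (?r ! i) (?c ! j)) $$ (i', j') = mat_delete ?A 0 j $$ (i', j')"
        using b by (auto simp: mat_delete_def)
    qed (auto simp: mat_delete_def)
    finally show ?thesis by (simp add: cofactor_def)
  qed
  then show "det ?A = 0" by (subst laplace_expansion_row[of _ "Suc m" 0]) auto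
qed

section \<open>Pfaffians and the rank of a skew-symmetric matrix\<close>

definition pfsum :: "nat \<Rightarrow> (nat \<Rightarrow> nat \<Rightarrow> complex) \<Rightarrow> complex" where
  "pfsum k A = (\<Sum>\<sigma> | \<sigma> permutes {..<k}.
       of_int (sign \<sigma>) * (\<Prod>i<k div 2. A (\<sigma> (2 * i)) (\<sigma> (2 * i + 1))))"

lemma pfaffian_0_iff: "pfaffian k A = 0 \<longleftrightarrow> pfsum k A = 0"
  by (simp add: pfaffian_def pfsum_def)

lemma pfsum_cong:
  assumes "\<And>i j. i < k \<Longrightarrow> j < k \<Longrightarrow> A i j = B i j"
  shows "pfsum k A = pfsum k B"
  unfolding pfsum_def
proof (intro sum.cong refl arg_cong2[of _ _ _ _ "(*)"] prod.cong)
  fix \<sigma> i assume "\<sigma> \<in> {\<sigma>. \<sigma> permutes {..<k}}" "i \<in> {..<k div 2}"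
  then have "\<sigma> (2 * i) < k" "\<sigma> (2 * i + 1) < k" using permutes_in_image[of \<sigma> "{..<k}"] by auto
  then show "A (\<sigma> (2 * i)) (\<sigma> (2 * i + 1)) = B (\<sigma> (2 * i)) (\<sigma> (2 * i + 1))" by (rule assms)
qed

lemma pfsum_repeated:
  assumes pq: "p < k" "q < k" "p \<noteq> q" "x p = x q"
  shows "pfsum k (\<lambda>i j. A (x i) (x j)) = 0"
proof -
  let ?F = "\<lambda>\<sigma>. of_int (sign \<sigma>) * (\<Prod>i<k div 2. A (x (\<sigma> (2 * i))) (x (\<sigma> (2 * i + 1))))"
  let ?t = "transpose p q"
  have t: "?t permutes {..<k}" using pq by (intro permutes_swap_id) auto
  have xt: "x (?t i) = x i" for i using pq by (auto simp: transpose_def)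
  have "pfsum k (\<lambda>i j. A (x i) (x j)) = (\<Sum>\<sigma> | \<sigma> permutes {..<k}. ?F (?t \<circ> \<sigma>))"
    unfolding pfsum_def by (rule setum_permutations_compose_left[OF t])
  also have "\<dots> = (\<Sum>\<sigma> | \<sigma> permutes {..<k}. - ?F \<sigma>)"
  proof (rule sum.cong[OF refl])
    fix \<sigma> assume "\<sigma> \<in> {\<sigma>. \<sigma> permutes {..<k}}"
    then have "permutation \<sigma>" using permutation_permutes by blast
    then have "sign (?t \<circ> \<sigma>) = - sign \<sigma>" using pq by (simp add: sign_compose permutation_swap_id sign_swap_id)
    then show "?F (?t \<circ> \<sigma>) = - ?F \<sigma>" by (simp add: xt)
  qed
  also have "\<dots> = - pfsum k (\<lambda>i j. A (x i) (x j))" by (simp add: pfsum_def sum_negf)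
  finally show ?thesis by simp
qed

text \<open>A Cramer rule that does not pass through the square of the Pfaffian. Replace the index
  \<open>q\<close> by \<open>l\<close> and sum with weights \<open>v l\<close>: the factor
  containing that index sums to an entry of A v up to sign, giving 0, while each \<open>l\<close>
  other than \<open>q\<close> repeats an index. What remains is \<open>v q\<close> times the
  Pfaffian.\<close>

lemma pfsum_kernel:
  assumes k: "even k" and v: "\<And>i. i < k \<Longrightarrow> (\<Sum>j<k. A i j * v j) = 0"
    and skew: "\<And>i j. i < k \<Longrightarrow> j < k \<Longrightarrow> A i j = - A j i" and q: "q < k" "v q \<noteq> 0"
  shows "pfsum k A = 0"
proof -
  let ?x = "\<lambda>l i. if i = q then l else i"
  have "(\<Sum>l<k. v l * pfsum k (\<lambda>i j. A (?x l i) (?x l j))) =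
    (\<Sum>\<sigma> | \<sigma> permutes {..<k}. of_int (sign \<sigma>) * (\<Sum>l<k. v l * (\<Prod>i<k div 2. A (?x l (\<sigma> (2 * i))) (?x l (\<sigma> (2 * i + 1))))))"
    unfolding pfsum_def sum_distrib_left by (subst sum.swap) (simp add: mult_ac)
  also have "\<dots> = 0"
  proof (rule sum.neutral, rule ballI)
    fix \<sigma> assume "\<sigma> \<in> {\<sigma>. \<sigma> permutes {..<k}}"
    then have \<sigma>: "\<sigma> permutes {..<k}" by simp
    obtain j where "\<sigma> j = q" using permutes_surj[OF \<sigma>] by (metis surjD)
    with q permutes_in_image[OF \<sigma>, of j] have j: "j < k" "\<sigma> j = q" by auto
    have inj: "\<sigma> i = q \<longleftrightarrow> i = j" for i using permutes_inj[OF \<sigma>] j(2) by (auto dest: injD)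
    \<comment> \<open>The index \<open>q\<close> occurs in exactly one factor, numbered
      \<open>i0\<close>; only this factor depends on \<open>l\<close>.\<close>
    define i0 where "i0 = j div 2"
    have i0: "i0 < k div 2" using j(1) k unfolding i0_def by (auto elim!: evenE)
    let ?f = "\<lambda>l i. A (?x l (\<sigma> (2 * i))) (?x l (\<sigma> (2 * i + 1)))"
    have rest: "?f l i = A (\<sigma> (2 * i)) (\<sigma> (2 * i + 1))" if "i \<noteq> i0" for l i
    proof -
      have "2 * i \<noteq> j" "2 * i + 1 \<noteq> j" using that by (auto simp: i0_def)
      then show ?thesis by (simp add: inj)
    qed
    have *: "(\<Sum>l<k. v l * ?f l i0) = 0"
    proof -
      have b: "\<sigma> (2 * i0) < k" "\<sigma> (2 * i0 + 1) < k" using i0 permutes_in_image[OF \<sigma>] by auto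
      consider "j = 2 * i0" | "j = 2 * i0 + 1" unfolding i0_def by linarith
      then show ?thesis
      proof cases
        case 1
        then have "?f l i0 = A l (\<sigma> (2 * i0 + 1))" for l using inj by auto
        then have "(\<Sum>l<k. v l * ?f l i0) = (\<Sum>l<k. - (A (\<sigma> (2 * i0 + 1)) l * v l))"
          using skew[OF _ b(2)] by (intro sum.cong) auto
        then show ?thesis using v[OF b(2)] by (simp add: sum_negf)
      next
        case 2
        then have "?f l i0 = A (\<sigma> (2 * i0)) l" for l using inj by auto
        then show ?thesis using v[OF b(1)] by (simp add: mult.commute)
      qed
    qed
    have "(\<Prod>i<k div 2. ?f l i) = ?f l i0 * (\<Prod>i\<in>{..<k div 2} - {i0}. A (\<sigma> (2 * i)) (\<sigma> (2 * i + 1)))" for l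
      using i0 rest by (subst prod.remove[of _ i0]) (auto intro!: prod.cong)
    then have "(\<Sum>l<k. v l * (\<Prod>i<k div 2. ?f l i)) = (\<Sum>l<k. v l * ?f l i0) * (\<Prod>i\<in>{..<k div 2} - {i0}. A (\<sigma> (2 * i)) (\<sigma> (2 * i + 1)))"
      by (simp add: sum_distrib_right mult.assoc)
    then show "of_int (sign \<sigma>) * (\<Sum>l<k. v l * (\<Prod>i<k div 2. ?f l i)) = 0" using * by simp
  qed
  finally have "(\<Sum>l<k. v l * pfsum k (\<lambda>i j. A (?x l i) (?x l j))) = 0" .
  moreover have "pfsum k (\<lambda>i j. A (?x l i) (?x l j)) = (if l = q then pfsum k A else 0)" if "l < k" for l
  proof (cases "l = q")
    case True
    then show ?thesis by (auto intro!: pfsum_cong)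
  next
    case False
    then show ?thesis using pfsum_repeated[of l k q "?x l" A] that q by simp
  qed
  ultimately have "(\<Sum>l<k. v l * (if l = q then pfsum k A else 0)) = 0" by simp
  then show ?thesis using q by (simp add: if_distrib[of "\<lambda>x. _ * x"] cong: if_cong)
qed

text \<open>Vanishing of the minors of size k + 1 passes to size k + 2, where a singular principal
  block has a kernel vector.\<close>

lemma subpfaffians_vanish_if_minors_vanish:
  assumes k: "even k" and skew: "\<And>p q. p \<in> P \<Longrightarrow> q \<in> P \<Longrightarrow> A p q = - A q p"
    and van: "minors_vanish (k + 1) P P A"
  shows "subpfaffians_vanish (k + 2) P A"
  unfolding subpfaffians_vanish_def
proof (intro allI impI, elim conjE)
  fix ks assume ks: "length ks = k + 2" "distinct ks" "set ks \<subseteq> P"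
  have in_P: "ks ! i \<in> P" if "i < k + 2" for i using that ks nth_mem by auto
  let ?A = "mat (k + 2) (k + 2) (\<lambda>(i, j). A (ks ! i) (ks ! j))"
  have "det ?A = 0" using minors_vanish_Suc[OF van] ks unfolding minors_vanish_def by simp
  then obtain v where v: "v \<in> carrier_vec (k + 2)" "v \<noteq> 0\<^sub>v (k + 2)" "?A *\<^sub>v v = 0\<^sub>v (k + 2)"
    using det_0_iff_vec_prod_zero[of ?A "k + 2"] by auto
  obtain q where q: "q < k + 2" "v $ q \<noteq> 0"
  proof (rule ccontr)
    assume "\<not> thesis"
    with that have "\<forall>q<k + 2. v $ q = 0" by blast
    then have "v = 0\<^sub>v (k + 2)" using v(1) by (intro eq_vecI) auto
    with v(2) show False by simp
  qed
  have "(\<Sum>j<k + 2. A (ks ! i) (ks ! j) * v $ j) = 0" if "i < k + 2" for i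
  proof -
    have "(?A *\<^sub>v v) $ i = 0" using v(3) that by simp
    then show ?thesis using that v(1) by (simp add: scalar_prod_def atLeast0LessThan)
  qed
  then have "pfsum (k + 2) (\<lambda>i j. A (ks ! i) (ks ! j)) = 0"
    using k q by (intro pfsum_kernel[of _ _ "\<lambda>j. v $ j" q] skew in_P) auto
  then show "pfaffian (k + 2) (\<lambda>i j. A (ks ! i) (ks ! j)) = 0" by (simp only: pfaffian_0_iff)
qed

definition pfcoef :: "nat \<Rightarrow> nat \<Rightarrow> (nat \<Rightarrow> nat \<Rightarrow> complex) \<Rightarrow> complex" where
  "pfcoef k j B = (\<Sum>\<sigma> | \<sigma> permutes {..<k + 2} \<and> \<sigma> k = k \<and> \<sigma> (k + 1) = j.
     of_int (sign \<sigma>) * (\<Prod>i<k div 2. B (\<sigma> (2 * i)) (\<sigma> (2 * i + 1))))"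

text \<open>Expansion along row \<open>k\<close>; the coefficients \<open>pfcoef\<close> do not involve that row.\<close>
lemma pfsum_expand:
  assumes k: "even k" and skew: "\<And>i j. i < k + 2 \<Longrightarrow> j < k + 2 \<Longrightarrow> B i j = - B j i"
  shows "pfsum (k + 2) B = of_nat (k + 2) * (B k (k + 1) * pfsum k B + (\<Sum>j<k. B k j * pfcoef k j B))"
proof -
  define m where "m = k div 2"
  have km: "k = 2 * m" using k by (simp add: m_def)
  let ?P = "{\<sigma>. \<sigma> permutes {..<k + 2}}"
  define F where "F = (\<lambda>\<sigma>. of_int (sign \<sigma>) * (\<Prod>i<Suc m. B (\<sigma> (2 * i)) (\<sigma> (2 * i + 1))))"
  \<comment> \<open>The value \<open>k\<close> is taken at exactly one position, and all positions
    contribute equally: \<open>flip\<close> exchanges the two entries of a pair,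
    \<open>block\<close> exchanges pairs. This produces the factor k + 2.\<close>
  define SF where "SF = (\<lambda>pos. \<Sum>\<sigma> | \<sigma> permutes {..<k + 2}. if \<sigma> pos = k then F \<sigma> else 0)"
  have lt: "\<sigma> i < k + 2" if "\<sigma> permutes {..<k + 2}" "i < k + 2" for \<sigma> i
    using permutes_in_image[OF that(1), of i] that(2) by simp
  have flip: "SF (2 * i + 1) = SF (2 * i)" if i: "i < Suc m" for i
  proof -
    let ?t = "transpose (2 * i) (2 * i + 1)"
    have t: "?t permutes {..<k + 2}" using i by (intro permutes_swap_id) (auto simp: km)
    have "F (\<sigma> \<circ> ?t) = F \<sigma>" if \<sigma>: "\<sigma> permutes {..<k + 2}" for \<sigma>
    proof -
      have "permutation \<sigma>" using \<sigma> permutation_permutes by blast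
      then have s: "sign (\<sigma> \<circ> ?t) = - sign \<sigma>" by (simp add: sign_compose permutation_swap_id sign_swap_id)
      have p: "(\<Prod>l<Suc m. B ((\<sigma> \<circ> ?t) (2 * l)) ((\<sigma> \<circ> ?t) (2 * l + 1))) = - (\<Prod>l<Suc m. B (\<sigma> (2 * l)) (\<sigma> (2 * l + 1)))"
      proof -
        have "(\<Prod>l\<in>{..<Suc m} - {i}. B ((\<sigma> \<circ> ?t) (2 * l)) ((\<sigma> \<circ> ?t) (2 * l + 1)))
           = (\<Prod>l\<in>{..<Suc m} - {i}. B (\<sigma> (2 * l)) (\<sigma> (2 * l + 1)))"
        proof (rule prod.cong[OF refl])
          fix l assume "l \<in> {..<Suc m} - {i}"
          then have "l \<noteq> i" by simp
          then have "2 * l \<noteq> 2 * i" "2 * l \<noteq> 2 * i + 1" "2 * l + 1 \<noteq> 2 * i" "2 * l + 1 \<noteq> 2 * i + 1"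
            by presburger+
          then show "B ((\<sigma> \<circ> ?t) (2 * l)) ((\<sigma> \<circ> ?t) (2 * l + 1)) = B (\<sigma> (2 * l)) (\<sigma> (2 * l + 1))"
            by (simp add: transpose_apply_other)
        qed
        moreover have "B (\<sigma> (2 * i + 1)) (\<sigma> (2 * i)) = - B (\<sigma> (2 * i)) (\<sigma> (2 * i + 1))"
          using i by (intro skew lt[OF \<sigma>]) (auto simp: km)
        ultimately show ?thesis using i
          by (subst (1 2) prod.remove[of "{..<Suc m}" i]) (auto simp del: prod.lessThan_Suc)
      qed
      show ?thesis unfolding F_def s p by simp
    qed
    moreover have "SF (2 * i + 1) = (\<Sum>\<sigma> | \<sigma> permutes {..<k + 2}. if (\<sigma> \<circ> ?t) (2 * i + 1) = k then F (\<sigma> \<circ> ?t) else 0)"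
      unfolding SF_def by (rule sum_permutations_compose_right[OF t])
    ultimately show ?thesis unfolding SF_def by (auto intro!: sum.cong)
  qed
  have block: "SF (2 * i) = SF (2 * m)" if i: "i < Suc m" for i
  proof (cases "i = m")
    case False
    let ?t1 = "transpose (2 * i) (2 * m)" and ?t2 = "transpose (2 * i + 1) (2 * m + 1)"
    let ?t = "?t1 \<circ> ?t2"
    have t12: "?t1 permutes {..<k + 2}" "?t2 permutes {..<k + 2}" using i by (auto intro!: permutes_swap_id simp: km)
    then have t: "?t permutes {..<k + 2}" by (intro permutes_compose)
    have t_even: "?t (2 * l) = 2 * transpose i m l" and t_odd: "?t (2 * l + 1) = 2 * transpose i m l + 1" for l
    proof -
      have "2 * l \<noteq> 2 * i + 1" "2 * l \<noteq> 2 * m + 1" "2 * l + 1 \<noteq> 2 * i" "2 * l + 1 \<noteq> 2 * m"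
        "2 * i + 1 \<noteq> 2 * m" "2 * m + 1 \<noteq> 2 * i" by presburger+
      then show "?t (2 * l) = 2 * transpose i m l" "?t (2 * l + 1) = 2 * transpose i m l + 1"
        by (auto simp: transpose_def)
    qed
    have "F (\<sigma> \<circ> ?t) = F \<sigma>" if \<sigma>: "\<sigma> permutes {..<k + 2}" for \<sigma>
    proof -
      have "permutation \<sigma>" "permutation ?t1" "permutation ?t2" "permutation ?t"
        using \<sigma> t12 t permutation_permutes by blast+
      then have s: "sign (\<sigma> \<circ> ?t) = sign \<sigma>"
        using False by (simp add: sign_compose sign_swap_id)
      have "(\<Prod>l<Suc m. B ((\<sigma> \<circ> ?t) (2 * l)) ((\<sigma> \<circ> ?t) (2 * l + 1)))
         = (\<Prod>l<Suc m. ((\<lambda>l. B (\<sigma> (2 * l)) (\<sigma> (2 * l + 1))) \<circ> transpose i m) l)"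
        using t_even t_odd by (intro prod.cong) auto
      also have "\<dots> = (\<Prod>l<Suc m. B (\<sigma> (2 * l)) (\<sigma> (2 * l + 1)))"
        using i prod.permute[OF permutes_swap_id[of i "{..<Suc m}" m], of "\<lambda>l. B (\<sigma> (2 * l)) (\<sigma> (2 * l + 1))"]
        by (simp add: comp_def del: prod.lessThan_Suc)
      finally show ?thesis unfolding F_def s by simp
    qed
    moreover have "SF (2 * i) = (\<Sum>\<sigma> | \<sigma> permutes {..<k + 2}. if (\<sigma> \<circ> ?t) (2 * i) = k then F (\<sigma> \<circ> ?t) else 0)"
      unfolding SF_def by (rule sum_permutations_compose_right[OF t])
    ultimately show ?thesis unfolding SF_def using t_even[of i] by (auto intro!: sum.cong)
  qed simp
  have all: "SF pos = SF k" if "pos < k + 2" for pos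
  proof -
    have "pos div 2 < Suc m" using that km by linarith
    moreover have "pos = 2 * (pos div 2) \<or> pos = 2 * (pos div 2) + 1" by linarith
    ultimately show ?thesis using flip[of "pos div 2"] block[of "pos div 2"] km by metis
  qed
  have "pfsum (k + 2) B = (\<Sum>\<sigma> | \<sigma> permutes {..<k + 2}. F \<sigma>)"
    unfolding pfsum_def F_def km by simp
  also have "\<dots> = (\<Sum>\<sigma> | \<sigma> permutes {..<k + 2}. \<Sum>pos<k + 2. if \<sigma> pos = k then F \<sigma> else 0)"
  proof (rule sum.cong[OF refl])
    fix \<sigma> assume "\<sigma> \<in> ?P"
    then have \<sigma>: "\<sigma> permutes {..<k + 2}" by simp
    obtain j where j: "\<sigma> j = k" using permutes_surj[OF \<sigma>] by (metis surjD)
    then have "\<sigma> pos = k \<longleftrightarrow> pos = j" for pos using permutes_inj[OF \<sigma>] by (auto dest: injD)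
    moreover have "j < k + 2" using permutes_in_image[OF \<sigma>, of j] j by simp
    ultimately show "F \<sigma> = (\<Sum>pos<k + 2. if \<sigma> pos = k then F \<sigma> else 0)" by (simp del: sum.lessThan_Suc)
  qed
  also have "\<dots> = (\<Sum>pos<k + 2. SF pos)" unfolding SF_def by (rule sum.swap)
  also have "\<dots> = (\<Sum>pos<k + 2. SF k)" by (rule sum.cong[OF refl], rule all) simp
  also have "\<dots> = of_nat (k + 2) * SF k" by (simp del: sum.lessThan_Suc of_nat_add)
  also have "SF k = B k (k + 1) * pfsum k B + (\<Sum>j<k. B k j * pfcoef k j B)"
  proof -
    define G where "G = (\<lambda>\<sigma>. of_int (sign \<sigma>) * (\<Prod>i<m. B (\<sigma> (2 * i)) (\<sigma> (2 * i + 1))))"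
    have fin: "finite {\<sigma>. \<sigma> permutes {..<k + 2}}" by (simp add: finite_permutations)
    have "SF k = (\<Sum>\<sigma> | \<sigma> permutes {..<k + 2} \<and> \<sigma> k = k. F \<sigma>)"
      unfolding SF_def using fin by (subst sum.inter_filter[symmetric]) auto
    also have "\<dots> = (\<Sum>\<sigma> | \<sigma> permutes {..<k + 2} \<and> \<sigma> k = k. \<Sum>j<k + 2. if \<sigma> (k + 1) = j then B k j * G \<sigma> else 0)"
    proof (rule sum.cong[OF refl])
      fix \<sigma> assume "\<sigma> \<in> {\<sigma>. \<sigma> permutes {..<k + 2} \<and> \<sigma> k = k}"
      then have \<sigma>: "\<sigma> permutes {..<k + 2}" "\<sigma> k = k" by auto
      have "F \<sigma> = B k (\<sigma> (k + 1)) * G \<sigma>" using \<sigma>(2) by (simp add: F_def G_def km mult_ac)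
      then show "F \<sigma> = (\<Sum>j<k + 2. if \<sigma> (k + 1) = j then B k j * G \<sigma> else 0)"
        using lt[OF \<sigma>(1), of "k + 1"] by (simp del: sum.lessThan_Suc)
    qed
    also have "\<dots> = (\<Sum>j<k + 2. B k j * pfcoef k j B)"
    proof (subst sum.swap, rule sum.cong[OF refl])
      fix j
      let ?A = "{\<sigma>. \<sigma> permutes {..<k + 2} \<and> \<sigma> k = k}"
      have "(\<Sum>\<sigma>\<in>?A. if \<sigma> (k + 1) = j then B k j * G \<sigma> else 0) = (\<Sum>\<sigma>\<in>{\<sigma>\<in>?A. \<sigma> (k + 1) = j}. B k j * G \<sigma>)"
        using finite_subset[of ?A, OF _ fin] by (intro sum.inter_filter[symmetric]) auto
      also have "{\<sigma>\<in>?A. \<sigma> (k + 1) = j} = {\<sigma>. \<sigma> permutes {..<k + 2} \<and> \<sigma> k = k \<and> \<sigma> (k + 1) = j}"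
        by auto
      finally show "(\<Sum>\<sigma>\<in>?A. if \<sigma> (k + 1) = j then B k j * G \<sigma> else 0) = B k j * pfcoef k j B"
        by (simp only: pfcoef_def G_def m_def sum_distrib_left)
    qed
    also have "\<dots> = (\<Sum>j<k. B k j * pfcoef k j B) + B k k * pfcoef k k B + B k (k + 1) * pfcoef k (k + 1) B"
      by simp
    also have "B k k = 0" using skew[of k k] by simp
    also have "pfcoef k (k + 1) B = pfsum k B"
    proof -
      have "{\<sigma>. \<sigma> permutes {..<k + 2} \<and> \<sigma> k = k \<and> \<sigma> (k + 1) = k + 1} = {\<sigma>. \<sigma> permutes {..<k}}"
      proof safe
        fix \<sigma> assume \<sigma>: "\<sigma> permutes {..<k + 2}" "\<sigma> k = k" "\<sigma> (k + 1) = k + 1"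
        show "\<sigma> permutes {..<k}"
        proof (rule permutes_superset[OF \<sigma>(1)])
          fix x assume "x \<in> {..<k + 2} - {..<k}"
          then have "x = k \<or> x = k + 1" by auto
          then show "\<sigma> x = x" using \<sigma> by auto
        qed
      next
        fix \<sigma> assume \<sigma>: "\<sigma> permutes {..<k}"
        show "\<sigma> permutes {..<k + 2}" by (rule permutes_subset[OF \<sigma>]) auto
        show "\<sigma> k = k" "\<sigma> (k + 1) = k + 1" using permutes_not_in[OF \<sigma>] by auto
      qed
      then show ?thesis by (simp add: pfcoef_def pfsum_def)
    qed
    finally show ?thesis by simp
  qed
  finally show ?thesis .
qed

lemma pfcoef_cong:
  assumes "\<And>i j. i < k + 2 \<Longrightarrow> j < k + 2 \<Longrightarrow> i \<noteq> k \<Longrightarrow> j \<noteq> k \<Longrightarrow> A i j = B i j"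
  shows "pfcoef k l A = pfcoef k l B"
  unfolding pfcoef_def
proof (intro sum.cong refl arg_cong2[of _ _ _ _ "(*)"] prod.cong)
  fix \<sigma> i assume \<sigma>: "\<sigma> \<in> {\<sigma>. \<sigma> permutes {..<k + 2} \<and> \<sigma> k = k \<and> \<sigma> (k + 1) = l}" and i: "i \<in> {..<k div 2}"
  have "2 * i < k" "2 * i + 1 < k" using i by auto
  moreover have "\<sigma> j < k + 2 \<and> \<sigma> j \<noteq> k" if "j < k" for j
    using \<sigma> that permutes_in_image[of \<sigma> "{..<k + 2}" j] permutes_inj[of \<sigma> "{..<k + 2}"]
    by (auto dest: injD[of \<sigma> j k])
  ultimately show "A (\<sigma> (2 * i)) (\<sigma> (2 * i + 1)) = B (\<sigma> (2 * i)) (\<sigma> (2 * i + 1))"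
    using assms by simp
qed

text \<open>A maximal nonvanishing sub-Pfaffian of size \<open>l \<le> k\<close> makes all columns combinations of its \<open>l\<close> columns.\<close>
lemma minors_vanish_if_subpfaffians_vanish:
  assumes k: "even k" and skew: "\<And>p q. p \<in> P \<Longrightarrow> q \<in> P \<Longrightarrow> A p q = - A q p"
    and van: "subpfaffians_vanish (k + 2) P A"
  shows "minors_vanish (k + 1) P P A"
proof -
  let ?Q = "\<lambda>l. even l \<and> l \<le> k \<and> \<not> subpfaffians_vanish l P A"
  \<comment> \<open>The empty Pfaffian is 1, so a nonvanishing one of maximal size exists.\<close>
  have "pfsum 0 B = 1" for B by (simp add: pfsum_def)
  then have "?Q 0" using pfaffian_0_iff[of 0] by (auto simp: subpfaffians_vanish_def)
  then obtain l where l: "?Q l" and max: "\<And>l'. ?Q l' \<Longrightarrow> l' \<le> l"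
    using Nat.ex_has_greatest_nat[of ?Q 0 k] by blast
  have van': "subpfaffians_vanish (l + 2) P A"
  proof (cases "l = k")
    case False
    with l k have "l + 2 \<le> k" by (auto elim!: evenE)
    with max[of "l + 2"] l show ?thesis by auto
  qed (use van in simp)
  from l obtain ks where ks: "length ks = l" "distinct ks" "set ks \<subseteq> P"
    "pfsum l (\<lambda>i j. A (ks ! i) (ks ! j)) \<noteq> 0" by (auto simp: subpfaffians_vanish_def pfaffian_0_iff)
  define D where "D = pfsum l (\<lambda>i j. A (ks ! i) (ks ! j))"
  define x where "x = (\<lambda>p q i. (ks @ [p, q]) ! i)"
  have x: "x p q i = ks ! i" if "i < l" for p q i using that ks by (simp add: x_def nth_append)
  have xl: "x p q l = p" "x p q (l + 1) = q" for p q using ks by (auto simp: x_def nth_append)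
  have xP: "x p q i \<in> P" if "p \<in> P" "q \<in> P" "i < l + 2" for p q i
  proof -
    have "x p q i \<in> set (ks @ [p, q])" unfolding x_def using that ks by (intro nth_mem) auto
    then show ?thesis using that ks by auto
  qed
  \<comment> \<open>Writing the coefficients with \<open>x q q\<close> in place of
    \<open>x p q\<close> exhibits their independence of the row \<open>p\<close>; this makes the
    expansion a factorization through \<open>l\<close> columns.\<close>
  have A_eq: "A p q = (\<Sum>j<l. A p (ks ! j) * (- pfcoef l j (\<lambda>i j. A (x q q i) (x q q j)) / D))"
    if pq: "p \<in> P" "q \<in> P" for p q
  proof -
    let ?B = "\<lambda>i j. A (x p q i) (x p q j)"
    have "pfsum (l + 2) ?B = 0"
    proof (cases "distinct (ks @ [p, q])")
      case True
      then have "pfaffian (l + 2) ?B = 0"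
        using van' ks pq unfolding subpfaffians_vanish_def x_def by simp
      then show ?thesis by (simp only: pfaffian_0_iff)
    next
      case False
      then obtain i j where "i < l + 2" "j < l + 2" "i \<noteq> j" "x p q i = x p q j"
        unfolding distinct_conv_nth x_def using ks by auto
      then show ?thesis by (rule pfsum_repeated)
    qed
    moreover have "pfsum (l + 2) ?B = of_nat (l + 2) * (?B l (l + 1) * pfsum l ?B + (\<Sum>j<l. ?B l j * pfcoef l j ?B))"
      using l xP[OF pq] by (intro pfsum_expand) (auto intro!: skew)
    moreover have "pfsum l ?B = D" unfolding D_def by (rule pfsum_cong) (simp add: x)
    moreover have "pfcoef l j ?B = pfcoef l j (\<lambda>i j. A (x q q i) (x q q j))" for j
    proof (rule pfcoef_cong)
      have "x p q i = x q q i" if "i < l + 2" "i \<noteq> l" for i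
      proof -
        have "i < l \<or> i = l + 1" using that by auto
        then show ?thesis using x xl by metis
      qed
      then show "A (x p q i) (x p q j) = A (x q q i) (x q q j)"
        if "i < l + 2" "j < l + 2" "i \<noteq> l" "j \<noteq> l" for i j using that by metis
    qed
    moreover have "(\<Sum>j<l. A p (x p q j) * c j) = (\<Sum>j<l. A p (ks ! j) * c j)" for c
      by (intro sum.cong) (simp_all add: x)
    ultimately have "of_nat (l + 2) * (A p q * D + (\<Sum>j<l. A p (ks ! j) * pfcoef l j (\<lambda>i j. A (x q q i) (x q q j)))) = 0"
      by (simp only: xl)
    moreover have "of_nat (l + 2) \<noteq> (0 :: complex)" by (simp only: of_nat_eq_0_iff)
    ultimately have "A p q * D + (\<Sum>j<l. A p (ks ! j) * pfcoef l j (\<lambda>i j. A (x q q i) (x q q j))) = 0"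
      by (simp only: mult_eq_0_iff simp_thms)
    then have "A p q = - (\<Sum>j<l. A p (ks ! j) * pfcoef l j (\<lambda>i j. A (x q q i) (x q q j))) / D"
      using ks(4) by (simp add: D_def[symmetric] field_simps eq_neg_iff_add_eq_0)
    then show ?thesis by (simp add: sum_divide_distrib sum_negf)
  qed
  show ?thesis
    by (rule minors_vanish_factorization[of "{..<l}" "k + 1" P P A, OF _ _ A_eq]) (use l in auto)
qed

section \<open>Wedge products of basis vectors\<close>

text \<open>Inversions between two blocks. Unlike those inside a block, they depend only on the two
  multisets.\<close>

definition cross :: "nat list \<Rightarrow> nat list \<Rightarrow> nat" where
  "cross xs ys = (\<Sum>x\<leftarrow>xs. length (filter (\<lambda>y. y < x) ys))"

lemma inversions_Nil: "inversions [] = 0"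
  by (simp add: inversions_def)

lemma inversions_Cons: "inversions (x # xs) = length (filter (\<lambda>y. y < x) xs) + inversions xs"
proof -
  let ?A = "{j. j < length xs \<and> xs ! j < x}"
  let ?B = "{(i, j). i < j \<and> j < length xs \<and> xs ! i > xs ! j}"
  have "{(i, j). i < j \<and> j < length (x # xs) \<and> (x # xs) ! i > (x # xs) ! j}
     = (\<lambda>j. (0, Suc j)) ` ?A \<union> map_prod Suc Suc ` ?B" (is "?L = ?R")
  proof -
    have "(i, j) \<in> ?L \<longleftrightarrow> (i, j) \<in> ?R" for i j
      by (cases i; cases j) (auto simp: image_iff)
    then show ?thesis by (intro Set.set_eqI) (simp only: split_paired_all)
  qed
  moreover have "finite ?B" by (rule finite_subset[of _ "{..<length xs} \<times> {..<length xs}"]) auto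
  moreover have "card ((\<lambda>j. (0 :: nat, Suc j)) ` ?A) = card ?A" by (rule card_image) (auto simp: inj_on_def)
  moreover have "card (map_prod Suc Suc ` ?B) = card ?B" by (rule card_image) (auto simp: inj_on_def)
  moreover have "(\<lambda>j. (0, Suc j)) ` ?A \<inter> map_prod Suc Suc ` ?B = {}" by auto
  ultimately show ?thesis unfolding inversions_def
    by (simp add: card_Un_disjoint length_filter_conv_card)
qed

lemma cross_Nil: "cross [] ys = 0"
  by (simp add: cross_def)

lemma cross_Cons: "cross (x # xs) ys = length (filter (\<lambda>y. y < x) ys) + cross xs ys"
  by (simp add: cross_def)

lemma cross_mset: "mset xs = mset xs' \<Longrightarrow> mset ys = mset ys' \<Longrightarrow> cross xs ys = cross xs' ys'"
  unfolding cross_def sum_mset_sum_list[symmetric] mset_map size_mset[symmetric] mset_filter by simp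

lemma inversions_append: "inversions (xs @ ys) = inversions xs + inversions ys + cross xs ys"
  by (induction xs) (auto simp: inversions_Nil inversions_Cons cross_Nil cross_Cons)

lemma inversions_sorted: "sorted xs \<Longrightarrow> inversions xs = 0"
  by (induction xs) (auto simp: inversions_Nil inversions_Cons filter_empty_conv)

lemma wcoef_mset_middle:
  assumes "mset zs = mset zs'"
  shows "wcoef (xs @ zs @ ys) U = (-1) ^ (inversions zs + inversions zs') * wcoef (xs @ zs' @ ys) U"
proof -
  have d: "distinct (xs @ zs @ ys) \<longleftrightarrow> distinct (xs @ zs' @ ys)" and s: "set (xs @ zs @ ys) = set (xs @ zs' @ ys)"
    using assms mset_eq_imp_distinct_iff[OF assms] mset_eq_setD[OF assms] by auto
  have "cross xs (zs @ ys) = cross xs (zs' @ ys)" "cross zs ys = cross zs' ys"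
    using assms by (auto intro!: cross_mset)
  then have "inversions (xs @ zs @ ys) + inversions zs' = inversions zs + inversions (xs @ zs' @ ys)"
    by (simp add: inversions_append)
  then have "(-1 :: complex) ^ inversions (xs @ zs @ ys) * (-1) ^ inversions zs' * (-1) ^ inversions zs' =
      (-1) ^ inversions zs * (-1) ^ inversions (xs @ zs' @ ys) * (-1) ^ inversions zs'"
    by (metis power_add)
  then have "(-1 :: complex) ^ inversions (xs @ zs @ ys) =
      (-1) ^ (inversions zs + inversions zs') * (-1) ^ inversions (xs @ zs' @ ys)"
    by (simp add: power_add mult_ac left_minus_one_mult_self)
  then show ?thesis using d s by (simp add: wcoef_def)
qed

lemma wcoef_sort_middle:
  assumes "distinct zs"
  shows "wcoef (xs @ zs @ ys) U = (-1) ^ inversions zs * wcoef (xs @ sorted_list_of_set (set zs) @ ys) U"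
proof -
  have "mset zs = mset (sorted_list_of_set (set zs))" using assms
    by (simp add: sorted_list_of_set_sort_remdups distinct_remdups_id)
  from wcoef_mset_middle[OF this] show ?thesis by (simp add: inversions_sorted)
qed

text \<open>Associativity of the wedge product: the inner factor is first expanded in the
  basis.\<close>

lemma wcoef_expand:
  assumes "finite \<S>" "distinct zs \<Longrightarrow> set zs \<in> \<S>"
  shows "(\<Sum>S\<in>\<S>. wcoef zs S * wcoef (xs @ sorted_list_of_set S @ ys) U) = wcoef (xs @ zs @ ys) U"
proof (cases "distinct zs")
  case True
  have "(\<Sum>S\<in>\<S>. wcoef zs S * wcoef (xs @ sorted_list_of_set S @ ys) U)
    = (\<Sum>S\<in>\<S>. if S = set zs then (-1) ^ inversions zs * wcoef (xs @ sorted_list_of_set (set zs) @ ys) U else 0)"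
    using True by (intro sum.cong) (auto simp: wcoef_def)
  also have "\<dots> = wcoef (xs @ zs @ ys) U"
    using assms True by (simp add: wcoef_sort_middle[OF True])
  finally show ?thesis .
next
  case False
  then show ?thesis by (simp add: wcoef_def)
qed

lemma wcoef_swap: "wcoef (xs @ x # y # ys) U = - wcoef (xs @ y # x # ys) U"
proof (cases "x = y")
  case True
  then show ?thesis by (simp add: wcoef_def)
next
  case False
  then show ?thesis
    using wcoef_mset_middle[of "[x, y]" "[y, x]" xs ys U] by (auto simp: inversions_Nil inversions_Cons add_mset_commute)
qed

lemma wcoef_move: "wcoef (xs @ x # ys @ zs) U = (-1) ^ length ys * wcoef (xs @ ys @ x # zs) U"
proof (induction ys arbitrary: xs)
  case (Cons y ys)
  from Cons.IH[of "xs @ [y]"] show ?case by (simp add: wcoef_swap[of xs x y])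
qed simp

lemma wcoef_block_swap:
  "wcoef (xs @ ys @ zs @ us) U = (-1) ^ (length ys * length zs) * wcoef (xs @ zs @ ys @ us) U"
proof (induction ys arbitrary: us)
  case (Cons y ys)
  have "wcoef (xs @ (y # ys) @ zs @ us) U = wcoef (xs @ y # (ys @ zs) @ us) U" by simp
  also have "\<dots> = (-1) ^ length (ys @ zs) * wcoef (xs @ ys @ zs @ y # us) U"
    by (subst wcoef_move) simp
  also have "\<dots> = (-1) ^ length (ys @ zs) * (-1) ^ (length ys * length zs) * wcoef (xs @ zs @ ys @ y # us) U"
    by (simp add: Cons.IH)
  also have "wcoef (xs @ zs @ ys @ y # us) U = (-1) ^ length ys * wcoef ((xs @ zs) @ y # ys @ us) U"
    by (subst wcoef_move) simp
  finally show ?case by (simp add: power_add mult_ac left_minus_one_mult_self)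
qed simp

lemma sum_antisym:
  fixes g :: "'a \<Rightarrow> 'a \<Rightarrow> complex"
  assumes "\<And>i j. g i j = - g j i"
  shows "(\<Sum>i\<in>A. \<Sum>j\<in>A. g i j) = 0"
proof -
  have "(\<Sum>i\<in>A. \<Sum>j\<in>A. g i j) = (\<Sum>i\<in>A. \<Sum>j\<in>A. - g j i)" by (intro sum.cong refl) (rule assms)
  also have "\<dots> = - (\<Sum>i\<in>A. \<Sum>j\<in>A. g i j)" by (subst sum.swap) (simp add: sum_negf)
  finally show ?thesis by simp
qed

text \<open>The relation w \<and> w = 0 inside a longer product.\<close>

lemma wcoef_square_zero:
  "(\<Sum>i\<in>A. \<Sum>j\<in>A. w i * w j * wcoef (xs @ i # ys @ j # zs) U) = 0"
proof (rule sum_antisym)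
  fix i j
  have "wcoef (xs @ i # ys @ j # zs) U = (-1) ^ length ys * wcoef ((xs @ ys) @ i # j # zs) U"
    using wcoef_move[of xs i ys "j # zs" U] by simp
  also have "\<dots> = - ((-1) ^ length ys * wcoef (xs @ ys @ j # i # zs) U)" by (subst wcoef_swap) simp
  also have "\<dots> = - wcoef (xs @ j # ys @ i # zs) U" using wcoef_move[of xs j ys "i # zs" U] by simp
  finally show "w i * w j * wcoef (xs @ i # ys @ j # zs) U = - (w j * w i * wcoef (xs @ j # ys @ i # zs) U)"
    by simp
qed

lemma finite_wsets: "finite (wsets k n)"
  by (rule finite_subset[of _ "Pow {..n}"]) (auto simp: wsets_def)

lemma finite_in_wsets: "S \<in> wsets k n \<Longrightarrow> finite S"
  by (auto simp: wsets_def intro: finite_subset)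

text \<open>Origin of the constant n choose a: if the coordinate \<open>m\<close> of w is nonzero,
  the w \<and> e_S for these sets S form a basis of the image of wedging with w.\<close>

lemma card_wsets_avoiding:
  assumes "m \<le> n"
  shows "card {S \<in> wsets a n. m \<notin> S} = n choose a"
proof -
  have "{S \<in> wsets a n. m \<notin> S} = {S. S \<subseteq> {..n} - {m} \<and> card S = a}" by (auto simp: wsets_def)
  then show ?thesis using n_subsets[of "{..n} - {m}" a] assms by simp
qed

section \<open>Wedging with a fixed vector, and the pairing by the volume form\<close>

definition wedge :: "nat \<Rightarrow> (nat \<Rightarrow> complex) \<Rightarrow> nat set \<Rightarrow> nat set \<Rightarrow> complex" where
  "wedge n w S T = (\<Sum>k\<le>n. w k * wcoef (k # sorted_list_of_set S) T)"

text \<open>For \<open>m\<close> in S and U = S - {m}, the relation w \<and> w \<and> e_U = 0 can be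
  solved for w \<and> e_S, whose coefficient is \<open>w m\<close> up to sign.\<close>

lemma wedge_columns_dependent:
  assumes m: "m \<le> n" "w m \<noteq> 0"
  shows "\<exists>c. \<forall>S\<in>wsets a n. \<forall>T. wedge n w S T = (\<Sum>S'\<in>{S'\<in>wsets a n. m \<notin> S'}. c S S' * wedge n w S' T)"
proof -
  let ?A = "{S'\<in>wsets a n. m \<notin> S'}"
  have fin: "finite ?A" using finite_wsets by simp
  have "\<exists>c. \<forall>T. wedge n w S T = (\<Sum>S'\<in>?A. c S' * wedge n w S' T)" if S: "S \<in> wsets a n" for S
  proof (cases "m \<in> S")
    case False
    then have "wedge n w S T = (\<Sum>S'\<in>?A. (if S' = S then 1 else 0) * wedge n w S' T)" for T
      using S fin by (simp add: if_distrib[of "\<lambda>x. x * _"] cong: if_cong)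
    then show ?thesis by (intro exI[of _ "\<lambda>S'. if S' = S then 1 else 0"] allI)
  next
    case True
    define U where "U = sorted_list_of_set (S - {m})"
    have finS: "finite S" using S by (rule finite_in_wsets)
    have U: "set U = S - {m}" "distinct U" "length U = a - 1"
      using finS True S by (auto simp: U_def wsets_def)
    have a: "a > 0" using True finS S card_gt_0_iff by (auto simp: wsets_def)
    have dist: "set (i # U) \<in> wsets a n" if "distinct (i # U)" "i \<le> n" for i
      using that U S a distinct_card[OF that(1)] by (auto simp: wsets_def)
    define \<epsilon> where "\<epsilon> = wcoef (m # U) S"
    have \<epsilon>: "\<epsilon> \<noteq> 0" using U True by (auto simp: \<epsilon>_def wcoef_def)
    have mU: "wcoef (m # U) S' = (if S' = S then \<epsilon> else 0)" for S'
      using U True by (auto simp: \<epsilon>_def wcoef_def)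
    define c where "c = (\<lambda>S'. - (\<Sum>i\<in>{..n} - {m}. w i * wcoef (i # U) S') / (w m * \<epsilon>))"
    have "wedge n w S T = (\<Sum>S'\<in>?A. c S' * wedge n w S' T)" for T
    proof -
      have "0 = (\<Sum>k\<le>n. \<Sum>i\<le>n. w k * w i * wcoef (k # i # U) T)"
        using wcoef_square_zero[where xs = "[]" and ys = "[]" and zs = U and A = "{..n}" and w = w and U = T] by simp
      also have "\<dots> = (\<Sum>k\<le>n. \<Sum>i\<le>n. w k * w i * (\<Sum>S'\<in>wsets a n. wcoef (i # U) S' * wcoef (k # sorted_list_of_set S') T))"
        using wcoef_expand[of "wsets a n" "_ # U" "[_]" "[]" T, OF finite_wsets dist] by (intro sum.cong) auto
      also have "\<dots> = (\<Sum>i\<le>n. \<Sum>S'\<in>wsets a n. w i * wcoef (i # U) S' * wedge n w S' T)"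
        unfolding wedge_def sum_distrib_left
        by (subst sum.swap, intro sum.cong refl, subst sum.swap) (simp add: mult_ac)
      also have "\<dots> = (\<Sum>S'\<in>wsets a n. w m * wcoef (m # U) S' * wedge n w S' T)
          + (\<Sum>i\<in>{..n} - {m}. \<Sum>S'\<in>wsets a n. w i * wcoef (i # U) S' * wedge n w S' T)"
        using m by (subst sum.remove[of _ m]) auto
      also have "(\<Sum>S'\<in>wsets a n. w m * wcoef (m # U) S' * wedge n w S' T) = w m * \<epsilon> * wedge n w S T"
        unfolding mU using S finite_wsets
        by (simp add: if_distrib[of "\<lambda>x. _ * x"] if_distrib[of "\<lambda>x. x * _"] cong: if_cong)
      also have "(\<Sum>i\<in>{..n} - {m}. \<Sum>S'\<in>wsets a n. w i * wcoef (i # U) S' * wedge n w S' T)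
         = (\<Sum>i\<in>{..n} - {m}. \<Sum>S'\<in>?A. w i * wcoef (i # U) S' * wedge n w S' T)"
      proof (rule sum.cong[OF refl])
        fix i assume "i \<in> {..n} - {m}"
        then have "wcoef (i # U) S' = 0" if "S' \<in> wsets a n - ?A" for S'
          using that U by (auto simp: wcoef_def)
        then show "(\<Sum>S'\<in>wsets a n. w i * wcoef (i # U) S' * wedge n w S' T)
           = (\<Sum>S'\<in>?A. w i * wcoef (i # U) S' * wedge n w S' T)"
          by (intro sum.mono_neutral_right[OF finite_wsets]) auto
      qed
      also have "\<dots> = (\<Sum>S'\<in>?A. (\<Sum>i\<in>{..n} - {m}. w i * wcoef (i # U) S') * wedge n w S' T)"
        by (subst sum.swap) (simp add: sum_distrib_right)
      finally have "w m * \<epsilon> * wedge n w S T = - (\<Sum>S'\<in>?A. (\<Sum>i\<in>{..n} - {m}. w i * wcoef (i # U) S') * wedge n w S' T)"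
        by (simp add: eq_neg_iff_add_eq_0)
      then have "wedge n w S T = - (\<Sum>S'\<in>?A. (\<Sum>i\<in>{..n} - {m}. w i * wcoef (i # U) S') * wedge n w S' T) / (w m * \<epsilon>)"
        using m \<epsilon> by (simp add: field_simps)
      also have "\<dots> = (\<Sum>S'\<in>?A. c S' * wedge n w S' T)"
        unfolding c_def minus_divide_left[symmetric] sum_divide_distrib[of _ ?A] by (simp add: sum_negf)
      finally show ?thesis .
    qed
    then show ?thesis by (intro exI[of _ c] allI)
  qed
  then show ?thesis by (intro bchoice ballI)
qed

text \<open>Exchanging two blocks of length a takes a * a transpositions; the tensor itself is
  unaffected by the exchange of its arguments.\<close>

lemma YF_pair_sym:
  assumes \<Phi>: "\<Phi> \<in> symT d n" and p: "p \<in> YF_cols \<delta> n a" and q: "q \<in> YF_cols \<delta> n a"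
  shows "YF_pair n \<Phi> p q = (-1) ^ (a * a) * YF_pair n \<Phi> q p"
proof -
  obtain I S' J S where pq: "p = (I, S')" "q = (J, S)" by (cases p, cases q)
  have len: "length (sorted_list_of_set S') = a" "length (sorted_list_of_set S) = a"
    using p q by (auto simp: pq YF_cols_def wsets_def)
  have "\<Phi> (I @ J @ [k]) * wcoef (k # sorted_list_of_set S @ sorted_list_of_set S') {..n}
     = (-1) ^ (a * a) * (\<Phi> (J @ I @ [k]) * wcoef (k # sorted_list_of_set S' @ sorted_list_of_set S) {..n})" for k
  proof -
    have "mset (I @ J @ [k]) = mset (J @ I @ [k])" by simp
    then have "\<Phi> (I @ J @ [k]) = \<Phi> (J @ I @ [k])" using \<Phi> unfolding symT_def by blast
    then show ?thesis
      using wcoef_block_swap[of "[k]" "sorted_list_of_set S" "sorted_list_of_set S'" "[]" "{..n}"] len by simp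
  qed
  then show ?thesis by (simp add: pq YF_pair_def sum_distrib_left)
qed

text \<open>Among the e_T only the one for the complement of S' has a nonzero product with e_S', so
  a row of the pairing is a row of the flattening times the sign of a shuffle.\<close>

lemma YF_pair_eq_YF_mat:
  assumes S': "S' \<in> wsets (n - a) n" and S: "S \<in> wsets a n" and a: "a \<le> n"
  shows "YF_pair n \<Phi> (I, S') (J, S) = wcoef (sorted_list_of_set ({..n} - S') @ sorted_list_of_set S') {..n}
     * YF_mat n \<Phi> (I, {..n} - S') (J, S)"
proof -
  let ?T = "{..n} - S'"
  have finS: "finite S" "finite S'" using S S' by (auto intro: finite_in_wsets)
  have T: "?T \<in> wsets (a + 1) n" using S' finS a by (auto simp: wsets_def card_Diff_subset)
  have "wcoef (k # sorted_list_of_set S @ sorted_list_of_set S') {..n}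
     = wcoef (sorted_list_of_set ?T @ sorted_list_of_set S') {..n} * wcoef (k # sorted_list_of_set S) ?T" if "k \<le> n" for k
  proof -
    have "set (k # sorted_list_of_set S) \<in> wsets (a + 1) n" if "distinct (k # sorted_list_of_set S)"
      using that \<open>k \<le> n\<close> S finS distinct_card[OF that] by (auto simp: wsets_def)
    then have "wcoef (k # sorted_list_of_set S @ sorted_list_of_set S') {..n}
      = (\<Sum>T\<in>wsets (a + 1) n. wcoef (k # sorted_list_of_set S) T * wcoef (sorted_list_of_set T @ sorted_list_of_set S') {..n})"
      using wcoef_expand[of "wsets (a + 1) n" "k # sorted_list_of_set S" "[]" "sorted_list_of_set S'" "{..n}"] finite_wsets
      by simp
    also have "\<dots> = (\<Sum>T\<in>{?T}. wcoef (k # sorted_list_of_set S) T * wcoef (sorted_list_of_set T @ sorted_list_of_set S') {..n})"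
    proof (rule sum.mono_neutral_right)
      have "wcoef (sorted_list_of_set T @ sorted_list_of_set S') {..n} = 0" if "T \<in> wsets (a + 1) n" "T \<noteq> ?T" for T
        using finite_in_wsets[OF that(1)] finS that(2) by (auto simp: wcoef_def)
      then show "\<forall>T\<in>wsets (a + 1) n - {?T}. wcoef (k # sorted_list_of_set S) T * wcoef (sorted_list_of_set T @ sorted_list_of_set S') {..n} = 0"
        by auto
    qed (use T finite_wsets in auto)
    finally show ?thesis by (simp add: mult.commute)
  qed
  then show ?thesis by (simp add: YF_pair_def YF_mat_def sum_distrib_left mult_ac)
qed

section \<open>Symmetric tensors and lattice points\<close>

text \<open>\<open>contract n \<psi> [L\<^sub>1, \<dots>, L\<^sub>d]\<close> is the value of \<open>\<psi>\<close>, as a functional on forms of degree \<open>d\<close>, on the product of the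
  linear forms \<open>L\<^sub>i\<close>; a linear form is given by its coefficients.\<close>
fun contract :: "nat \<Rightarrow> (nat list \<Rightarrow> complex) \<Rightarrow> (nat \<Rightarrow> complex) list \<Rightarrow> complex" where
  "contract n \<psi> [] = \<psi> []"
| "contract n \<psi> (L # Ls) = (\<Sum>k\<le>n. L k * contract n (\<lambda>xs. \<psi> (k # xs)) Ls)"

definition lval :: "nat \<Rightarrow> (nat \<Rightarrow> complex) \<Rightarrow> (nat \<Rightarrow> complex) \<Rightarrow> complex" where
  "lval n L w = (\<Sum>k\<le>n. L k * w k)"

definition sym_tensor :: "(nat list \<Rightarrow> complex) \<Rightarrow> bool" where
  "sym_tensor \<psi> \<longleftrightarrow> (\<forall>xs ys. mset xs = mset ys \<longrightarrow> \<psi> xs = \<psi> ys)"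

definition unit_form :: "nat \<Rightarrow> nat \<Rightarrow> complex" where
  "unit_form k = (\<lambda>i. of_bool (i = k))"

lemma contract_append: "contract n \<psi> (Ls @ Ms) = contract n (\<lambda>xs. contract n (\<lambda>ys. \<psi> (xs @ ys)) Ms) Ls"
  by (induction Ls arbitrary: \<psi>) auto

lemma contract_add: "contract n (\<lambda>xs. \<psi> xs + \<phi> xs) Ls = contract n \<psi> Ls + contract n \<phi> Ls"
  by (induction Ls arbitrary: \<psi> \<phi>) (auto simp: distrib_left sum.distrib)

lemma contract_zero: "contract n (\<lambda>xs. 0) Ls = 0"
  by (induction Ls) auto

lemma contract_cmult: "contract n (\<lambda>xs. c * \<psi> xs) Ls = c * contract n \<psi> Ls"
  by (induction Ls arbitrary: \<psi>) (auto simp: sum_distrib_left mult_ac)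

lemma contract_diff: "contract n (\<lambda>xs. \<psi> xs - \<phi> xs) Ls = contract n \<psi> Ls - contract n \<phi> Ls"
  using contract_add[of n \<psi> "\<lambda>xs. (-1) * \<phi> xs" Ls] contract_cmult[of n "-1" \<phi> Ls] by simp

lemma contract_sum: "contract n (\<lambda>xs. \<Sum>i\<in>S. \<psi> i xs) Ls = (\<Sum>i\<in>S. contract n (\<psi> i) Ls)"
  by (induction S rule: infinite_finite_induct) (auto simp: contract_zero contract_add)

lemma contract_cong:
  assumes "\<And>xs. xs \<in> tidx (length Ls) n \<Longrightarrow> \<psi> xs = \<phi> xs"
  shows "contract n \<psi> Ls = contract n \<phi> Ls"
  using assms
proof (induction Ls arbitrary: \<psi> \<phi>)
  case Nil
  then show ?case by (simp add: tidx_def)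
next
  case (Cons L Ls)
  have "contract n (\<lambda>xs. \<psi> (k # xs)) Ls = contract n (\<lambda>xs. \<phi> (k # xs)) Ls" if "k \<le> n" for k
    using that Cons.prems by (intro Cons.IH) (auto simp: tidx_def)
  then show ?case by simp
qed

lemma sym_tensor_Cons: "sym_tensor \<psi> \<Longrightarrow> sym_tensor (\<lambda>xs. \<psi> (k # xs))"
  by (simp add: sym_tensor_def)

lemma contract_swap:
  assumes "sym_tensor \<psi>"
  shows "contract n \<psi> (L # M # Ls) = contract n \<psi> (M # L # Ls)"
proof -
  have "\<psi> (k # l # xs) = \<psi> (l # k # xs)" for k l xs
    using assms unfolding sym_tensor_def by (elim allE[of _ "k # l # xs"] allE[of _ "l # k # xs"]) (simp add: add_mset_commute)
  then show ?thesis by (simp add: sum_distrib_left) (subst sum.swap, simp add: mult_ac)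
qed

lemma contract_move: "sym_tensor \<psi> \<Longrightarrow> contract n \<psi> (Ls @ L # Ms) = contract n \<psi> (L # Ls @ Ms)"
proof (induction Ls arbitrary: \<psi>)
  case (Cons M Ls)
  have "contract n \<psi> ((M # Ls) @ L # Ms) = contract n \<psi> (M # L # Ls @ Ms)"
    using Cons.IH[OF sym_tensor_Cons[OF Cons.prems]] by simp
  then show ?case using contract_swap[OF Cons.prems] by simp
qed simp

lemma contract_mset:
  assumes "sym_tensor \<psi>" "mset Ls = mset Ms"
  shows "contract n \<psi> Ls = contract n \<psi> Ms"
  using assms
proof (induction Ls arbitrary: \<psi> Ms)
  case (Cons L Ls)
  from Cons.prems(2) have "L \<in> set Ms" by (metis list.set_intros(1) mset_eq_setD)
  then obtain Ms1 Ms2 where Ms: "Ms = Ms1 @ L # Ms2" by (meson split_list)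
  with Cons.prems(2) have "mset Ls = mset (Ms1 @ Ms2)" by simp
  then have "contract n (\<lambda>xs. \<psi> (k # xs)) Ls = contract n (\<lambda>xs. \<psi> (k # xs)) (Ms1 @ Ms2)" for k
    using Cons.IH sym_tensor_Cons[OF Cons.prems(1)] by blast
  then show ?case using contract_move[OF Cons.prems(1), of n Ms1 L Ms2] by (simp add: Ms)
qed simp

lemma contract_last: "contract n \<psi> (Ls @ [L]) = (\<Sum>k\<le>n. L k * contract n \<psi> (Ls @ [unit_form k]))"
proof -
  have u: "(\<Sum>k\<le>n. unit_form l k * f k) = f l" if "l \<le> n" for l f
    using that by (simp add: unit_form_def of_bool_def if_distrib[of "\<lambda>x. x * _"] cong: if_cong)
  have "contract n \<psi> (Ls @ [L]) = (\<Sum>k\<le>n. L k * contract n (\<lambda>xs. \<psi> (xs @ [k])) Ls)"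
    by (simp add: contract_append contract_sum contract_cmult)
  moreover have "contract n \<psi> (Ls @ [unit_form k]) = contract n (\<lambda>xs. \<psi> (xs @ [k])) Ls" if "k \<le> n" for k
    using u[OF that] by (simp add: contract_append contract_sum contract_cmult)
  ultimately show ?thesis by simp
qed

lemma contract_units: "set xs \<subseteq> {..n} \<Longrightarrow> contract n \<psi> (map unit_form xs) = \<psi> xs"
  by (induction xs arbitrary: \<psi>)
    (auto simp: unit_form_def of_bool_def if_distrib[of "\<lambda>x. x * _"] cong: if_cong)

lemma contract_power: "contract n (\<lambda>xs. prod_list (map w xs)) Ls = prod_list (map (\<lambda>L. lval n L w) Ls)"
  by (induction Ls) (auto simp: lval_def contract_cmult sum_distrib_right mult_ac)

text \<open>The derivative of \<open>(w + s v)^d\<close> at s = 0, with d the length of the list: a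
  tangent vector of the cone over the Veronese variety. \<open>prod_deriv\<close> is the
  corresponding derivative of a product of linear forms.\<close>

fun power_tangent :: "(nat \<Rightarrow> complex) \<Rightarrow> (nat \<Rightarrow> complex) \<Rightarrow> nat list \<Rightarrow> complex" where
  "power_tangent w v [] = 0"
| "power_tangent w v (k # xs) = v k * prod_list (map w xs) + w k * power_tangent w v xs"

fun prod_deriv :: "nat \<Rightarrow> (nat \<Rightarrow> complex) \<Rightarrow> (nat \<Rightarrow> complex) \<Rightarrow> (nat \<Rightarrow> complex) list \<Rightarrow> complex" where
  "prod_deriv n w v [] = 0"
| "prod_deriv n w v (L # Ls) = lval n L v * prod_list (map (\<lambda>L. lval n L w) Ls) + lval n L w * prod_deriv n w v Ls"

lemma contract_power_tangent: "contract n (power_tangent w v) Ls = prod_deriv n w v Ls"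
proof (induction Ls)
  case (Cons L Ls)
  have "contract n (power_tangent w v) (L # Ls) = (\<Sum>k\<le>n. L k * (v k * prod_list (map (\<lambda>L. lval n L w) Ls) + w k * prod_deriv n w v Ls))"
    by (simp add: contract_add contract_cmult contract_power Cons.IH)
  also have "\<dots> = prod_deriv n w v (L # Ls)"
    by (simp add: lval_def sum_distrib_right sum_distrib_left sum.distrib distrib_left mult_ac)
  finally show ?case .
qed simp

lemma prod_deriv_append: "prod_deriv n w v (Ls @ Ms) =
    prod_deriv n w v Ls * prod_list (map (\<lambda>L. lval n L w) Ms) + prod_list (map (\<lambda>L. lval n L w) Ls) * prod_deriv n w v Ms"
  by (induction Ls) (auto simp: algebra_simps)

lemma lval_lincomb: "lval n L (\<lambda>k. a * u k + b * v k) = a * lval n L u + b * lval n L v"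
  by (simp add: lval_def sum_distrib_left sum.distrib distrib_left mult_ac)

lemma prod_deriv_lincomb: "prod_deriv n w (\<lambda>k. a * u k + b * v k) Ls = a * prod_deriv n w u Ls + b * prod_deriv n w v Ls"
  by (induction Ls) (auto simp: lval_lincomb algebra_simps)

lemma prod_deriv_Euler: "prod_deriv n w w Ls = of_nat (length Ls) * prod_list (map (\<lambda>L. lval n L w) Ls)"
  by (induction Ls) (auto simp: algebra_simps)

lemma power_tangent_append_middle: "power_tangent w v (xs @ y # ys) = power_tangent w v (y # xs @ ys)"
  by (induction xs) (auto simp: algebra_simps)

lemma sym_tensor_power_tangent: "sym_tensor (power_tangent w v)"
  unfolding sym_tensor_def
proof (intro allI impI)
  fix xs ys :: "nat list" assume "mset xs = mset ys"
  then show "power_tangent w v xs = power_tangent w v ys"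
  proof (induction xs arbitrary: ys)
    case (Cons x xs)
    then have "x \<in> set ys" by (metis list.set_intros(1) mset_eq_setD)
    then obtain as bs where ys: "ys = as @ x # bs" by (meson split_list)
    with Cons.prems have m: "mset xs = mset (as @ bs)" by simp
    then have "prod_list (map w xs) = prod_list (map w (as @ bs))"
      by (metis mset_map prod_mset_prod_list)
    then show ?case using Cons.IH[OF m] by (simp only: ys power_tangent_append_middle power_tangent.simps)
  qed simp
qed

text \<open>Gives the polynomial path, together with its velocity, that the smooth point criterion
  asks for.\<close>

lemma power_path:
  "\<exists>E. (\<forall>s. prod_list (map (\<lambda>k. w k + s * v k) xs) = prod_list (map w xs) + s * poly E s)
     \<and> poly E 0 = power_tangent w v xs"
proof (induction xs)
  case Nil
  show ?case by (intro exI[of _ 0]) simp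
next
  case (Cons k xs)
  then obtain E where E: "\<And>s. prod_list (map (\<lambda>k. w k + s * v k) xs) = prod_list (map w xs) + s * poly E s"
    "poly E 0 = power_tangent w v xs" by blast
  show ?case
    by (intro exI[of _ "[:v k * prod_list (map w xs):] + [:w k, v k:] * E"]) (simp add: E algebra_simps)
qed

section \<open>Lattice points of a simplex and their interpolating forms\<close>

definition lattice :: "nat \<Rightarrow> nat \<Rightarrow> (nat \<Rightarrow> nat) set" where
  "lattice d n = {\<alpha>. (\<forall>k>n. \<alpha> k = 0) \<and> (\<Sum>k\<le>n. \<alpha> k) = d}"

definition pt :: "(nat \<Rightarrow> nat) \<Rightarrow> nat \<Rightarrow> complex" where
  "pt \<alpha> = (\<lambda>k. of_nat (\<alpha> k))"

text \<open>The linear form \<open>x\<^sub>k - j h\<close> with \<open>h = (x\<^sub>0 + \<dots> + x\<^sub>n) / \<delta>\<close>.\<close>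
definition falling_form :: "nat \<Rightarrow> nat \<Rightarrow> nat \<Rightarrow> nat \<Rightarrow> complex" where
  "falling_form \<delta> k j = (\<lambda>i. of_bool (i = k) - of_nat j / of_nat \<delta>)"

text \<open>A list of factors rather than a function, so that identities between products become
  identities of multisets. Points \<alpha> of degree below \<delta> give the partial products used
  in \<open>interp_forms_spans\<close>.\<close>

definition interp_forms :: "nat \<Rightarrow> nat \<Rightarrow> (nat \<Rightarrow> nat) \<Rightarrow> (nat \<Rightarrow> complex) list" where
  "interp_forms \<delta> n \<alpha> = concat (map (\<lambda>k. map (falling_form \<delta> k) [0..<\<alpha> k]) [0..<Suc n])"

lemma mset_interp_forms: "mset (interp_forms \<delta> n \<alpha>) = (\<Sum>k\<le>n. image_mset (falling_form \<delta> k) (mset [0..<\<alpha> k]))"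
  unfolding interp_forms_def by (induction n) (simp_all add: atLeast0LessThan)

text \<open>Source of the syzygies: raising one coordinate adds a single factor.\<close>

lemma mset_interp_Suc:
  assumes "k \<le> n"
  shows "mset (interp_forms \<delta> n (\<alpha>(k := Suc (\<alpha> k)))) = add_mset (falling_form \<delta> k (\<alpha> k)) (mset (interp_forms \<delta> n \<alpha>))"
proof -
  have "(\<Sum>i\<in>{..n} - {k}. image_mset (falling_form \<delta> i) (mset [0..<(\<alpha>(k := Suc (\<alpha> k))) i]))
     = (\<Sum>i\<in>{..n} - {k}. image_mset (falling_form \<delta> i) (mset [0..<\<alpha> i]))" by (intro sum.cong) auto
  then show ?thesis unfolding mset_interp_forms
    using assms by (subst (1 2) sum.remove[of "{..n}" k]) auto
qed

lemma length_interp_forms: "length (interp_forms \<delta> n \<alpha>) = (\<Sum>k\<le>n. \<alpha> k)"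
proof -
  have "size (mset (interp_forms \<delta> n \<alpha>)) = (\<Sum>k\<le>n. \<alpha> k)"
    unfolding mset_interp_forms by (induction n) auto
  then show ?thesis by simp
qed

lemma lval_falling_form:
  assumes "\<beta> \<in> lattice \<delta> n" "k \<le> n" "\<delta> \<ge> 1"
  shows "lval n (falling_form \<delta> k j) (pt \<beta>) = of_nat (\<beta> k) - of_nat j"
proof -
  have "lval n (falling_form \<delta> k j) (pt \<beta>) = (\<Sum>i\<le>n. of_bool (i = k) * pt \<beta> i) - of_nat j / of_nat \<delta> * (\<Sum>i\<le>n. pt \<beta> i)"
    by (simp add: lval_def falling_form_def left_diff_distrib sum_subtractf sum_distrib_left)
  also have "(\<Sum>i\<le>n. of_bool (i = k) * pt \<beta> i) = pt \<beta> k"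
    using assms by (simp add: of_bool_def if_distrib[of "\<lambda>x. x * _"] cong: if_cong)
  also have "(\<Sum>i\<le>n. pt \<beta> i) = of_nat \<delta>"
    using assms by (simp add: pt_def lattice_def flip: of_nat_sum)
  finally show ?thesis using assms by (simp add: pt_def)
qed

lemma interp_forms_val:
  "prod_list (map (\<lambda>L. lval n L w) (interp_forms \<delta> n \<alpha>)) = (\<Prod>k\<le>n. \<Prod>j<\<alpha> k. lval n (falling_form \<delta> k j) w)"
proof -
  have "prod_list (map f (concat (map (\<lambda>k. map (falling_form \<delta> k) [0..<\<alpha> k]) [0..<Suc m]))) = (\<Prod>k\<le>m. \<Prod>j<\<alpha> k. f (falling_form \<delta> k j))"
    for f :: "(nat \<Rightarrow> complex) \<Rightarrow> complex" and m
    by (induction m) (simp_all add: comp_def prod.list_conv_set_nth[symmetric] atLeast0LessThan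
      flip: prod.distinct_set_conv_list)
  then show ?thesis by (simp only: interp_forms_def)
qed

lemma lattice_eqI:
  assumes "\<alpha> \<in> lattice \<delta> n" "\<beta> \<in> lattice \<delta> n" "\<And>k. k \<le> n \<Longrightarrow> \<alpha> k \<le> \<beta> k"
  shows "\<alpha> = \<beta>"
proof
  fix k
  show "\<alpha> k = \<beta> k"
  proof (cases "k \<le> n")
    case True
    have "(\<Sum>k\<le>n. \<beta> k - \<alpha> k) = 0"
      using assms by (subst sum_subtractf_nat) (auto simp: lattice_def)
    then have "\<beta> k \<le> \<alpha> k" using True by auto
    then show ?thesis using assms(3)[OF True] by simp
  next
    case False
    then show ?thesis using assms by (simp add: lattice_def)
  qed
qed

text \<open>Both points have the same degree, so \<beta> k < \<alpha> k for some k, and the factor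
  with j = \<beta> k vanishes.\<close>

lemma interp_forms_val_0:
  assumes "\<alpha> \<in> lattice \<delta> n" "\<beta> \<in> lattice \<delta> n" "\<alpha> \<noteq> \<beta>" "\<delta> \<ge> 1"
  shows "prod_list (map (\<lambda>L. lval n L (pt \<beta>)) (interp_forms \<delta> n \<alpha>)) = 0"
proof -
  obtain k where k: "k \<le> n" "\<beta> k < \<alpha> k" using assms lattice_eqI[of \<alpha> \<delta> n \<beta>] by (meson not_le)
  then have "(\<Prod>j<\<alpha> k. lval n (falling_form \<delta> k j) (pt \<beta>)) = 0"
    using assms by (intro prod_zero) (auto simp: lval_falling_form intro!: bexI[of _ "\<beta> k"])
  then show ?thesis unfolding interp_forms_val using k by (intro prod_zero) auto
qed

lemma interp_forms_val_nz:
  assumes "\<alpha> \<in> lattice \<delta> n" "\<delta> \<ge> 1"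
  shows "prod_list (map (\<lambda>L. lval n L (pt \<alpha>)) (interp_forms \<delta> n \<alpha>)) \<noteq> 0"
  unfolding interp_forms_val using assms by (auto simp: lval_falling_form)

text \<open>Cramer's rule in the coordinates \<open>y\<close> and \<open>z\<close> fixes the two
  coefficients; the 3 x 3 determinant with a further coordinate extends the relation to it.\<close>

lemma span_from_minors:
  fixes u v q :: "nat \<Rightarrow> complex"
  assumes yz: "y \<le> n" "z \<le> n" and D: "u y * v z - u z * v y \<noteq> 0"
    and minors: "\<And>x y z. x \<le> n \<Longrightarrow> y \<le> n \<Longrightarrow> z \<le> n \<Longrightarrow> distinct [x, y, z] \<Longrightarrow>
      q x * (u y * v z - u z * v y) + q y * (u z * v x - u x * v z) + q z * (u x * v y - u y * v x) = 0"
  shows "\<exists>a b. \<forall>k\<le>n. q k = a * u k + b * v k"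
proof -
  let ?D = "u y * v z - u z * v y"
  let ?a = "(q y * v z - q z * v y) / ?D" and ?b = "(u y * q z - u z * q y) / ?D"
  have "q x = ?a * u x + ?b * v x" if "x \<le> n" for x
  proof -
    have "q x * ?D + q y * (u z * v x - u x * v z) + q z * (u x * v y - u y * v x) = 0"
    proof (cases "distinct [x, y, z]")
      case True
      then show ?thesis using minors that yz by blast
    next
      case False
      moreover have "y \<noteq> z" using D by auto
      ultimately have "x = y \<or> x = z" by auto
      then show ?thesis by (auto simp: algebra_simps)
    qed
    then have "q x * ?D = (q y * v z - q z * v y) * u x + (u y * q z - u z * q y) * v x"
      by (simp add: algebra_simps add_eq_0_iff)
    then have "q x = ((q y * v z - q z * v y) * u x + (u y * q z - u z * q y) * v x) / ?D"
      using D by (simp add: eq_divide_eq)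
    then show ?thesis by (simp add: add_divide_distrib)
  qed
  then show ?thesis by blast
qed

text \<open>Proportional vectors with the same positive coordinate sum coincide.\<close>

lemma lattice_independent:
  assumes "\<alpha> \<in> lattice \<delta> n" "\<beta> \<in> lattice \<delta> n" "\<alpha> \<noteq> \<beta>" "\<delta> \<ge> 1"
  shows "\<exists>y\<le>n. \<exists>z\<le>n. pt \<alpha> y * pt \<beta> z - pt \<alpha> z * pt \<beta> y \<noteq> 0"
proof (rule ccontr)
  assume *: "\<not> ?thesis"
  have "\<alpha> y = \<beta> y" if "y \<le> n" for y
  proof -
    have "\<alpha> y * \<beta> z = \<alpha> z * \<beta> y" if "z \<le> n" for z
      using * that \<open>y \<le> n\<close> by (auto simp: pt_def simp flip: of_nat_mult)
    then have "(\<Sum>z\<le>n. \<alpha> y * \<beta> z) = (\<Sum>z\<le>n. \<alpha> z * \<beta> y)" by (intro sum.cong) auto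
    then have "\<alpha> y * \<delta> = \<delta> * \<beta> y" using assms by (simp add: lattice_def flip: sum_distrib_left sum_distrib_right)
    then show ?thesis using assms by simp
  qed
  then show False using lattice_eqI[OF assms(1,2)] assms(3) by auto
qed

lemma lattice_zero: "(\<lambda>_. 0) \<in> lattice 0 n"
  by (simp add: lattice_def)

text \<open>The interpolating forms span all forms of degree \<delta>; a monomial is built up one
  variable at a time. For \<gamma> of degree m < \<delta> the forms
  \<open>x\<^sub>l - \<gamma> l h\<close> add up to (\<delta> - m) h, so they span h and with it
  every variable. The factors \<open>Rs\<close> are carried along.\<close>

lemma interp_forms_spans:
  assumes sym: "sym_tensor \<psi>" and \<delta>: "\<delta> \<ge> 1"
    and van: "\<And>\<gamma>. \<gamma> \<in> lattice \<delta> n \<Longrightarrow> contract n \<psi> (interp_forms \<delta> n \<gamma> @ Rs) = 0"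
    and ks: "set ks \<subseteq> {..n}" "length ks = \<delta>"
  shows "contract n \<psi> (map unit_form ks @ Rs) = 0"
proof -
  have "contract n \<psi> (interp_forms \<delta> n \<gamma> @ map unit_form ks @ Rs) = 0"
    if "\<gamma> \<in> lattice m n" "set ks \<subseteq> {..n}" "m + length ks = \<delta>" for \<gamma> ks m
    using that
  proof (induction ks arbitrary: \<gamma> m)
    case Nil
    then show ?case using van by simp
  next
    case (Cons k ks)
    let ?R = "interp_forms \<delta> n \<gamma> @ map unit_form ks @ Rs"
    let ?g = "\<lambda>i. falling_form \<delta> i (\<gamma> i)"
    have step: "contract n \<psi> (?g i # ?R) = 0" if i: "i \<le> n" for i
    proof -
      have "mset (?g i # ?R) = mset (interp_forms \<delta> n (\<gamma>(i := Suc (\<gamma> i))) @ map unit_form ks @ Rs)"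
        using mset_interp_Suc[OF i, of \<delta> \<gamma>] by simp
      moreover have "\<gamma>(i := Suc (\<gamma> i)) \<in> lattice (Suc m) n"
      proof -
        have "(\<Sum>k\<le>n. (\<gamma>(i := Suc (\<gamma> i))) k) = Suc (\<Sum>k\<le>n. \<gamma> k)"
        proof -
          have "(\<Sum>k\<in>{..n} - {i}. (\<gamma>(i := Suc (\<gamma> i))) k) = (\<Sum>k\<in>{..n} - {i}. \<gamma> k)" by (intro sum.cong) auto
          then show ?thesis using i by (subst (1 2) sum.remove[of "{..n}" i]) auto
        qed
        then show ?thesis using Cons.prems(1) i by (auto simp: lattice_def)
      qed
      ultimately show ?thesis
        using Cons.IH[of "\<gamma>(i := Suc (\<gamma> i))" "Suc m"] Cons.prems contract_mset[OF sym] by (metis add_Suc add_Suc_right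
            insert_subset length_Cons list.simps(15))
    qed
    have m: "of_nat \<delta> - of_nat m \<noteq> (0 :: complex)"
    proof -
      have "m < \<delta>" using Cons.prems(3) by auto
      then show ?thesis by auto
    qed
    have form: "unit_form k i = ?g k i + of_nat (\<gamma> k) / (of_nat \<delta> - of_nat m) * (\<Sum>l\<le>n. ?g l i)" if "i \<le> n" for i
    proof -
      have "(\<Sum>l\<le>n. ?g l i) = (\<Sum>l\<le>n. of_bool (i = l)) - (\<Sum>l\<le>n. of_nat (\<gamma> l)) / of_nat \<delta>"
        by (simp add: falling_form_def sum_subtractf sum_divide_distrib)
      also have "(\<Sum>l\<le>n. of_bool (i = l)) = (1 :: complex)" using that by (simp add: of_bool_def)
      also have "(\<Sum>l\<le>n. of_nat (\<gamma> l)) = (of_nat m :: complex)"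
        using Cons.prems(1) by (simp add: lattice_def flip: of_nat_sum)
      finally have "(\<Sum>l\<le>n. ?g l i) = (of_nat \<delta> - of_nat m) / of_nat \<delta>" using \<delta> by (simp add: field_simps)
      then show ?thesis using m by (simp add: unit_form_def falling_form_def)
    qed
    have "contract n \<psi> (unit_form k # ?R) = (\<Sum>i\<le>n. (?g k i + of_nat (\<gamma> k) / (of_nat \<delta> - of_nat m) * (\<Sum>l\<le>n. ?g l i)) * contract n (\<lambda>xs. \<psi> (i # xs)) ?R)"
      using form by simp
    also have "\<dots> = (\<Sum>i\<le>n. ?g k i * contract n (\<lambda>xs. \<psi> (i # xs)) ?R)
        + of_nat (\<gamma> k) / (of_nat \<delta> - of_nat m) * (\<Sum>i\<le>n. \<Sum>l\<le>n. ?g l i * contract n (\<lambda>xs. \<psi> (i # xs)) ?R)"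
      by (simp add: distrib_right sum.distrib sum_distrib_left sum_distrib_right mult.assoc)
    also have "(\<Sum>i\<le>n. \<Sum>l\<le>n. ?g l i * contract n (\<lambda>xs. \<psi> (i # xs)) ?R) = (\<Sum>l\<le>n. contract n \<psi> (?g l # ?R))"
      by (subst sum.swap) simp
    also have "\<dots> = 0" using step by (intro sum.neutral) auto
    also have "(\<Sum>i\<le>n. ?g k i * contract n (\<lambda>xs. \<psi> (i # xs)) ?R) = 0" using step[of k] Cons.prems by simp
    finally have "contract n \<psi> (unit_form k # ?R) = 0" by simp
    moreover have "mset (unit_form k # ?R) = mset (interp_forms \<delta> n \<gamma> @ map unit_form (k # ks) @ Rs)" by simp
    ultimately show ?case using contract_mset[OF sym] by metis
  qed
  moreover have "interp_forms \<delta> n (\<lambda>_. 0) = []" by (simp add: interp_forms_def concat_eq_Nil_conv)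
  ultimately show ?thesis using ks by (metis (no_types, lifting) append_Nil add_0 lattice_zero)
qed

text \<open>Induction on the distance of \<open>\<alpha>\<close> and \<open>\<beta>\<close>: if \<open>\<beta> k > \<alpha> k\<close> and \<open>\<beta> l < \<alpha> l\<close>, moving a unit of \<open>\<beta>\<close> from \<open>k\<close> to \<open>l\<close> gives
  a point \<open>\<beta>'\<close> nearer to \<open>\<alpha>\<close>, and \<open>p_\<beta> (x\<^sub>l - \<beta> l h) = p_\<beta>' (x\<^sub>k - (\<beta> k - 1) h)\<close>.\<close>
lemma tensor_zero:
  assumes sym: "sym_tensor \<psi>" and \<delta>: "\<delta> \<ge> 1"
    and diag: "\<And>\<alpha> k. \<alpha> \<in> lattice \<delta> n \<Longrightarrow> k \<le> n \<Longrightarrow>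
      contract n \<psi> (interp_forms \<delta> n \<alpha> @ interp_forms \<delta> n \<alpha> @ [unit_form k]) = 0"
    and span: "\<And>\<alpha> \<beta>. \<alpha> \<in> lattice \<delta> n \<Longrightarrow> \<beta> \<in> lattice \<delta> n \<Longrightarrow> \<alpha> \<noteq> \<beta> \<Longrightarrow>
      \<exists>a b. \<forall>k\<le>n. contract n \<psi> (interp_forms \<delta> n \<alpha> @ interp_forms \<delta> n \<beta> @ [unit_form k]) = a * pt \<alpha> k + b * pt \<beta> k"
    and xs: "xs \<in> tidx (2 * \<delta> + 1) n"
  shows "\<psi> xs = 0"
proof -
  let ?p = "interp_forms \<delta> n"
  define Q where "Q = (\<lambda>\<alpha> \<beta> k. contract n \<psi> (?p \<alpha> @ ?p \<beta> @ [unit_form k]))"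
  have X: "contract n \<psi> (?p \<alpha> @ ?p \<beta> @ [L]) = (\<Sum>k\<le>n. L k * Q \<alpha> \<beta> k)" for \<alpha> \<beta> L
    using contract_last[of n \<psi> "?p \<alpha> @ ?p \<beta>" L] by (simp add: Q_def)
  have Q_comm: "Q \<alpha> \<beta> k = Q \<beta> \<alpha> k" for \<alpha> \<beta> k
    unfolding Q_def by (rule contract_mset[OF sym]) simp
  \<comment> \<open>This removes the component along \<alpha>. By symmetry the one along \<beta>
    disappears as well, since \<alpha> and \<beta> are independent.\<close>
  have one: "\<exists>b. \<forall>k\<le>n. Q \<alpha> \<beta> k = b * pt \<beta> k" if "\<alpha> \<in> lattice \<delta> n" "\<beta> \<in> lattice \<delta> n" "\<alpha> \<noteq> \<beta>" for \<alpha> \<beta>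
    using that
  proof (induction "\<Sum>k\<le>n. \<beta> k - \<alpha> k" arbitrary: \<beta> rule: less_induct)
    case less
    from span[OF less.prems] obtain a b where ab: "\<And>k. k \<le> n \<Longrightarrow> Q \<alpha> \<beta> k = a * pt \<alpha> k + b * pt \<beta> k"
      unfolding Q_def by blast
    obtain k where k: "k \<le> n" "\<alpha> k < \<beta> k" using lattice_eqI[OF less.prems(2,1)] less.prems(3) by (metis not_le)
    obtain l where l: "l \<le> n" "\<beta> l < \<alpha> l" using lattice_eqI[OF less.prems(1,2)] less.prems(3) by (metis not_le)
    have kl: "k \<noteq> l" using k l by auto
    define K where "K = \<beta>(k := \<beta> k - 1)"
    define \<beta>' where "\<beta>' = K(l := Suc (K l))"
    have K: "\<beta> = K(k := Suc (K k))" "K k = \<beta> k - 1" "K l = \<beta> l" using k kl by (auto simp: K_def)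
    have K2: "K(k := Suc (\<beta> k - 1)) = \<beta>" using k by (simp add: K_def)
    have \<beta>'v: "\<beta>' l = Suc (\<beta> l)" "\<beta>' k = \<beta> k - 1" "\<And>i. i \<noteq> k \<Longrightarrow> i \<noteq> l \<Longrightarrow> \<beta>' i = \<beta> i"
      using kl by (auto simp: \<beta>'_def K_def)
    have split: "(\<Sum>i\<le>n. f i) = f k + (f l + (\<Sum>i\<in>{..n} - {k} - {l}. f i))" for f :: "nat \<Rightarrow> nat"
      using k l kl by (simp add: sum.remove[of "{..n}" k] sum.remove[of "{..n} - {k}" l])
    have "(\<Sum>i\<le>n. \<beta>' i) = (\<Sum>i\<le>n. \<beta> i)"
      unfolding split using k \<beta>'v by (auto intro!: sum.cong)
    then have \<beta>': "\<beta>' \<in> lattice \<delta> n" using less.prems(2) k l \<beta>'v by (auto simp: lattice_def)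
    have dist: "(\<Sum>i\<le>n. \<beta>' i - \<alpha> i) < (\<Sum>i\<le>n. \<beta> i - \<alpha> i)"
    proof -
      have "(\<Sum>i\<in>{..n} - {k} - {l}. \<beta>' i - \<alpha> i) = (\<Sum>i\<in>{..n} - {k} - {l}. \<beta> i - \<alpha> i)"
        using \<beta>'v by (intro sum.cong) auto
      then show ?thesis unfolding split using k l \<beta>'v by auto
    qed
    let ?L = "falling_form \<delta> l (\<beta> l)" and ?M = "falling_form \<delta> k (\<beta> k - 1)"
    have "mset (?p \<beta>) = add_mset ?M (mset (?p K))"
      using mset_interp_Suc[OF k(1), of \<delta> K] K2 unfolding K(2) by simp
    moreover have "mset (?p \<beta>') = add_mset ?L (mset (?p K))"
      using mset_interp_Suc[OF l(1), of \<delta> K] unfolding \<beta>'_def K(3) .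
    ultimately have "mset (?p \<alpha> @ ?p \<beta> @ [?L]) = mset (?p \<alpha> @ ?p \<beta>' @ [?M])"
      by simp
    then have "contract n \<psi> (?p \<alpha> @ ?p \<beta> @ [?L]) = contract n \<psi> (?p \<alpha> @ ?p \<beta>' @ [?M])" by (rule contract_mset[OF sym])
    also have "\<dots> = 0"
    proof (cases "\<alpha> = \<beta>'")
      case True
      then show ?thesis unfolding X using diag[OF less.prems(1)] by (simp add: Q_def)
    next
      case False
      from less.hyps[OF dist less.prems(1) \<beta>' False] obtain c where "\<And>k. k \<le> n \<Longrightarrow> Q \<alpha> \<beta>' k = c * pt \<beta>' k" by blast
      then have "contract n \<psi> (?p \<alpha> @ ?p \<beta>' @ [?M]) = c * lval n ?M (pt \<beta>')"
        unfolding X by (simp add: lval_def sum_distrib_left mult_ac)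
      also have "lval n ?M (pt \<beta>') = 0" using lval_falling_form[OF \<beta>' k(1) \<delta>] \<beta>'v by simp
      finally show ?thesis by simp
    qed
    \<comment> \<open>The form \<open>?L\<close> vanishes at \<beta> and takes the value \<alpha> l
      - \<beta> l at \<alpha>, so it isolates the coefficient \<open>a\<close>.\<close>
    finally have "0 = a * lval n ?L (pt \<alpha>) + b * lval n ?L (pt \<beta>)"
      unfolding X using ab by (simp add: lval_def sum_distrib_left sum.distrib distrib_left mult_ac)
    then have "a * (of_nat (\<alpha> l) - of_nat (\<beta> l)) = 0"
      using lval_falling_form[OF less.prems(1) l(1) \<delta>] lval_falling_form[OF less.prems(2) l(1) \<delta>] by simp
    then have "a = 0" using l by auto
    with ab show ?case by auto
  qed
  have Q0: "Q \<alpha> \<beta> k = 0" if ab: "\<alpha> \<in> lattice \<delta> n" "\<beta> \<in> lattice \<delta> n" "k \<le> n" for \<alpha> \<beta> k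
  proof (cases "\<alpha> = \<beta>")
    case True
    then show ?thesis using diag that by (simp add: Q_def)
  next
    case False
    obtain b where b: "\<And>k. k \<le> n \<Longrightarrow> Q \<alpha> \<beta> k = b * pt \<beta> k" using one[OF ab(1,2) False] by blast
    obtain a where a: "\<And>k. k \<le> n \<Longrightarrow> Q \<beta> \<alpha> k = a * pt \<alpha> k" using one[OF ab(2,1)] False by metis
    have eq: "b * pt \<beta> k = a * pt \<alpha> k" if "k \<le> n" for k using a b Q_comm that by metis
    have b0: "b = 0"
    proof (rule ccontr)
      assume "b \<noteq> 0"
      obtain y z where yz: "y \<le> n" "z \<le> n" "pt \<alpha> y * pt \<beta> z - pt \<alpha> z * pt \<beta> y \<noteq> 0"
        using lattice_independent[OF ab(1,2) False \<delta>] by blast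
      have "b * (pt \<alpha> y * pt \<beta> z - pt \<alpha> z * pt \<beta> y) = pt \<alpha> y * (b * pt \<beta> z) - pt \<alpha> z * (b * pt \<beta> y)"
        by (simp add: algebra_simps)
      also have "\<dots> = 0" using eq yz by simp
      finally show False using yz \<open>b \<noteq> 0\<close> by simp
    qed
    then show ?thesis using b that by simp
  qed
  from xs have len: "length xs = 2 * \<delta> + 1" and set: "set xs \<subseteq> {..n}" by (auto simp: tidx_def)
  \<comment> \<open>The two blocks of length \<delta> are treated in turn by the spanning lemma; the
    last index is the remaining linear factor.\<close>
  define as bs k where "as = take \<delta> xs" and "bs = take \<delta> (drop \<delta> xs)" and "k = xs ! (2 * \<delta>)"
  have drop: "drop \<delta> (drop \<delta> xs) = [k]"
    using len by (intro nth_equalityI) (auto simp: k_def mult_2)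
  have xs_eq: "xs = as @ bs @ [k]" unfolding as_def bs_def drop[symmetric] by (simp only: append_take_drop_id)
  have l: "length as = \<delta>" "length bs = \<delta>" using len by (auto simp: as_def bs_def)
  have s: "set as \<subseteq> {..n}" "set bs \<subseteq> {..n}" "k \<le> n" using set by (auto simp: xs_eq)
  have step1: "contract n \<psi> (interp_forms \<delta> n \<beta> @ map unit_form as @ [unit_form k]) = 0" if \<beta>: "\<beta> \<in> lattice \<delta> n" for \<beta>
  proof -
    have "contract n \<psi> (map unit_form as @ interp_forms \<delta> n \<beta> @ [unit_form k]) = 0"
      using Q0[OF _ \<beta> s(3)] by (intro interp_forms_spans[OF sym \<delta> _ s(1) l(1)]) (auto simp: Q_def)
    also have "contract n \<psi> (map unit_form as @ interp_forms \<delta> n \<beta> @ [unit_form k])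
        = contract n \<psi> (interp_forms \<delta> n \<beta> @ map unit_form as @ [unit_form k])" by (rule contract_mset[OF sym]) simp
    finally show ?thesis .
  qed
  have "contract n \<psi> (map unit_form bs @ map unit_form as @ [unit_form k]) = 0"
    by (rule interp_forms_spans[OF sym \<delta> step1 s(2) l(2)])
  also have "map unit_form bs @ map unit_form as @ [unit_form k] = map unit_form (bs @ as @ [k])" by simp
  also have "contract n \<psi> \<dots> = \<psi> (bs @ as @ [k])" using s by (intro contract_units) auto
  also have "\<psi> (bs @ as @ [k]) = \<psi> xs"
  proof -
    have "mset (bs @ as @ [k]) = mset xs" by (simp add: xs_eq)
    then show ?thesis using sym unfolding sym_tensor_def by blast
  qed
  finally show ?thesis by simp
qed

text \<open>Only diagonal values at points of \<open>Z\<close> can be nonzero. Tangent vectors at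
  these points are chosen to reproduce them, and the difference satisfies the hypotheses of
  \<open>tensor_zero\<close>.\<close>

lemma tensor_tangent:
  assumes sym: "sym_tensor \<psi>" and \<delta>: "\<delta> \<ge> 1" and Z: "Z \<subseteq> lattice \<delta> n" "finite Z"
    and diag: "\<And>\<alpha> k. \<alpha> \<in> lattice \<delta> n - Z \<Longrightarrow> k \<le> n \<Longrightarrow>
      contract n \<psi> (interp_forms \<delta> n \<alpha> @ interp_forms \<delta> n \<alpha> @ [unit_form k]) = 0"
    and span: "\<And>\<alpha> \<beta>. \<alpha> \<in> lattice \<delta> n \<Longrightarrow> \<beta> \<in> lattice \<delta> n \<Longrightarrow> \<alpha> \<noteq> \<beta> \<Longrightarrow>
      \<exists>a b. \<forall>k\<le>n. contract n \<psi> (interp_forms \<delta> n \<alpha> @ interp_forms \<delta> n \<beta> @ [unit_form k]) = a * pt \<alpha> k + b * pt \<beta> k"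
  shows "\<exists>v. \<forall>xs\<in>tidx (2 * \<delta> + 1) n. \<psi> xs = (\<Sum>\<gamma>\<in>Z. power_tangent (pt \<gamma>) (v \<gamma>) xs)"
proof -
  let ?p = "interp_forms \<delta> n"
  define c where "c = (\<lambda>\<alpha> \<gamma>. prod_list (map (\<lambda>L. lval n L (pt \<gamma>)) (?p \<alpha>)))"
  have c0: "c \<alpha> \<gamma> = 0" if "\<alpha> \<in> lattice \<delta> n" "\<gamma> \<in> lattice \<delta> n" "\<alpha> \<noteq> \<gamma>" for \<alpha> \<gamma>
    unfolding c_def by (rule interp_forms_val_0[OF that \<delta>])
  have cnz: "c \<alpha> \<alpha> \<noteq> 0" if "\<alpha> \<in> lattice \<delta> n" for \<alpha> unfolding c_def by (rule interp_forms_val_nz[OF that \<delta>])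
  define Q where "Q = (\<lambda>\<alpha> k. contract n \<psi> (?p \<alpha> @ ?p \<alpha> @ [unit_form k]))"
  define D where "D = (\<lambda>\<gamma> v \<alpha>. prod_deriv n (pt \<gamma>) v (?p \<alpha>))"
  have unit: "lval n (unit_form k) v = v k" if "k \<le> n" for k v
    using that by (simp add: lval_def unit_form_def of_bool_def if_distrib[of "\<lambda>x. x * _"] cong: if_cong)
  have tan: "contract n (power_tangent (pt \<gamma>) v) (?p \<alpha> @ ?p \<beta> @ [unit_form k]) =
      D \<gamma> v \<alpha> * c \<beta> \<gamma> * pt \<gamma> k + c \<alpha> \<gamma> * D \<gamma> v \<beta> * pt \<gamma> k + c \<alpha> \<gamma> * c \<beta> \<gamma> * v k" if "k \<le> n" for \<gamma> v \<alpha> \<beta> k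
    using unit[OF that] by (simp add: contract_power_tangent prod_deriv_append c_def D_def algebra_simps)
  \<comment> \<open>The equation to solve is 2 c D(v) \<gamma> + c^2 v = Q with c =
    \<open>c \<gamma> \<gamma>\<close>. Applying D, where Euler's relation gives D(\<gamma>) =
    \<delta> c, yields c^2 (1 + 2 \<delta>) D(v) = D(Q); \<open>lam\<close> is the resulting value
    of 2 c D(v).\<close>
  define lam where "lam = (\<lambda>\<gamma>. 2 * D \<gamma> (Q \<gamma>) \<gamma> / (c \<gamma> \<gamma> * (1 + 2 * of_nat \<delta>)))"
  define v where "v = (\<lambda>\<gamma> k. 1 / (c \<gamma> \<gamma>)\<^sup>2 * Q \<gamma> k + (- lam \<gamma> / (c \<gamma> \<gamma>)\<^sup>2) * pt \<gamma> k)"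
  have solve: "2 * c \<gamma> \<gamma> * D \<gamma> (v \<gamma>) \<gamma> * pt \<gamma> k + (c \<gamma> \<gamma>)\<^sup>2 * v \<gamma> k = Q \<gamma> k" if \<gamma>: "\<gamma> \<in> lattice \<delta> n" for \<gamma> k
  proof -
    have E: "D \<gamma> (pt \<gamma>) \<gamma> = of_nat \<delta> * c \<gamma> \<gamma>"
    proof -
      have "length (?p \<gamma>) = \<delta>" using \<gamma> by (simp add: length_interp_forms lattice_def)
      then show ?thesis by (simp add: D_def prod_deriv_Euler c_def)
    qed
    have Dv: "D \<gamma> (v \<gamma>) \<gamma> = (D \<gamma> (Q \<gamma>) \<gamma> - lam \<gamma> * of_nat \<delta> * c \<gamma> \<gamma>) / (c \<gamma> \<gamma>)\<^sup>2"
      using E unfolding v_def D_def prod_deriv_lincomb by (simp add: diff_divide_distrib mult_ac)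
    have d: "(1 + 2 * of_nat \<delta> :: complex) \<noteq> 0"
      by (metis of_nat_Suc of_nat_mult of_nat_numeral of_nat_neq_0)
    have "lam \<gamma> * (c \<gamma> \<gamma> * (1 + 2 * of_nat \<delta>)) = 2 * D \<gamma> (Q \<gamma>) \<gamma>"
      using d cnz[OF \<gamma>] by (simp add: lam_def)
    then have "2 * (D \<gamma> (Q \<gamma>) \<gamma> - lam \<gamma> * of_nat \<delta> * c \<gamma> \<gamma>) = lam \<gamma> * c \<gamma> \<gamma>" by (simp add: algebra_simps)
    moreover have "2 * c \<gamma> \<gamma> * D \<gamma> (v \<gamma>) \<gamma> = 2 * (D \<gamma> (Q \<gamma>) \<gamma> - lam \<gamma> * of_nat \<delta> * c \<gamma> \<gamma>) / c \<gamma> \<gamma>"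
      unfolding Dv by (simp add: power2_eq_square)
    ultimately have "2 * c \<gamma> \<gamma> * D \<gamma> (v \<gamma>) \<gamma> = lam \<gamma>" using cnz[OF \<gamma>] by simp
    then show ?thesis using cnz[OF \<gamma>] by (simp add: v_def field_simps)
  qed
  define \<psi>' where "\<psi>' = (\<lambda>xs. \<psi> xs - (\<Sum>\<gamma>\<in>Z. power_tangent (pt \<gamma>) (v \<gamma>) xs))"
  have sym': "sym_tensor \<psi>'"
    using sym sym_tensor_power_tangent unfolding sym_tensor_def \<psi>'_def by (metis (mono_tags, lifting) sum.cong)
  have contract': "contract n \<psi>' Ls = contract n \<psi> Ls - (\<Sum>\<gamma>\<in>Z. contract n (power_tangent (pt \<gamma>) (v \<gamma>)) Ls)" for Ls
    by (simp add: \<psi>'_def contract_diff contract_sum)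
  have "\<psi>' xs = 0" if "xs \<in> tidx (2 * \<delta> + 1) n" for xs
  proof (rule tensor_zero[OF sym' \<delta> _ _ that])
    fix \<alpha> k assume \<alpha>: "\<alpha> \<in> lattice \<delta> n" and k: "k \<le> n"
    have "(\<Sum>\<gamma>\<in>Z. contract n (power_tangent (pt \<gamma>) (v \<gamma>)) (?p \<alpha> @ ?p \<alpha> @ [unit_form k])) = (\<Sum>\<gamma>\<in>Z. if \<gamma> = \<alpha> then Q \<alpha> k else 0)"
    proof (rule sum.cong[OF refl])
      fix \<gamma> assume "\<gamma> \<in> Z"
      then have \<gamma>: "\<gamma> \<in> lattice \<delta> n" using Z by auto
      show "contract n (power_tangent (pt \<gamma>) (v \<gamma>)) (?p \<alpha> @ ?p \<alpha> @ [unit_form k]) = (if \<gamma> = \<alpha> then Q \<alpha> k else 0)"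
        unfolding tan[OF k] using c0[OF \<alpha> \<gamma>] solve[OF \<alpha>, of k] by (auto simp: algebra_simps power2_eq_square)
    qed
    also have "\<dots> = Q \<alpha> k" using Z diag[of \<alpha> k] \<alpha> k by (auto simp: Q_def)
    finally show "contract n \<psi>' (?p \<alpha> @ ?p \<alpha> @ [unit_form k]) = 0" unfolding contract' by (simp add: Q_def)
  next
    fix \<alpha> \<beta> assume ab: "\<alpha> \<in> lattice \<delta> n" "\<beta> \<in> lattice \<delta> n" "\<alpha> \<noteq> \<beta>"
    have "\<exists>a b. \<forall>k\<le>n. contract n (power_tangent (pt \<gamma>) (v \<gamma>)) (?p \<alpha> @ ?p \<beta> @ [unit_form k]) = a * pt \<alpha> k + b * pt \<beta> k"
      if "\<gamma> \<in> Z" for \<gamma>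
    proof -
      have \<gamma>: "\<gamma> \<in> lattice \<delta> n" using that Z by auto
      consider "\<gamma> = \<alpha>" "c \<beta> \<gamma> = 0" | "\<gamma> = \<beta>" "c \<alpha> \<gamma> = 0" | "c \<alpha> \<gamma> = 0" "c \<beta> \<gamma> = 0"
        using c0 ab \<gamma> by metis
      then show ?thesis
      proof cases
        case 1
        then show ?thesis by (intro exI[of _ "c \<alpha> \<gamma> * D \<gamma> (v \<gamma>) \<beta>"] exI[of _ 0]) (simp add: tan)
      next
        case 2
        then show ?thesis by (intro exI[of _ 0] exI[of _ "D \<gamma> (v \<gamma>) \<alpha> * c \<beta> \<gamma>"]) (simp add: tan)
      next
        case 3
        then show ?thesis by (intro exI[of _ 0]) (simp add: tan)
      qed
    qed
    then obtain A B where AB: "\<And>\<gamma> k. \<gamma> \<in> Z \<Longrightarrow> k \<le> n \<Longrightarrow>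
        contract n (power_tangent (pt \<gamma>) (v \<gamma>)) (?p \<alpha> @ ?p \<beta> @ [unit_form k]) = A \<gamma> * pt \<alpha> k + B \<gamma> * pt \<beta> k" by metis
    obtain a b where "\<And>k. k \<le> n \<Longrightarrow> contract n \<psi> (?p \<alpha> @ ?p \<beta> @ [unit_form k]) = a * pt \<alpha> k + b * pt \<beta> k"
      using span[OF ab] by blast
    then show "\<exists>a b. \<forall>k\<le>n. contract n \<psi>' (?p \<alpha> @ ?p \<beta> @ [unit_form k]) = a * pt \<alpha> k + b * pt \<beta> k"
      using AB by (intro exI[of _ "a - sum A Z"] exI[of _ "b - sum B Z"])
        (simp add: contract' sum.distrib left_diff_distrib flip: sum_distrib_right)
  qed
  then show ?thesis by (intro exI[of _ v]) (simp add: \<psi>'_def)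
qed

text \<open>Ensures that r distinct points can be selected under the hypothesis on r.\<close>

lemma card_lattice_ge: "finite (lattice d n) \<and> (d + n) choose n \<le> card (lattice d n)"
proof
  have "\<alpha> k \<le> d" if "\<alpha> \<in> lattice d n" for \<alpha> k
    using that member_le_sum[of k "{..n}" \<alpha>] by (cases "k \<le> n") (auto simp: lattice_def)
  then have "lattice d n \<subseteq> {\<alpha>. (\<forall>k. k \<notin> {..n} \<longrightarrow> \<alpha> k = 0) \<and> (\<forall>k. \<alpha> k \<in> {..d})}"
    by (auto simp: lattice_def)
  moreover have "finite {\<alpha>. (\<forall>k. k \<notin> {..n} \<longrightarrow> \<alpha> k = (0 :: nat)) \<and> (\<forall>k. \<alpha> k \<in> {..d})}"
    using finite_set_of_finite_funs[of "{..n}" "{..d}" 0] by (rule rev_finite_subset) auto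
  ultimately show fin: "finite (lattice d n)" by (rule finite_subset)
  let ?A = "{l :: nat list. length l = Suc n \<and> sum_list l = d}"
  let ?f = "\<lambda>l :: nat list. \<lambda>k. if k \<le> n then l ! k else 0"
  have "card ?A = (d + n) choose d" using card_length_sum_list[of "Suc n" d] by simp
  also have "\<dots> = (d + n) choose n" using binomial_symmetric[of d "d + n"] by simp
  finally have "card ?A = (d + n) choose n" .
  moreover have "inj_on ?f ?A"
  proof (rule inj_onI)
    fix l l' assume *: "l \<in> ?A" "l' \<in> ?A" and eq: "?f l = ?f l'"
    have "l ! i = l' ! i" if "i \<le> n" for i using fun_cong[OF eq, of i] that by simp
    with * show "l = l'" by (intro nth_equalityI) auto
  qed
  moreover have "?f ` ?A \<subseteq> lattice d n"
    by (auto simp: lattice_def sum_list_sum_nth atLeast0LessThan lessThan_Suc_atMost)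
  ultimately show "(d + n) choose n \<le> card (lattice d n)" using card_inj_on_le[of ?f ?A "lattice d n"] fin by simp
qed

section \<open>The bilinear form of a Young flattening\<close>

definition lin_form :: "'a set \<Rightarrow> (('a \<Rightarrow> complex) \<Rightarrow> complex) \<Rightarrow> bool" where
  "lin_form I F \<longleftrightarrow> (\<exists>c. \<forall>\<psi>. F \<psi> = (\<Sum>i\<in>I. c i * \<psi> i))"

lemma lin_form_eval:
  assumes "finite I" "i \<in> I"
  shows "lin_form I (\<lambda>\<psi>. \<psi> i)"
  unfolding lin_form_def using assms
  by (intro exI[of _ "\<lambda>j. if j = i then 1 else 0"]) (simp add: if_distrib[of "\<lambda>x. x * _"] cong: if_cong)

lemma lin_form_0: "lin_form I (\<lambda>\<psi>. 0)"
  unfolding lin_form_def by (intro exI[of _ "\<lambda>_. 0"]) simp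

lemma lin_form_add: "lin_form I F \<Longrightarrow> lin_form I G \<Longrightarrow> lin_form I (\<lambda>\<psi>. F \<psi> + G \<psi>)"
proof -
  assume "lin_form I F" "lin_form I G"
  then obtain c d where "\<And>\<psi>. F \<psi> = (\<Sum>i\<in>I. c i * \<psi> i)" "\<And>\<psi>. G \<psi> = (\<Sum>i\<in>I. d i * \<psi> i)"
    by (auto simp: lin_form_def)
  then show ?thesis unfolding lin_form_def
    by (intro exI[of _ "\<lambda>i. c i + d i"]) (simp add: distrib_right sum.distrib)
qed

lemma lin_form_cmult: "lin_form I F \<Longrightarrow> lin_form I (\<lambda>\<psi>. c * F \<psi>)"
proof -
  assume "lin_form I F"
  then obtain d where "\<And>\<psi>. F \<psi> = (\<Sum>i\<in>I. d i * \<psi> i)" by (auto simp: lin_form_def)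
  then show ?thesis unfolding lin_form_def
    by (intro exI[of _ "\<lambda>i. c * d i"]) (simp add: sum_distrib_left mult.assoc)
qed

lemma lin_form_sum:
  assumes "\<And>x. x \<in> S \<Longrightarrow> lin_form I (F x)"
  shows "lin_form I (\<lambda>\<psi>. \<Sum>x\<in>S. F x \<psi>)"
  using assms by (induction S rule: infinite_finite_induct) (auto intro: lin_form_0 lin_form_add)

lemma lin_form_polyfun: "lin_form I F \<Longrightarrow> F \<in> polyfun I"
proof -
  assume "lin_form I F"
  then obtain d where d: "\<And>\<psi>. F \<psi> = (\<Sum>i\<in>I. d i * \<psi> i)" by (auto simp: lin_form_def)
  have "(\<lambda>\<psi>. \<Sum>i\<in>I. d i * \<psi> i) \<in> polyfun I" by (intro polyfun_sum pmult pconst pvar)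
  moreover have "F = (\<lambda>\<psi>. \<Sum>i\<in>I. d i * \<psi> i)" using d by (rule ext)
  ultimately show ?thesis by simp
qed

lemma polyfun_det:
  assumes "\<And>i j. i < m \<Longrightarrow> j < m \<Longrightarrow> E i j \<in> polyfun I"
  shows "(\<lambda>x. det (mat m m (\<lambda>(i, j). E i j x))) \<in> polyfun I"
proof -
  have "(\<lambda>x. \<Sum>p | p permutes {0..<m}. signof p * (\<Prod>i = 0..<m. E i (p i) x)) \<in> polyfun I"
    using assms by (intro polyfun_sum pmult pconst polyfun_prod) (auto dest: permutes_in_image)
  also have "(\<lambda>x. \<Sum>p | p permutes {0..<m}. signof p * (\<Prod>i = 0..<m. E i (p i) x))
     = (\<lambda>x. det (mat m m (\<lambda>(i, j). E i j x)))"
    by (intro ext, subst det_def'[of _ m]) (auto intro!: sum.cong prod.cong)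
  finally show ?thesis .
qed

text \<open>In the Leibniz expansion every permutation but the identity picks at least two off-diagonal entries.\<close>
lemma diagonal_minor_mpow:
  assumes I: "finite I"
    and E: "\<And>i j. i \<le> m \<Longrightarrow> j \<le> m \<Longrightarrow> E i j \<in> polyfun I"
    and off: "\<And>i j. i \<le> m \<Longrightarrow> j \<le> m \<Longrightarrow> i \<noteq> j \<Longrightarrow> E i j z = 0"
    and diag: "\<And>i. i < m \<Longrightarrow> E i i z \<noteq> 0" and corner: "E m m z = 0"
    and det: "\<And>x. x \<in> X \<Longrightarrow> det (mat (m + 1) (m + 1) (\<lambda>(i, j). E i j x)) = 0"
  shows "\<exists>g \<in> mpow I z 2. \<forall>x\<in>X. E m m x = g x"
proof -
  let ?P = "{p. p permutes {0..<m + 1}}"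
  define D where "D = (\<lambda>x. \<Prod>i<m. E i i x)"
  have Dz: "D z \<noteq> 0" using diag by (simp add: D_def)
  have van1: "E i j \<in> mpow I z 1" if "i \<le> m" "j \<le> m" "E i j z = 0" for i j
    using polyfun_minus_value_mpow[OF I E[OF that(1,2)], of z] that(3) by simp
  have term_mpow: "(\<lambda>x. signof p * (\<Prod>i = 0..<m + 1. E i (p i) x)) \<in> mpow I z 2" if p: "p \<in> ?P - {id}" for p
  proof -
    have pp: "p permutes {0..<m + 1}" using p by simp
    obtain i where i: "p i \<noteq> i" using p by (auto simp: fun_eq_iff)
    then have im: "i < m + 1" using permutes_not_in[OF pp, of i] by auto
    have pi: "p i < m + 1" "p (p i) < m + 1" using permutes_in_image[OF pp] im by auto
    have ppi: "p (p i) \<noteq> p i" using i permutes_inj[OF pp] by (auto dest: injD)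
    let ?S = "{0..<m + 1} - {i} - {p i}"
    have le: "p j \<le> m" if "j \<le> m" for j using permutes_in_image[OF pp, of j] that by simp
    have "(\<lambda>x. E i (p i) x * E (p i) (p (p i)) x) \<in> mpow I z (1 + 1)"
      using i ppi im pi off by (intro mpow_mult van1) auto
    moreover have "(\<lambda>x. signof p * (\<Prod>j\<in>?S. E j (p j) x)) \<in> polyfun I"
      using le by (intro pmult pconst polyfun_prod E) auto
    ultimately have "(\<lambda>x. (signof p * (\<Prod>j\<in>?S. E j (p j) x)) * (E i (p i) x * E (p i) (p (p i)) x)) \<in> mpow I z 2"
      unfolding one_add_one by (rule mpow_mult_polyfun[rotated])
    moreover have "(\<Prod>j = 0..<m + 1. E j (p j) x) = E i (p i) x * (E (p i) (p (p i)) x * (\<Prod>j\<in>?S. E j (p j) x))" for x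
      using im pi i by (subst prod.remove[of "{0..<m + 1}" i], simp, simp,
          subst prod.remove[of "{0..<m + 1} - {i}" "p i"]) (simp_all del: prod.op_ivl_Suc)
    ultimately show ?thesis by (simp add: mult_ac del: prod.op_ivl_Suc)
  qed
  define W where "W = (\<lambda>x. \<Sum>p\<in>?P - {id}. signof p * (\<Prod>i = 0..<m + 1. E i (p i) x))"
  have W: "W \<in> mpow I z 2" unfolding W_def by (intro mpow_sum term_mpow)
  have split: "E m m x * D x + W x = 0" if "x \<in> X" for x
  proof -
    have "0 = (\<Sum>p\<in>?P. signof p * (\<Prod>i = 0..<m + 1. E i (p i) x))"
      using det[OF that] by (subst (asm) det_def'[of _ "m + 1"]) (auto intro!: sum.cong prod.cong simp del: prod.op_ivl_Suc)
    also have "\<dots> = signof id * (\<Prod>i = 0..<m + 1. E i (id i) x) + W x"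
      unfolding W_def by (subst sum.remove[of _ id]) (auto simp: finite_permutations permutes_id[unfolded id_def[symmetric]] simp del: prod.op_ivl_Suc)
    finally show ?thesis by (simp add: D_def atLeast0LessThan mult.commute)
  qed
  have Dp: "D \<in> polyfun I" unfolding D_def using E by (intro polyfun_prod) auto
  \<comment> \<open>The diagonal product \<open>D\<close> is exchanged for its nonzero value at
    \<open>z\<close>; the error is a product of two functions vanishing there.\<close>
  have "(\<lambda>x. E m m x * (D x - D z)) \<in> mpow I z (1 + 1)"
    using van1[of m m] corner polyfun_minus_value_mpow[OF I Dp, of z] by (intro mpow_mult) auto
  then have "(\<lambda>x. - 1 / D z * (W x + E m m x * (D x - D z))) \<in> mpow I z 2"
    unfolding one_add_one using W by (intro mpow_cmult mpow_add)
  moreover have "E m m x = - 1 / D z * (W x + E m m x * (D x - D z))" if "x \<in> X" for x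
    using split[OF that] Dz by (simp add: field_simps)
  ultimately show ?thesis by (intro bexI[of _ "\<lambda>x. - 1 / D z * (W x + E m m x * (D x - D z))"] ballI)
qed

text \<open>The case of \<open>minors_vanish_combination\<close> with coordinate vectors as columns;
  it serves to pass between the flattening and the pairing.\<close>

lemma minors_vanish_row_combinations:
  assumes fin: "finite R" "finite C" and van: "minors_vanish m R C M"
    and comb: "\<And>x. x \<in> R' \<Longrightarrow> \<exists>q. \<forall>y\<in>C. M' x y = (\<Sum>x'\<in>R. q x' * M x' y)"
  shows "minors_vanish m R' C M'"
  unfolding minors_vanish_def
proof (intro allI impI, elim conjE)
  fix rs cs assume len: "length rs = m" "length cs = m" and sub: "set rs \<subseteq> R'" "set cs \<subseteq> C"
  from comb obtain q where q: "\<And>x y. x \<in> R' \<Longrightarrow> y \<in> C \<Longrightarrow> M' x y = (\<Sum>x'\<in>R. q x x' * M x' y)" by metis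
  have "mat m m (\<lambda>(i, j). M' (rs ! i) (cs ! j))
      = mat m m (\<lambda>(i, j). \<Sum>x\<in>R. \<Sum>y\<in>C. q (rs ! i) x * M x y * (if y = cs ! j then 1 else 0))"
  proof (rule cong_mat)
    fix i j assume "i < m" "j < m"
    then have "rs ! i \<in> R'" "cs ! j \<in> C" using len sub nth_mem by auto
    then show "(case (i, j) of (i, j) \<Rightarrow> M' (rs ! i) (cs ! j)) = (case (i, j) of (i, j) \<Rightarrow>
        \<Sum>x\<in>R. \<Sum>y\<in>C. q (rs ! i) x * M x y * (if y = cs ! j then 1 else 0))"
      using q fin(2) by (simp add: if_distrib[of "\<lambda>x. _ * x"] cong: if_cong)
  qed auto
  then show "det (mat m m (\<lambda>(i, j). M' (rs ! i) (cs ! j))) = 0"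
    using minors_vanish_combination[OF fin van] by simp
qed

lemma finite_tidx: "finite (tidx d n)"
proof -
  have "tidx d n = {xs. set xs \<subseteq> {..n} \<and> length xs = d}" by (auto simp: tidx_def)
  then show ?thesis by (simp add: finite_lists_length_eq)
qed

lemma slists_subset_tidx: "slists k n \<subseteq> tidx k n"
  by (auto simp: slists_def tidx_def)

lemma finite_slists: "finite (slists k n)"
  using finite_subset[OF slists_subset_tidx finite_tidx] .

lemma finite_YF_rows: "finite (YF_rows \<delta> n a)"
  by (simp add: YF_rows_def finite_slists finite_wsets)

lemma finite_YF_cols: "finite (YF_cols \<delta> n a)"
  by (simp add: YF_cols_def finite_slists finite_wsets)

lemma index_in_tidx:
  "I \<in> slists \<delta> n \<Longrightarrow> J \<in> slists \<delta> n \<Longrightarrow> k \<le> n \<Longrightarrow> I @ J @ [k] \<in> tidx (2 * \<delta> + 1) n"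
  by (auto simp: slists_def tidx_def)

lemma YF_mat_lin_form:
  assumes "x \<in> YF_rows \<delta> n a" "y \<in> YF_cols \<delta> n a"
  shows "lin_form (tidx (2 * \<delta> + 1) n) (\<lambda>\<Phi>. YF_mat n \<Phi> x y)"
proof -
  obtain I T J S where xy: "x = (I, T)" "y = (J, S)" by (cases x, cases y)
  have "lin_form (tidx (2 * \<delta> + 1) n) (\<lambda>\<Phi>. \<Sum>k\<le>n. wcoef (k # sorted_list_of_set S) T * \<Phi> (I @ J @ [k]))"
    using assms xy index_in_tidx[of I \<delta> n J]
    by (intro lin_form_sum lin_form_cmult lin_form_eval finite_tidx) (auto simp: YF_rows_def YF_cols_def)
  then show ?thesis by (simp add: YF_mat_def xy mult.commute)
qed

text \<open>The coefficient of the sorted monomial \<open>J\<close> in the product of the linear forms \<open>Ls\<close>.\<close>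
definition pcoef :: "nat \<Rightarrow> (nat \<Rightarrow> complex) list \<Rightarrow> nat list \<Rightarrow> complex" where
  "pcoef n Ls J = contract n (\<lambda>xs. of_bool (sort xs = J)) Ls"

lemma pcoef_sum:
  assumes "length Ls = k" and G: "sym_tensor G"
  shows "(\<Sum>J\<in>slists k n. pcoef n Ls J * G J) = contract n G Ls"
proof -
  have "(\<Sum>J\<in>slists k n. pcoef n Ls J * G J) = contract n (\<lambda>xs. \<Sum>J\<in>slists k n. G J * of_bool (sort xs = J)) Ls"
    unfolding pcoef_def contract_sum contract_cmult by (simp add: mult.commute)
  also have "\<dots> = contract n G Ls"
  proof (rule contract_cong)
    fix xs assume "xs \<in> tidx (length Ls) n"
    then have "sort xs \<in> slists k n" using assms(1) by (auto simp: slists_def tidx_def)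
    then have "(\<Sum>J\<in>slists k n. G J * of_bool (sort xs = J)) = G (sort xs)"
      using finite_slists by (simp add: of_bool_def if_distrib[of "\<lambda>x. _ * x"] cong: if_cong)
    also have "\<dots> = G xs"
    proof -
      have "mset (sort xs) = mset xs" by simp
      then show ?thesis using G unfolding sym_tensor_def by blast
    qed
    finally show "(\<Sum>J\<in>slists k n. G J * of_bool (sort xs = J)) = G xs" .
  qed
  finally show ?thesis .
qed

text \<open>The linear form sending x to \<theta>(x \<and> \<eta>), given by its
  coefficients.\<close>

definition wform :: "nat \<Rightarrow> nat \<Rightarrow> (nat set \<Rightarrow> complex) \<Rightarrow> (nat set \<Rightarrow> complex) \<Rightarrow> nat \<Rightarrow> complex" where
  "wform n a \<theta> \<eta> k = (\<Sum>T\<in>wsets (a + 1) n. \<Sum>S\<in>wsets a n. \<theta> T * \<eta> S * wcoef (k # sorted_list_of_set S) T)"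

definition YF_form :: "nat \<Rightarrow> nat \<Rightarrow> nat \<Rightarrow> (nat list \<times> nat set \<Rightarrow> complex) \<Rightarrow> (nat list \<times> nat set \<Rightarrow> complex)
    \<Rightarrow> (nat list \<Rightarrow> complex) \<Rightarrow> complex" where
  "YF_form \<delta> n a t s \<psi> = (\<Sum>x\<in>YF_rows \<delta> n a. \<Sum>y\<in>YF_cols \<delta> n a. t x * YF_mat n \<psi> x y * s y)"

text \<open>The decomposable vector p \<otimes> \<theta>, with p the product of the linear forms
  \<open>Ls\<close>.\<close>

definition form_vec :: "nat \<Rightarrow> (nat \<Rightarrow> complex) list \<Rightarrow> (nat set \<Rightarrow> complex) \<Rightarrow> nat list \<times> nat set \<Rightarrow> complex" where
  "form_vec n Ls \<theta> = (\<lambda>(I, T). pcoef n Ls I * \<theta> T)"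

lemma YF_form_lin_form: "lin_form (tidx (2 * \<delta> + 1) n) (YF_form \<delta> n a t s)"
proof -
  have "lin_form (tidx (2 * \<delta> + 1) n) (\<lambda>\<psi>. \<Sum>x\<in>YF_rows \<delta> n a. \<Sum>y\<in>YF_cols \<delta> n a. (t x * s y) * YF_mat n \<psi> x y)"
    by (intro lin_form_sum lin_form_cmult YF_mat_lin_form)
  then show ?thesis by (simp add: YF_form_def[abs_def] mult_ac)
qed

text \<open>On decomposable vectors the flattening evaluates \<psi> on a product of forms.
  Conditions on kernel vectors thereby become conditions on contractions.\<close>

lemma YF_form_form_vec:
  assumes \<psi>: "sym_tensor \<psi>" and len: "length Ls = \<delta>" "length Ms = \<delta>"
  shows "YF_form \<delta> n a (form_vec n Ls \<theta>) (form_vec n Ms \<eta>) \<psi> = contract n \<psi> (Ls @ Ms @ [wform n a \<theta> \<eta>])"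
proof -
  have sym1: "sym_tensor (\<lambda>ys. \<psi> (zs @ ys @ us))" for zs us
    using \<psi> unfolding sym_tensor_def by (metis mset_append)
  have sym2: "sym_tensor (\<lambda>xs. contract n (\<lambda>ys. \<psi> (xs @ ys @ [k])) Ms)" for k
    unfolding sym_tensor_def
  proof (intro allI impI)
    fix xs xs' :: "nat list" assume "mset xs = mset xs'"
    then have "\<psi> (xs @ ys @ [k]) = \<psi> (xs' @ ys @ [k])" for ys
      using \<psi> unfolding sym_tensor_def by (metis mset_append)
    then show "contract n (\<lambda>ys. \<psi> (xs @ ys @ [k])) Ms = contract n (\<lambda>ys. \<psi> (xs' @ ys @ [k])) Ms" by simp
  qed
  have inner: "(\<Sum>I\<in>slists \<delta> n. \<Sum>J\<in>slists \<delta> n. pcoef n Ls I * pcoef n Ms J * \<psi> (I @ J @ [k]))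
     = contract n (\<lambda>xs. contract n (\<lambda>ys. \<psi> (xs @ ys @ [k])) Ms) Ls" for k
  proof -
    have "(\<Sum>J\<in>slists \<delta> n. pcoef n Ls I * pcoef n Ms J * \<psi> (I @ J @ [k])) = pcoef n Ls I * contract n (\<lambda>ys. \<psi> (I @ ys @ [k])) Ms" for I
      using pcoef_sum[OF len(2) sym1[of I "[k]"], of n] by (simp add: sum_distrib_left mult.assoc flip: sum_distrib_left)
    then show ?thesis using pcoef_sum[OF len(1) sym2[of k], of n] by simp
  qed
  have "YF_form \<delta> n a (form_vec n Ls \<theta>) (form_vec n Ms \<eta>) \<psi> =
    (\<Sum>I\<in>slists \<delta> n. \<Sum>T\<in>wsets (a + 1) n. \<Sum>J\<in>slists \<delta> n. \<Sum>S\<in>wsets a n. \<Sum>k\<le>n.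
       (pcoef n Ls I * pcoef n Ms J * \<psi> (I @ J @ [k])) * (\<theta> T * \<eta> S * wcoef (k # sorted_list_of_set S) T))"
    unfolding YF_form_def YF_rows_def YF_cols_def YF_mat_def form_vec_def sum.cartesian_product'
    by (simp add: sum_distrib_left sum_distrib_right mult_ac)
  also have "\<dots> = (\<Sum>I\<in>slists \<delta> n. \<Sum>J\<in>slists \<delta> n. \<Sum>T\<in>wsets (a + 1) n. \<Sum>k\<le>n. \<Sum>S\<in>wsets a n.
       (pcoef n Ls I * pcoef n Ms J * \<psi> (I @ J @ [k])) * (\<theta> T * \<eta> S * wcoef (k # sorted_list_of_set S) T))"
    by (intro sum.cong refl, subst sum.swap, intro sum.cong refl, rule sum.swap)
  also have "\<dots> = (\<Sum>I\<in>slists \<delta> n. \<Sum>J\<in>slists \<delta> n. \<Sum>k\<le>n. \<Sum>T\<in>wsets (a + 1) n. \<Sum>S\<in>wsets a n.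
       (pcoef n Ls I * pcoef n Ms J * \<psi> (I @ J @ [k])) * (\<theta> T * \<eta> S * wcoef (k # sorted_list_of_set S) T))"
    by (intro sum.cong refl, rule sum.swap)
  also have "\<dots> = (\<Sum>I\<in>slists \<delta> n. \<Sum>J\<in>slists \<delta> n. \<Sum>k\<le>n.
       (pcoef n Ls I * pcoef n Ms J * \<psi> (I @ J @ [k])) * wform n a \<theta> \<eta> k)"
    by (simp add: wform_def sum_distrib_left)
  also have "\<dots> = (\<Sum>I\<in>slists \<delta> n. \<Sum>k\<le>n. \<Sum>J\<in>slists \<delta> n.
       (pcoef n Ls I * pcoef n Ms J * \<psi> (I @ J @ [k])) * wform n a \<theta> \<eta> k)"
    by (intro sum.cong refl, rule sum.swap)
  also have "\<dots> = (\<Sum>k\<le>n. \<Sum>I\<in>slists \<delta> n. \<Sum>J\<in>slists \<delta> n.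
       (pcoef n Ls I * pcoef n Ms J * \<psi> (I @ J @ [k])) * wform n a \<theta> \<eta> k)"
    by (rule sum.swap)
  also have "\<dots> = (\<Sum>k\<le>n. wform n a \<theta> \<eta> k * contract n (\<lambda>xs. contract n (\<lambda>ys. \<psi> (xs @ ys @ [k])) Ms) Ls)"
    unfolding inner[symmetric] by (simp add: sum_distrib_left mult_ac)
  also have "\<dots> = contract n \<psi> (Ls @ Ms @ [wform n a \<theta> \<eta>])"
    by (simp add: contract_append contract_sum contract_cmult)
  finally show ?thesis .
qed

lemma sym_tensor_sum_powers: "sym_tensor (\<lambda>xs. \<Sum>\<gamma>\<in>Z. powT d n (w \<gamma>) xs)"
  unfolding sym_tensor_def
proof (intro allI impI sum.cong refl)
  fix xs ys :: "nat list" and \<gamma> assume m: "mset xs = mset ys"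
  have "prod_list (map (w \<gamma>) xs) = prod_list (map (w \<gamma>) ys)"
    using m by (metis mset_map prod_mset_prod_list)
  moreover have "xs \<in> tidx d n \<longleftrightarrow> ys \<in> tidx d n"
    using mset_eq_length[OF m] mset_eq_setD[OF m] by (simp add: tidx_def)
  ultimately show "powT d n (w \<gamma>) xs = powT d n (w \<gamma>) ys" by (simp add: powT_def)
qed

lemma contract_sum_powers:
  assumes "length Ls = d"
  shows "contract n (\<lambda>xs. \<Sum>\<gamma>\<in>Z. powT d n (w \<gamma>) xs) Ls = (\<Sum>\<gamma>\<in>Z. prod_list (map (\<lambda>L. lval n L (w \<gamma>)) Ls))"
proof -
  have "contract n (powT d n (w \<gamma>)) Ls = prod_list (map (\<lambda>L. lval n L (w \<gamma>)) Ls)" for \<gamma>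
    unfolding contract_power[symmetric] by (rule contract_cong) (simp add: powT_def assms)
  then show ?thesis by (simp add: contract_sum)
qed

lemma lval_wform:
  "lval n (wform n a \<theta> \<eta>) w = (\<Sum>T\<in>wsets (a + 1) n. \<Sum>S\<in>wsets a n. \<theta> T * \<eta> S * wedge n w S T)"
proof -
  have "lval n (wform n a \<theta> \<eta>) w = (\<Sum>k\<le>n. \<Sum>T\<in>wsets (a + 1) n. \<Sum>S\<in>wsets a n. \<theta> T * \<eta> S * (w k * wcoef (k # sorted_list_of_set S) T))"
    by (simp add: lval_def wform_def sum_distrib_right sum_distrib_left mult_ac)
  also have "\<dots> = (\<Sum>T\<in>wsets (a + 1) n. \<Sum>S\<in>wsets a n. \<Sum>k\<le>n. \<theta> T * \<eta> S * (w k * wcoef (k # sorted_list_of_set S) T))"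
    by (subst sum.swap, intro sum.cong refl, rule sum.swap)
  finally show ?thesis by (simp add: wedge_def sum_distrib_left)
qed

lemma YF_form_sum_powers:
  assumes "length Ls = \<delta>" "length Ms = \<delta>"
  shows "YF_form \<delta> n a (form_vec n Ls \<theta>) (form_vec n Ms \<eta>) (\<lambda>xs. \<Sum>\<gamma>\<in>Z. powT (2 * \<delta> + 1) n (w \<gamma>) xs) =
    (\<Sum>\<gamma>\<in>Z. prod_list (map (\<lambda>L. lval n L (w \<gamma>)) Ls) * prod_list (map (\<lambda>L. lval n L (w \<gamma>)) Ms)
       * (\<Sum>T\<in>wsets (a + 1) n. \<Sum>S\<in>wsets a n. \<theta> T * \<eta> S * wedge n (w \<gamma>) S T))"
  using assms by (subst YF_form_form_vec[OF sym_tensor_sum_powers])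
    (simp_all add: contract_sum_powers lval_wform mult.assoc)

text \<open>\<open>col_wedge\<close> is w \<and> e_A, in the kernel of wedging with w. Dually,
  \<open>row_wedge\<close> sends x to the coefficient of the volume form in x \<and> w \<and> e_B, a
  functional vanishing on the image of wedging with w.\<close>

definition col_wedge :: "nat \<Rightarrow> (nat \<Rightarrow> complex) \<Rightarrow> nat list \<Rightarrow> nat set \<Rightarrow> complex" where
  "col_wedge n w A S = (\<Sum>i\<le>n. w i * wcoef (i # A) S)"

definition row_wedge :: "nat \<Rightarrow> (nat \<Rightarrow> complex) \<Rightarrow> nat list \<Rightarrow> nat set \<Rightarrow> complex" where
  "row_wedge n w B T = (\<Sum>j\<le>n. w j * wcoef (sorted_list_of_set T @ j # B) {..n})"

lemma wcoef_expand_cols: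
  assumes "i \<le> n" "set A \<subseteq> {..n}" "Suc (length A) = a"
  shows "(\<Sum>S\<in>wsets a n. wcoef (i # A) S * wcoef (xs @ sorted_list_of_set S @ ys) U) = wcoef (xs @ i # A @ ys) U"
proof -
  have "set (i # A) \<in> wsets a n" if "distinct (i # A)"
    using distinct_card[OF that] assms by (auto simp: wsets_def)
  from wcoef_expand[OF finite_wsets this, of xs ys U] show ?thesis by simp
qed

lemma wcoef_expand_rows:
  assumes "k \<le> n" "S \<in> wsets a n"
  shows "(\<Sum>T\<in>wsets (a + 1) n. wcoef (k # sorted_list_of_set S) T * wcoef (sorted_list_of_set T @ ys) U)
    = wcoef (k # sorted_list_of_set S @ ys) U"
proof -
  have "finite S" using assms(2) by (rule finite_in_wsets)
  then have "set (k # sorted_list_of_set S) \<in> wsets (a + 1) n" if "distinct (k # sorted_list_of_set S)"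
    using distinct_card[OF that] assms by (auto simp: wsets_def)
  from wcoef_expand[OF finite_wsets this, of "[]" ys U] show ?thesis by simp
qed

lemma wedge_col_wedge:
  assumes "set A \<subseteq> {..n}" "Suc (length A) = a"
  shows "(\<Sum>S\<in>wsets a n. col_wedge n w A S * wedge n w S T) = 0"
proof -
  have "(\<Sum>S\<in>wsets a n. col_wedge n w A S * wedge n w S T)
    = (\<Sum>S\<in>wsets a n. \<Sum>k\<le>n. \<Sum>i\<le>n. w k * w i * (wcoef (i # A) S * wcoef ([k] @ sorted_list_of_set S @ []) T))"
    unfolding mult.commute[of "col_wedge n w A _"] unfolding col_wedge_def wedge_def sum_product by (simp add: mult_ac)
  also have "\<dots> = (\<Sum>k\<le>n. \<Sum>i\<le>n. w k * w i * (\<Sum>S\<in>wsets a n. wcoef (i # A) S * wcoef ([k] @ sorted_list_of_set S @ []) T))"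
    unfolding sum_distrib_left by (subst sum.swap, intro sum.cong refl, rule sum.swap)
  also have "\<dots> = (\<Sum>k\<le>n. \<Sum>i\<le>n. w k * w i * wcoef ([] @ k # [] @ i # A) T)"
    using wcoef_expand_cols[OF _ assms, of _ "[_]" "[]" T] by (intro sum.cong refl) simp
  also have "\<dots> = 0" by (rule wcoef_square_zero)
  finally show ?thesis .
qed

lemma wedge_row_wedge:
  assumes "S \<in> wsets a n"
  shows "(\<Sum>T\<in>wsets (a + 1) n. row_wedge n w B T * wedge n w S T) = 0"
proof -
  have "(\<Sum>T\<in>wsets (a + 1) n. row_wedge n w B T * wedge n w S T)
    = (\<Sum>T\<in>wsets (a + 1) n. \<Sum>k\<le>n. \<Sum>j\<le>n. w k * w j *
        (wcoef (k # sorted_list_of_set S) T * wcoef (sorted_list_of_set T @ j # B) {..n}))"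
    unfolding mult.commute[of "row_wedge n w B _"] unfolding row_wedge_def wedge_def sum_product by (simp add: mult_ac)
  also have "\<dots> = (\<Sum>k\<le>n. \<Sum>j\<le>n. w k * w j * (\<Sum>T\<in>wsets (a + 1) n.
        wcoef (k # sorted_list_of_set S) T * wcoef (sorted_list_of_set T @ j # B) {..n}))"
    unfolding sum_distrib_left by (subst sum.swap, intro sum.cong refl, rule sum.swap)
  also have "\<dots> = (\<Sum>k\<le>n. \<Sum>j\<le>n. w k * w j * wcoef ([] @ k # sorted_list_of_set S @ j # B) {..n})"
    using wcoef_expand_rows[OF _ assms] by (intro sum.cong refl) simp
  also have "\<dots> = 0" by (rule wcoef_square_zero)
  finally show ?thesis .
qed

text \<open>Pairing both kinds of vectors gives the linear form x to x \<and> w \<and> e_A \<and> v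
  \<and> e_B, which vanishes at w and at v.\<close>

lemma wform_theta_col_wedge:
  assumes "set A \<subseteq> {..n}" "Suc (length A) = a" "k \<le> n"
  shows "wform n a (row_wedge n v B) (col_wedge n w A) k = (\<Sum>i\<le>n. \<Sum>j\<le>n. w i * v j * wcoef (k # i # A @ j # B) {..n})"
proof -
  have "wform n a (row_wedge n v B) (col_wedge n w A) k = (\<Sum>S\<in>wsets a n. \<Sum>T\<in>wsets (a + 1) n. \<Sum>j\<le>n. col_wedge n w A S * v j *
      (wcoef (k # sorted_list_of_set S) T * wcoef (sorted_list_of_set T @ j # B) {..n}))"
    unfolding wform_def row_wedge_def by (subst sum.swap) (simp add: sum_distrib_left sum_distrib_right mult_ac)
  also have "\<dots> = (\<Sum>S\<in>wsets a n. \<Sum>j\<le>n. col_wedge n w A S * v j * (\<Sum>T\<in>wsets (a + 1) n.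
      wcoef (k # sorted_list_of_set S) T * wcoef (sorted_list_of_set T @ j # B) {..n}))"
    unfolding sum_distrib_left by (intro sum.cong refl, rule sum.swap)
  also have "\<dots> = (\<Sum>S\<in>wsets a n. \<Sum>j\<le>n. col_wedge n w A S * v j * wcoef (k # sorted_list_of_set S @ j # B) {..n})"
    using wcoef_expand_rows[OF assms(3)] by (intro sum.cong refl) simp
  also have "\<dots> = (\<Sum>S\<in>wsets a n. \<Sum>i\<le>n. \<Sum>j\<le>n. w i * v j *
      (wcoef (i # A) S * wcoef ([k] @ sorted_list_of_set S @ j # B) {..n}))"
    unfolding col_wedge_def by (simp add: sum_distrib_left sum_distrib_right mult_ac) (subst (2) sum.swap, rule refl)
  also have "\<dots> = (\<Sum>i\<le>n. \<Sum>j\<le>n. w i * v j * (\<Sum>S\<in>wsets a n.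
      wcoef (i # A) S * wcoef ([k] @ sorted_list_of_set S @ j # B) {..n}))"
    unfolding sum_distrib_left by (subst sum.swap, intro sum.cong refl, rule sum.swap)
  also have "\<dots> = (\<Sum>i\<le>n. \<Sum>j\<le>n. w i * v j * wcoef (k # i # A @ j # B) {..n})"
    using wcoef_expand_cols[OF _ assms(1,2), of _ "[k]"] by (intro sum.cong refl) simp
  finally show ?thesis .
qed

text \<open>Only the six arrangements of \<open>x\<close>, \<open>y\<close>, \<open>z\<close>
  survive, with their signs: the expansion of the 3 x 3 determinant of \<open>q\<close>,
  \<open>u\<close>, \<open>v\<close> in these coordinates.\<close>

lemma triple_sum:
  fixes q u v :: "nat \<Rightarrow> complex"
  assumes xyz: "x \<le> n" "y \<le> n" "z \<le> n" "distinct [x, y, z]" and W: "set W = {..n} - {x, y, z}"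
  shows "(\<Sum>k\<le>n. \<Sum>i\<le>n. \<Sum>j\<le>n. q k * (u i * v j * wcoef (k # i # j # W) {..n})) =
    wcoef (x # y # z # W) {..n} *
     (q x * (u y * v z - u z * v y) + q y * (u z * v x - u x * v z) + q z * (u x * v y - u y * v x))"
proof -
  define g where "g = (\<lambda>k i j. wcoef (k # i # j # W) {..n})"
  have g0: "g k i j = 0" if "k \<in> set W \<or> i \<in> set W \<or> j \<in> set W \<or> k = i \<or> k = j \<or> i = j" for k i j
    using that by (auto simp: g_def wcoef_def)
  have sw1: "g k i j = - g i k j" for k i j unfolding g_def using wcoef_swap[of "[]" k i "j # W"] by simp
  have sw2: "g k i j = - g k j i" for k i j unfolding g_def using wcoef_swap[of "[k]" i j W] by simp
  have g1: "g y x z = - g x y z" "g x z y = - g x y z" "g y z x = g x y z" "g z x y = g x y z" "g z y x = - g x y z"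
    using sw1[of y x z] sw2[of x z y] sw2[of y z x] sw1[of z x y] sw1[of z y x] by simp_all
  have red: "(\<Sum>k\<le>n. f k) = f x + f y + f z" if "\<And>k. k \<in> set W \<Longrightarrow> f k = 0" for f :: "nat \<Rightarrow> complex"
  proof -
    have "(\<Sum>k\<le>n. f k) = (\<Sum>k\<in>{x, y, z}. f k)"
      using xyz that W by (intro sum.mono_neutral_right) auto
    then show ?thesis using xyz by (simp add: add.assoc)
  qed
  have "(\<Sum>k\<le>n. \<Sum>i\<le>n. \<Sum>j\<le>n. q k * (u i * v j * g k i j)) =
     g x y z * (q x * (u y * v z - u z * v y) + q y * (u z * v x - u x * v z) + q z * (u x * v y - u y * v x))"
    by (simp add: red g0 g1 algebra_simps)
  then show ?thesis by (simp add: g_def)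
qed

lemma wform_unit:
  assumes "T0 \<in> wsets (a + 1) n" "S0 \<in> wsets a n"
  shows "wform n a (\<lambda>T. of_bool (T = T0)) (\<lambda>S. of_bool (S = S0)) k = wcoef (k # sorted_list_of_set S0) T0"
proof -
  have "wform n a (\<lambda>T. of_bool (T = T0)) (\<lambda>S. of_bool (S = S0)) k
    = (\<Sum>T\<in>wsets (a + 1) n. if T = T0 then (\<Sum>S\<in>wsets a n. if S = S0 then wcoef (k # sorted_list_of_set S) T else 0) else 0)"
    unfolding wform_def by (intro sum.cong refl) (auto intro!: sum.cong)
  then show ?thesis using assms finite_wsets by simp
qed

lemma wedge_unit:
  assumes "T0 \<in> wsets (a + 1) n" "S0 \<in> wsets a n"
  shows "(\<Sum>T\<in>wsets (a + 1) n. \<Sum>S\<in>wsets a n. of_bool (T = T0) * of_bool (S = S0) * wedge n w S T) = wedge n w S0 T0"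
  using wform_unit[OF assms] unfolding lval_wform[symmetric] by (simp add: lval_def wedge_def mult.commute)

text \<open>With columns indexed by sets avoiding \<open>m\<close> and rows by the same sets with
  \<open>m\<close> added, wedging with w is diagonal with entries \<open>w m\<close> up to sign.
  This supplies the invertible block of the flattening.\<close>

lemma wedge_avoid:
  assumes "m \<notin> S" "m \<notin> S'" "m \<le> n" "finite S"
  shows "wedge n w S (insert m S') = (if S = S' then w m * wcoef (m # sorted_list_of_set S) (insert m S) else 0)"
proof -
  have z: "wcoef (k # sorted_list_of_set S) (insert m S') = 0" if "k \<noteq> m \<or> S \<noteq> S'" for k
  proof (rule ccontr)
    assume "\<not> ?thesis"
    then have "k \<notin> S" "insert k S = insert m S'" using assms by (auto simp: wcoef_def split: if_splits)
    moreover from this have "k = m" using assms(1) by (metis insertE insertI1)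
    ultimately show False using that assms(1,2) insert_ident[of m S S'] by simp
  qed
  show ?thesis
  proof (cases "S = S'")
    case True
    have "wedge n w S (insert m S') = (\<Sum>k\<le>n. if k = m then w m * wcoef (m # sorted_list_of_set S) (insert m S) else 0)"
      unfolding wedge_def using z True by (intro sum.cong) auto
    then show ?thesis using True assms by simp
  qed (simp add: wedge_def z)
qed

section \<open>The secant variety as a component\<close>

text \<open>The secant cone before closure: the point \<phi> and all paths through it are taken in
  this set.\<close>

definition sums_of_powers :: "nat \<Rightarrow> nat \<Rightarrow> nat \<Rightarrow> (nat list \<Rightarrow> complex) set" where
  "sums_of_powers d n r = {\<Phi>. \<exists>ws :: nat \<Rightarrow> nat \<Rightarrow> complex. \<Phi> = (\<lambda>xs. \<Sum>i<r. powT d n (ws i) xs)}"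

lemma sums_of_powersI:
  assumes "finite Z" "card Z = r"
  shows "(\<lambda>xs. \<Sum>\<gamma>\<in>Z. powT d n (w \<gamma>) xs) \<in> sums_of_powers d n r"
proof -
  obtain g where g: "bij_betw g {..<r} Z"
    using assms ex_bij_betw_nat_finite[of Z] by (auto simp: atLeast0LessThan)
  have "(\<lambda>xs. \<Sum>\<gamma>\<in>Z. powT d n (w \<gamma>) xs) = (\<lambda>xs. \<Sum>i<r. powT d n (w (g i)) xs)"
    using sum.reindex_bij_betw[OF g, of "\<lambda>\<gamma>. powT d n (w \<gamma>) _"] by simp
  then show ?thesis unfolding sums_of_powers_def mem_Collect_eq by (intro exI[of _ "\<lambda>i. w (g i)"])
qed

lemma symT_eq: "\<Phi> \<in> symT d n \<longleftrightarrow> \<Phi> \<in> aff (tidx d n) \<and> sym_tensor \<Phi>"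
  by (simp add: symT_def sym_tensor_def)

lemma sums_of_powers_symT: "sums_of_powers d n r \<subseteq> symT d n"
proof
  fix \<Phi> assume "\<Phi> \<in> sums_of_powers d n r"
  then obtain ws where \<Phi>: "\<Phi> = (\<lambda>xs. \<Sum>i<r. powT d n (ws i) xs)" by (auto simp: sums_of_powers_def)
  show "\<Phi> \<in> symT d n" unfolding symT_eq \<Phi> using sym_tensor_sum_powers
    by (auto simp: aff_def powT_def)
qed

lemma YF_mat_sum_powers:
  assumes "I \<in> slists \<delta> n" "J \<in> slists \<delta> n"
  shows "YF_mat n (\<lambda>xs. \<Sum>i\<in>Z. powT (2 * \<delta> + 1) n (w i) xs) (I, T) (J, S)
    = (\<Sum>i\<in>Z. prod_list (map (w i) I) * prod_list (map (w i) J) * wedge n (w i) S T)"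
proof -
  have "YF_mat n (\<lambda>xs. \<Sum>i\<in>Z. powT (2 * \<delta> + 1) n (w i) xs) (I, T) (J, S)
    = (\<Sum>k\<le>n. \<Sum>i\<in>Z. prod_list (map (w i) I) * prod_list (map (w i) J) * (w i k * wcoef (k # sorted_list_of_set S) T))"
    unfolding YF_mat_def using index_in_tidx[OF assms]
    by (auto simp: powT_def sum_distrib_right sum_distrib_left mult_ac intro!: sum.cong)
  also have "\<dots> = (\<Sum>i\<in>Z. prod_list (map (w i) I) * prod_list (map (w i) J) * wedge n (w i) S T)"
    unfolding wedge_def sum_distrib_left by (rule sum.swap)
  finally show ?thesis .
qed

text \<open>A summand of a power sum may be the power of w = 0; the zero matrix satisfies the
  relation trivially.\<close>

lemma wedge_rank:
  "\<exists>m\<le>n. \<exists>c. \<forall>S\<in>wsets a n. \<forall>T. wedge n w S T = (\<Sum>S'\<in>{S'\<in>wsets a n. m \<notin> S'}. c S S' * wedge n w S' T)"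
proof (cases "\<exists>m\<le>n. w m \<noteq> 0")
  case True
  then show ?thesis using wedge_columns_dependent by blast
next
  case False
  then have "wedge n w S T = 0" for S T by (simp add: wedge_def)
  then show ?thesis by (intro exI[of _ 0]) simp
qed

text \<open>Each power contributes a matrix factoring through the sets that avoid one index, so r
  powers give a factorization through (n choose a) r indices.\<close>

lemma sums_of_powers_subset_YF_locus: "sums_of_powers (2 * \<delta> + 1) n r \<subseteq> YF_locus \<delta> n r"
proof
  fix \<Phi> assume \<Phi>A: "\<Phi> \<in> sums_of_powers (2 * \<delta> + 1) n r"
  then obtain ws where \<Phi>: "\<Phi> = (\<lambda>xs. \<Sum>i<r. powT (2 * \<delta> + 1) n (ws i) xs)" by (auto simp: sums_of_powers_def)
  let ?a = "n div 2"
  have "\<forall>i. \<exists>m c. m \<le> n \<and> (\<forall>S\<in>wsets ?a n. \<forall>T. wedge n (ws i) S T = (\<Sum>S'\<in>{S'\<in>wsets ?a n. m \<notin> S'}. c S S' * wedge n (ws i) S' T))"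
    using wedge_rank by blast
  then obtain m where "\<forall>i. \<exists>c. m i \<le> n \<and> (\<forall>S\<in>wsets ?a n. \<forall>T. wedge n (ws i) S T = (\<Sum>S'\<in>{S'\<in>wsets ?a n. m i \<notin> S'}. c S S' * wedge n (ws i) S' T))"
    by (rule choice[THEN exE])
  then obtain c where mc: "\<forall>i. m i \<le> n \<and> (\<forall>S\<in>wsets ?a n. \<forall>T. wedge n (ws i) S T = (\<Sum>S'\<in>{S'\<in>wsets ?a n. m i \<notin> S'}. c i S S' * wedge n (ws i) S' T))"
    by (rule choice[THEN exE])
  have m: "m i \<le> n" for i using mc by blast
  have c: "wedge n (ws i) S T = (\<Sum>S'\<in>{S'\<in>wsets ?a n. m i \<notin> S'}. c i S S' * wedge n (ws i) S' T)"
    if "S \<in> wsets ?a n" for i S T using mc that by blast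
  let ?B = "\<lambda>i. {S'\<in>wsets ?a n. m i \<notin> S'}"
  let ?L = "\<lambda>(I, T) (i, S'). prod_list (map (ws i) I) * wedge n (ws i) S' T"
  let ?N = "\<lambda>(i, S') (J, S). prod_list (map (ws i) J) * c i S S'"
  have "minors_vanish ((n choose ?a) * r + 1) (YF_rows \<delta> n ?a) (YF_cols \<delta> n ?a) (YF_mat n \<Phi>)"
  proof (rule minors_vanish_factorization[of "Sigma {..<r} ?B" _ _ _ _ ?L ?N])
    show "finite (Sigma {..<r} ?B)" using finite_wsets by simp
    have "card (Sigma {..<r} ?B) = r * (n choose ?a)"
      using card_wsets_avoiding[OF m] finite_wsets by (subst card_SigmaI) auto
    then show "card (Sigma {..<r} ?B) < (n choose ?a) * r + 1" by simp
    fix x y assume xy: "x \<in> YF_rows \<delta> n ?a" "y \<in> YF_cols \<delta> n ?a"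
    obtain I T J S where e: "x = (I, T)" "y = (J, S)" by (cases x, cases y)
    have IJ: "I \<in> slists \<delta> n" "J \<in> slists \<delta> n" "S \<in> wsets ?a n" using xy by (auto simp: e YF_rows_def YF_cols_def)
    have "YF_mat n \<Phi> x y = (\<Sum>i<r. prod_list (map (ws i) I) * prod_list (map (ws i) J) * wedge n (ws i) S T)"
      unfolding \<Phi> e by (rule YF_mat_sum_powers[OF IJ(1,2)])
    also have "\<dots> = (\<Sum>i<r. \<Sum>S'\<in>?B i. (prod_list (map (ws i) I) * wedge n (ws i) S' T) * (prod_list (map (ws i) J) * c i S S'))"
      unfolding c[OF IJ(3), of _ T] by (simp add: sum_distrib_left mult_ac)
    also have "\<dots> = (\<Sum>(i, S')\<in>Sigma {..<r} ?B. (prod_list (map (ws i) I) * wedge n (ws i) S' T) * (prod_list (map (ws i) J) * c i S S'))"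
      using finite_wsets by (subst sum.Sigma) auto
    finally show "YF_mat n \<Phi> x y = (\<Sum>z\<in>Sigma {..<r} ?B. ?L x z * ?N z y)"
      unfolding e by (simp add: case_prod_unfold)
  qed
  then show "\<Phi> \<in> YF_locus \<delta> n r" using \<Phi>A sums_of_powers_symT by (auto simp: YF_locus_def)
qed

section \<open>Closedness of the locus and irreducibility of the secant cone\<close>

lemma tidx_mset: "mset xs = mset ys \<Longrightarrow> xs \<in> tidx d n \<longleftrightarrow> ys \<in> tidx d n"
  using mset_eq_length[of xs ys] mset_eq_setD[of xs ys] by (auto simp: tidx_def)

lemma zclosed_YF_locus: "zclosed (tidx (2 * \<delta> + 1) n) (YF_locus \<delta> n r)"
proof -
  let ?I = "tidx (2 * \<delta> + 1) n" and ?R = "YF_rows \<delta> n (n div 2)" and ?C = "YF_cols \<delta> n (n div 2)"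
  let ?m = "(n choose (n div 2)) * r + 1"
  define P1 where "P1 = {(\<lambda>\<Phi> :: nat list \<Rightarrow> complex. \<Phi> xs - \<Phi> ys) | xs ys. xs \<in> ?I \<and> ys \<in> ?I \<and> mset xs = mset ys}"
  define P2 where "P2 = {(\<lambda>\<Phi>. det (mat ?m ?m (\<lambda>(i, j). YF_mat n \<Phi> (rs ! i) (cs ! j)))) | rs cs.
     length rs = ?m \<and> length cs = ?m \<and> distinct rs \<and> distinct cs \<and> set rs \<subseteq> ?R \<and> set cs \<subseteq> ?C}"
  have "P1 \<subseteq> polyfun ?I" unfolding P1_def by (auto intro!: polyfun_diff pvar)
  moreover have "P2 \<subseteq> polyfun ?I"
  proof
    fix p assume "p \<in> P2"
    then obtain rs cs where p: "p = (\<lambda>\<Phi>. det (mat ?m ?m (\<lambda>(i, j). YF_mat n \<Phi> (rs ! i) (cs ! j))))"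
      and l: "length rs = ?m" "length cs = ?m" "set rs \<subseteq> ?R" "set cs \<subseteq> ?C" unfolding P2_def by blast
    show "p \<in> polyfun ?I" unfolding p
    proof (rule polyfun_det)
      fix i j assume "i < ?m" "j < ?m"
      then have "rs ! i \<in> ?R" "cs ! j \<in> ?C" using l nth_mem by (metis subsetD)+
      then show "(\<lambda>\<Phi>. YF_mat n \<Phi> (rs ! i) (cs ! j)) \<in> polyfun ?I"
        by (rule lin_form_polyfun[OF YF_mat_lin_form])
    qed
  qed
  moreover have "YF_locus \<delta> n r = {\<Phi> \<in> aff ?I. \<forall>p\<in>P1 \<union> P2. p \<Phi> = 0}"
  proof (intro Set.set_eqI iffI)
    fix \<Phi> assume "\<Phi> \<in> YF_locus \<delta> n r"
    then have 1: "\<Phi> \<in> aff ?I" "\<forall>xs ys. mset xs = mset ys \<longrightarrow> \<Phi> xs = \<Phi> ys" "minors_vanish ?m ?R ?C (YF_mat n \<Phi>)"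
      unfolding YF_locus_def symT_def by blast+
    have "p \<Phi> = 0" if p_in: "p \<in> P1" for p
    proof -
      obtain xs ys where p: "p = (\<lambda>\<Phi>. \<Phi> xs - \<Phi> ys)" and "mset xs = mset ys" using p_in by (auto simp: P1_def)
      then have "\<Phi> xs = \<Phi> ys" using 1(2) by blast
      then show ?thesis by (simp add: p)
    qed
    moreover have "p \<Phi> = 0" if "p \<in> P2" for p using that 1(3) unfolding minors_vanish_def P2_def by blast
    ultimately show "\<Phi> \<in> {\<Phi> \<in> aff ?I. \<forall>p\<in>P1 \<union> P2. p \<Phi> = 0}" using 1 by blast
  next
    fix \<Phi> assume "\<Phi> \<in> {\<Phi> \<in> aff ?I. \<forall>p\<in>P1 \<union> P2. p \<Phi> = 0}"
    then have 1: "\<Phi> \<in> aff ?I" "\<And>p. p \<in> P1 \<Longrightarrow> p \<Phi> = 0" "\<And>p. p \<in> P2 \<Longrightarrow> p \<Phi> = 0" by auto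
    have "\<Phi> xs = \<Phi> ys" if "mset xs = mset ys" for xs ys
    proof (cases "xs \<in> ?I")
      case True
      then have "(\<lambda>\<Phi> :: nat list \<Rightarrow> complex. \<Phi> xs - \<Phi> ys) \<in> P1"
        using that tidx_mset[OF that] unfolding P1_def by blast
      from 1(2)[OF this] show ?thesis by simp
    next
      case False
      then show ?thesis using 1(1) tidx_mset[OF that] by (simp add: aff_def)
    qed
    moreover have "minors_vanish ?m ?R ?C (YF_mat n \<Phi>)"
      unfolding minors_vanish_def
    proof (intro allI impI)
      fix rs cs assume "length rs = ?m \<and> length cs = ?m \<and> distinct rs \<and> distinct cs \<and> set rs \<subseteq> ?R \<and> set cs \<subseteq> ?C"
      then have "(\<lambda>\<Phi>. det (mat ?m ?m (\<lambda>(i, j). YF_mat n \<Phi> (rs ! i) (cs ! j)))) \<in> P2" unfolding P2_def by blast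
      from 1(3)[OF this] show "det (mat ?m ?m (\<lambda>(i, j). YF_mat n \<Phi> (rs ! i) (cs ! j))) = 0" .
    qed
    ultimately show "\<Phi> \<in> YF_locus \<delta> n r" using 1(1) unfolding YF_locus_def symT_def by blast
  qed
  ultimately show ?thesis unfolding zclosed_def by (intro exI[of _ "P1 \<union> P2"] conjI Un_least)
qed

lemma secant_cone_eq: "secant_cone d n r = zclosure (tidx d n) (sums_of_powers d n r)"
  by (simp add: secant_cone_def sums_of_powers_def)

lemma zclosure_upper: "A \<subseteq> zclosure I A"
  by (auto simp: zclosure_def)

lemma zclosure_least: "zclosed I Z \<Longrightarrow> A \<subseteq> Z \<Longrightarrow> zclosure I A \<subseteq> Z"
  by (auto simp: zclosure_def)

text \<open>On a path in \<open>A\<close> from a point outside \<open>Z1\<close> to a point outside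
  \<open>Z2\<close>, a product of two nonzero univariate polynomials would vanish
  identically.\<close>

lemma zirred_zclosure:
  assumes ne: "A \<noteq> {}" and aff: "A \<subseteq> aff I"
    and path: "\<And>x y. x \<in> A \<Longrightarrow> y \<in> A \<Longrightarrow> \<exists>\<gamma>. \<gamma> 0 = x \<and> \<gamma> 1 = y \<and> (\<forall>s. \<gamma> s \<in> A) \<and> (\<forall>i\<in>I. \<exists>P. \<forall>s. \<gamma> s i = poly P s)"
  shows "zirred I (zclosure I A)"
  unfolding zirred_def
proof (intro conjI allI impI, goal_cases)
  case 1
  then show ?case using ne zclosure_upper by blast
next
  case 2
  have "zclosed I (aff I)" unfolding zclosed_def by (intro exI[of _ "{}"]) auto
  then show ?case using aff by (rule zclosure_least)
next
  case (3 Z1 Z2)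
  then have Z: "zclosed I Z1" "zclosed I Z2" and A: "A \<subseteq> Z1 \<union> Z2" using zclosure_upper[of A I] by auto
  have "A \<subseteq> Z1 \<or> A \<subseteq> Z2"
  proof (rule ccontr)
    assume "\<not> ?thesis"
    then obtain x y where x: "x \<in> A" "x \<notin> Z1" and y: "y \<in> A" "y \<notin> Z2" by blast
    obtain P where P: "P \<subseteq> polyfun I" "Z1 = {f \<in> aff I. \<forall>p\<in>P. p f = 0}" using Z(1) unfolding zclosed_def by blast
    obtain Q where Q: "Q \<subseteq> polyfun I" "Z2 = {f \<in> aff I. \<forall>p\<in>Q. p f = 0}" using Z(2) unfolding zclosed_def by blast
    from x aff P obtain p where p: "p \<in> P" "p \<in> polyfun I" "p x \<noteq> 0" by auto
    from y aff Q obtain q where q: "q \<in> Q" "q \<in> polyfun I" "q y \<noteq> 0" by auto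
    obtain \<gamma> where \<gamma>: "\<gamma> 0 = x" "\<gamma> 1 = y" "\<And>s. \<gamma> s \<in> A" "\<And>i. i \<in> I \<Longrightarrow> \<exists>P. \<forall>s. \<gamma> s i = poly P s"
      using path[OF x(1) y(1)] by blast
    obtain F where F: "\<And>s. p (\<gamma> s) = poly F s" using polyfun_path[of p I \<gamma>, OF p(2) \<gamma>(4)] by blast
    obtain G where G: "\<And>s. q (\<gamma> s) = poly G s" using polyfun_path[of q I \<gamma>, OF q(2) \<gamma>(4)] by blast
    have "p (\<gamma> s) = 0 \<or> q (\<gamma> s) = 0" for s
      using \<gamma>(3)[of s] A p(1) q(1) unfolding P(2) Q(2) by blast
    then have "\<forall>s. poly (F * G) s = 0" unfolding F G by auto
    then have "F * G = 0" by (simp only: poly_all_0_iff_0)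
    then have "p (\<gamma> 0) = 0 \<or> q (\<gamma> 1) = 0" unfolding F G by auto
    then show False using p q \<gamma> by simp
  qed
  then show ?case using zclosure_least Z by metis
qed

lemma zirred_secant_cone: "zirred (tidx d n) (secant_cone d n r)"
  unfolding secant_cone_eq
proof (rule zirred_zclosure)
  show "sums_of_powers d n r \<noteq> {}" by (auto simp: sums_of_powers_def)
  show "sums_of_powers d n r \<subseteq> aff (tidx d n)" using sums_of_powers_symT by (auto simp: symT_def)
  fix x y assume "x \<in> sums_of_powers d n r" "y \<in> sums_of_powers d n r"
  then obtain u v where x: "x = (\<lambda>xs. \<Sum>i<r. powT d n (u i) xs)" and y: "y = (\<lambda>xs. \<Sum>i<r. powT d n (v i) xs)"
    by (auto simp: sums_of_powers_def)
  \<comment> \<open>The segments join the vectors, not the tensors, so the path stays among sums of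
    r powers.\<close>
  define \<gamma> where "\<gamma> = (\<lambda>s xs. \<Sum>i<r. powT d n (\<lambda>k. u i k + s * (v i k - u i k)) xs)"
  have "\<exists>P. \<forall>s. \<gamma> s xs = poly P s" if "xs \<in> tidx d n" for xs
  proof -
    have "\<exists>E. \<forall>s. prod_list (map (\<lambda>k. u i k + s * (v i k - u i k)) xs) = prod_list (map (u i) xs) + s * poly E s" for i
      using power_path[of "u i" "\<lambda>k. v i k - u i k" xs] by blast
    then obtain E where E: "\<And>i s. prod_list (map (\<lambda>k. u i k + s * (v i k - u i k)) xs) = prod_list (map (u i) xs) + s * poly (E i) s"
      by metis
    show ?thesis using that
      by (intro exI[of _ "\<Sum>i<r. [:prod_list (map (u i) xs):] + [:0, 1:] * E i"])
        (simp add: \<gamma>_def powT_def E poly_sum)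
  qed
  moreover have "\<gamma> s \<in> sums_of_powers d n r" for s
    unfolding \<gamma>_def sums_of_powers_def mem_Collect_eq
    by (intro exI[of _ "\<lambda>i k. u i k + s * (v i k - u i k)"] refl)
  ultimately show "\<exists>\<gamma>. \<gamma> 0 = x \<and> \<gamma> 1 = y \<and> (\<forall>s. \<gamma> s \<in> sums_of_powers d n r) \<and> (\<forall>i\<in>tidx d n. \<exists>P. \<forall>s. \<gamma> s i = poly P s)"
    by (intro exI[of _ \<gamma>]) (auto simp: x y \<gamma>_def)
qed

text \<open>The vectors \<open>t\<close> and \<open>s\<close> behave as cokernel and kernel vectors
  at \<phi>. They border a block of size (n choose a) r that is diagonal and invertible at \<phi>,
  and the bordered minor vanishes on \<open>X\<close>; so their pairing is of second order on
  \<open>X\<close> and defines an equation of the tangent space.\<close>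

lemma YF_form_mpow:
  fixes \<delta> n r :: nat
  defines "a \<equiv> n div 2" and "I \<equiv> tidx (2 * \<delta> + 1) n"
  assumes \<delta>: "\<delta> \<ge> 1" and Z: "Z \<subseteq> lattice \<delta> n" "finite Z" "card Z = r" and X: "X \<subseteq> YF_locus \<delta> n r"
    and \<phi>: "\<phi> = (\<lambda>xs. \<Sum>\<gamma>\<in>Z. powT (2 * \<delta> + 1) n (pt \<gamma>) xs)"
    and t: "\<And>Ms \<eta>. length Ms = \<delta> \<Longrightarrow> YF_form \<delta> n a t (form_vec n Ms \<eta>) \<phi> = 0"
    and s: "\<And>Ls \<theta>. length Ls = \<delta> \<Longrightarrow> YF_form \<delta> n a (form_vec n Ls \<theta>) s \<phi> = 0"
    and ts: "YF_form \<delta> n a t s \<phi> = 0"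
  shows "\<exists>g \<in> mpow I \<phi> 2. \<forall>x\<in>X. YF_form \<delta> n a t s x = g x"
proof -
  let ?p = "interp_forms \<delta> n"
  have len: "length (?p \<gamma>) = \<delta>" if "\<gamma> \<in> Z" for \<gamma> using that Z by (auto simp: length_interp_forms lattice_def)
  have "\<exists>m\<le>n. \<gamma> m \<noteq> 0" if "\<gamma> \<in> Z" for \<gamma>
  proof (rule ccontr)
    assume "\<not> ?thesis"
    then have "(\<Sum>k\<le>n. \<gamma> k) = 0" by simp
    with that Z \<delta> show False by (auto simp: lattice_def)
  qed
  then obtain m where m: "\<And>\<gamma>. \<gamma> \<in> Z \<Longrightarrow> m \<gamma> \<le> n" "\<And>\<gamma>. \<gamma> \<in> Z \<Longrightarrow> pt \<gamma> (m \<gamma>) \<noteq> 0"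
    unfolding pt_def by (metis of_nat_eq_0_iff)
  define \<Xi> where "\<Xi> = Sigma Z (\<lambda>\<gamma>. {S\<in>wsets a n. m \<gamma> \<notin> S})"
  define \<rho> where "\<rho> = (n choose a) * r"
  have "card \<Xi> = \<rho>"
  proof -
    have "card \<Xi> = (\<Sum>\<gamma>\<in>Z. card {S\<in>wsets a n. m \<gamma> \<notin> S})" unfolding \<Xi>_def using Z finite_wsets by (subst card_SigmaI) auto
    also have "\<dots> = (\<Sum>\<gamma>\<in>Z. n choose a)" using card_wsets_avoiding[OF m(1)] by (intro sum.cong) auto
    finally show ?thesis using Z by (simp add: \<rho>_def)
  qed
  moreover have "finite \<Xi>" unfolding \<Xi>_def using Z finite_wsets by auto
  ultimately obtain e where e: "bij_betw e {..<\<rho>} \<Xi>"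
    using ex_bij_betw_nat_finite[of \<Xi>] by (auto simp: atLeast0LessThan)
  \<comment> \<open>The interpolating forms separate the points, and sets avoiding the pivot
    \<open>m \<gamma>\<close> separate the wedge directions at one point; hence the block is
    diagonal.\<close>
  define row where "row = (\<lambda>(\<gamma>, S). form_vec n (?p \<gamma>) (\<lambda>T. of_bool (T = insert (m \<gamma>) S)))"
  define col where "col = (\<lambda>(\<gamma>, S). form_vec n (?p \<gamma>) (\<lambda>S'. of_bool (S' = S)))"
  define q where "q = (\<lambda>i. if i < \<rho> then row (e i) else t)"
  define p where "p = (\<lambda>i. if i < \<rho> then col (e i) else s)"
  have at_\<phi>: "YF_form \<delta> n a (row \<xi>) (col \<xi>') \<phi> = 0 \<longleftrightarrow> \<xi> \<noteq> \<xi>'" if xi: "\<xi> \<in> \<Xi>" "\<xi>' \<in> \<Xi>" for \<xi> \<xi>'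
  proof -
    obtain \<alpha> S \<beta> S' where ab: "\<xi> = (\<alpha>, S)" "\<xi>' = (\<beta>, S')" by (cases \<xi>, cases \<xi>')
    have S: "\<alpha> \<in> Z" "\<beta> \<in> Z" "S \<in> wsets a n" "S' \<in> wsets a n" "m \<alpha> \<notin> S" "m \<beta> \<notin> S'"
      using xi by (auto simp: ab \<Xi>_def)
    have fin: "finite S" "finite S'" using S finite_in_wsets by auto
    have T: "insert (m \<alpha>) S \<in> wsets (a + 1) n" using S m(1)[OF S(1)] fin by (auto simp: wsets_def)
    let ?c = "\<lambda>\<alpha> \<gamma>. prod_list (map (\<lambda>L. lval n L (pt \<gamma>)) (?p \<alpha>))"
    have c0: "?c \<alpha> \<gamma> = 0" if "\<alpha> \<in> Z" "\<gamma> \<in> Z" "\<alpha> \<noteq> \<gamma>" for \<alpha> \<gamma>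
      using interp_forms_val_0[of \<alpha> \<delta> n \<gamma>] that Z \<delta> by auto
    have "YF_form \<delta> n a (row \<xi>) (col \<xi>') \<phi> = (\<Sum>\<gamma>\<in>Z. ?c \<alpha> \<gamma> * ?c \<beta> \<gamma> * wedge n (pt \<gamma>) S' (insert (m \<alpha>) S))"
      unfolding ab row_def col_def prod.case \<phi> YF_form_sum_powers[OF len[OF S(1)] len[OF S(2)]] wedge_unit[OF T S(4)] ..
    also have "\<dots> = (\<Sum>\<gamma>\<in>Z. if \<gamma> = \<alpha> then ?c \<alpha> \<alpha> * ?c \<beta> \<alpha> * wedge n (pt \<alpha>) S' (insert (m \<alpha>) S) else 0)"
      using c0[OF S(1)] by (intro sum.cong) auto
    also have "\<dots> = ?c \<alpha> \<alpha> * ?c \<beta> \<alpha> * wedge n (pt \<alpha>) S' (insert (m \<alpha>) S)" using Z S by simp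
    finally have val: "YF_form \<delta> n a (row \<xi>) (col \<xi>') \<phi> = ?c \<alpha> \<alpha> * ?c \<beta> \<alpha> * wedge n (pt \<alpha>) S' (insert (m \<alpha>) S)" .
    have cnz: "?c \<alpha> \<alpha> \<noteq> 0" using interp_forms_val_nz[of \<alpha> \<delta> n] S Z \<delta> by auto
    show ?thesis
    proof (cases "\<alpha> = \<beta>")
      case False
      then show ?thesis unfolding val using c0[OF S(2,1)] by (simp add: ab)
    next
      case True
      have "wcoef (m \<alpha> # sorted_list_of_set S') (insert (m \<alpha>) S') \<noteq> 0"
        using True S fin by (simp add: wcoef_def)
      then show ?thesis unfolding val using True S m(2)[OF S(1)] cnz fin
          wedge_avoid[of "m \<alpha>" S' S n "pt \<alpha>"] m(1)[OF S(1)] by (auto simp: ab)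
    qed
  qed
  have e_in: "e i \<in> \<Xi>" if "i < \<rho>" for i using e that by (auto simp: bij_betw_def)
  have e_inj: "e i = e j \<longleftrightarrow> i = j" if "i < \<rho>" "j < \<rho>" for i j using e that by (auto simp: bij_betw_def inj_on_def)
  have row_form_vec: "\<exists>Ls \<theta>. length Ls = \<delta> \<and> row \<xi> = form_vec n Ls \<theta>" if "\<xi> \<in> \<Xi>" for \<xi>
    using that len by (auto simp: row_def \<Xi>_def)
  have col_form_vec: "\<exists>Ls \<theta>. length Ls = \<delta> \<and> col \<xi> = form_vec n Ls \<theta>" if "\<xi> \<in> \<Xi>" for \<xi>
    using that len by (auto simp: col_def \<Xi>_def)
  have "\<exists>g \<in> mpow I \<phi> 2. \<forall>x\<in>X. YF_form \<delta> n a (q \<rho>) (p \<rho>) x = g x"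
  proof (rule diagonal_minor_mpow[of I \<rho> "\<lambda>i j. YF_form \<delta> n a (q i) (p j)"])
    show "finite I" unfolding I_def by (rule finite_tidx)
    show "YF_form \<delta> n a (q i) (p j) \<in> polyfun I" for i j
      unfolding I_def by (rule lin_form_polyfun[OF YF_form_lin_form])
    show "YF_form \<delta> n a (q i) (p j) \<phi> = 0" if "i \<le> \<rho>" "j \<le> \<rho>" "i \<noteq> j" for i j
    proof -
      consider "i < \<rho>" "j < \<rho>" | "i = \<rho>" "j < \<rho>" | "i < \<rho>" "j = \<rho>" using \<open>i \<le> \<rho>\<close> \<open>j \<le> \<rho>\<close> \<open>i \<noteq> j\<close> by linarith
      then show ?thesis
      proof cases
        case 1
        then show ?thesis using at_\<phi>[OF e_in e_in] e_inj that by (simp add: q_def p_def)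
      next
        case 2
        then show ?thesis using col_form_vec[OF e_in[of j]] t by (auto simp: q_def p_def)
      next
        case 3
        then show ?thesis using row_form_vec[OF e_in[of i]] s by (auto simp: q_def p_def)
      qed
    qed
    show "YF_form \<delta> n a (q i) (p i) \<phi> \<noteq> 0" if "i < \<rho>" for i
      using at_\<phi>[OF e_in e_in] that by (simp add: q_def p_def)
    show "YF_form \<delta> n a (q \<rho>) (p \<rho>) \<phi> = 0" using ts by (simp add: q_def p_def)
    fix x assume "x \<in> X"
    then have "minors_vanish (\<rho> + 1) (YF_rows \<delta> n a) (YF_cols \<delta> n a) (YF_mat n x)"
      using X by (auto simp: YF_locus_def \<rho>_def a_def)
    from minors_vanish_combination[OF finite_YF_rows finite_YF_cols this]
    show "det (mat (\<rho> + 1) (\<rho> + 1) (\<lambda>(i, j). YF_form \<delta> n a (q i) (p j) x)) = 0"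
      unfolding YF_form_def .
  qed
  then show ?thesis by (simp add: q_def p_def)
qed


text \<open>Verifies the smooth point criterion at \<phi>: a vector satisfying the tangent equations
  of \<open>X\<close> is a sum of tangent vectors at the chosen powers.\<close>

lemma vanishing_on_YF_locus:
  fixes \<delta> n r :: nat
  assumes n: "n \<ge> 2" and \<delta>: "\<delta> \<ge> 1" and Z: "Z \<subseteq> lattice \<delta> n" "finite Z" "card Z = r"
    and X: "zirred (tidx (2 * \<delta> + 1) n) X" "sums_of_powers (2 * \<delta> + 1) n r \<subseteq> X" "X \<subseteq> YF_locus \<delta> n r"
    and f: "f \<in> polyfun (tidx (2 * \<delta> + 1) n)" "\<And>x. x \<in> sums_of_powers (2 * \<delta> + 1) n r \<Longrightarrow> f x = 0"
    and x: "x \<in> X"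
  shows "f x = 0"
proof -
  define a where "a = n div 2"
  have a: "1 \<le> a" "a + 1 \<le> n" using n by (auto simp: a_def)
  define I where "I = tidx (2 * \<delta> + 1) n"
  define \<phi> where "\<phi> = (\<lambda>xs. \<Sum>\<gamma>\<in>Z. powT (2 * \<delta> + 1) n (pt \<gamma>) xs)"
  let ?p = "interp_forms \<delta> n"
  let ?c = "\<lambda>\<alpha> \<gamma>. prod_list (map (\<lambda>L. lval n L (pt \<gamma>)) (?p \<alpha>))"
  have len: "length (?p \<gamma>) = \<delta>" if "\<gamma> \<in> lattice \<delta> n" for \<gamma> using that by (auto simp: length_interp_forms lattice_def)
  have c0: "?c \<alpha> \<gamma> = 0" if "\<alpha> \<in> lattice \<delta> n" "\<gamma> \<in> Z" "\<alpha> \<noteq> \<gamma>" for \<alpha> \<gamma>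
    using interp_forms_val_0[of \<alpha> \<delta> n \<gamma>] that Z \<delta> by auto
  show ?thesis
  proof (rule vanishing_near_smooth_point[OF _ X(1,2) _ f _ x, of \<phi>])
    show "finite (tidx (2 * \<delta> + 1) n)" by (rule finite_tidx)
    show "\<phi> \<in> sums_of_powers (2 * \<delta> + 1) n r" unfolding \<phi>_def by (rule sums_of_powersI[OF Z(2,3)])
    fix v assume v: "v \<in> aff (tidx (2 * \<delta> + 1) n)"
      and H: "\<And>c. \<exists>g\<in>mpow (tidx (2 * \<delta> + 1) n) \<phi> 2. \<forall>x\<in>X. (\<Sum>i\<in>tidx (2 * \<delta> + 1) n. c i * (x i - \<phi> i)) = g x
        \<Longrightarrow> (\<Sum>i\<in>tidx (2 * \<delta> + 1) n. c i * v i) = 0"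
    \<comment> \<open>A linear functional that vanishes at \<phi> equals its own shifted form, so
      the tangent equations can be stated without the shift.\<close>
    have H': "F v = 0" if F: "lin_form I F" and F0: "F \<phi> = 0" "\<exists>g\<in>mpow I \<phi> 2. \<forall>x\<in>X. F x = g x" for F
    proof -
      obtain c where c: "\<And>\<psi>. F \<psi> = (\<Sum>i\<in>I. c i * \<psi> i)" using F by (auto simp: lin_form_def)
      have "(\<Sum>i\<in>I. c i * (x i - \<phi> i)) = F x" for x
        using F0(1) by (simp add: c right_diff_distrib sum_subtractf)
      then show ?thesis using H[of c] F0(2) unfolding I_def[symmetric] c[of v] by simp
    qed
    \<comment> \<open>Differences of entries with equal multisets vanish on all of \<open>X\<close>,
      hence are themselves tangent equations.\<close>
    have sym: "sym_tensor v"
      unfolding sym_tensor_def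
    proof (intro allI impI)
      fix xs ys :: "nat list" assume m: "mset xs = mset ys"
      show "v xs = v ys"
      proof (cases "xs \<in> I")
        case True
        then have "ys \<in> I" using tidx_mset[OF m] by (simp add: I_def)
        have "v xs + (-1) * v ys = 0"
        proof (rule H'[of "\<lambda>\<psi>. \<psi> xs + (-1) * \<psi> ys"])
          show "lin_form I (\<lambda>\<psi>. \<psi> xs + (-1) * \<psi> ys)"
            using True \<open>ys \<in> I\<close> finite_tidx by (intro lin_form_add lin_form_cmult lin_form_eval) (auto simp: I_def)
          have s: "\<Phi> xs + (-1) * \<Phi> ys = 0" if "\<Phi> \<in> X" for \<Phi>
          proof -
            have "\<Phi> \<in> symT (2 * \<delta> + 1) n" using that X(3) by (auto simp: YF_locus_def)
            then have "\<Phi> xs = \<Phi> ys" using m unfolding symT_def by blast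
            then show ?thesis by simp
          qed
          show "\<exists>g\<in>mpow I \<phi> 2. \<forall>x\<in>X. x xs + - 1 * x ys = g x"
            by (rule bexI[OF _ mpow_const_0]) (rule ballI, rule s)
          show "\<phi> xs + (-1) * \<phi> ys = 0"
            by (rule s) (use X(2) sums_of_powersI[OF Z(2,3)] in \<open>auto simp: \<phi>_def\<close>)
        qed
        then show ?thesis by simp
      next
        case False
        then show ?thesis using v tidx_mset[OF m] by (simp add: aff_def I_def)
      qed
    qed
    \<comment> \<open>Conditions on \<theta> and \<eta> are needed only at points of
      \<open>Z\<close>: for any other lattice point the interpolating form vanishes at all powers in
      \<phi>.\<close>
    have form0: "contract n v (?p \<alpha> @ ?p \<beta> @ [wform n a \<theta> \<eta>]) = 0"
      if ab: "\<alpha> \<in> lattice \<delta> n" "\<beta> \<in> lattice \<delta> n"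
        and t: "\<alpha> \<in> Z \<Longrightarrow> \<forall>S\<in>wsets a n. (\<Sum>T\<in>wsets (a + 1) n. \<theta> T * wedge n (pt \<alpha>) S T) = 0"
        and s: "\<beta> \<in> Z \<Longrightarrow> \<forall>T\<in>wsets (a + 1) n. (\<Sum>S\<in>wsets a n. \<eta> S * wedge n (pt \<beta>) S T) = 0"
      for \<alpha> \<beta> \<theta> \<eta>
    proof -
      have 1: "YF_form \<delta> n a (form_vec n (?p \<alpha>) \<theta>) (form_vec n Ms \<eta>') \<phi> = 0" if "length Ms = \<delta>" for Ms \<eta>'
        unfolding \<phi>_def YF_form_sum_powers[OF len[OF ab(1)] that]
      proof (rule sum.neutral, rule ballI)
        fix \<gamma> assume \<gamma>: "\<gamma> \<in> Z"
        show "?c \<alpha> \<gamma> * prod_list (map (\<lambda>L. lval n L (pt \<gamma>)) Ms)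
          * (\<Sum>T\<in>wsets (a + 1) n. \<Sum>S\<in>wsets a n. \<theta> T * \<eta>' S * wedge n (pt \<gamma>) S T) = 0"
        proof (cases "\<alpha> = \<gamma>")
          case True
          have "(\<Sum>T\<in>wsets (a + 1) n. \<Sum>S\<in>wsets a n. \<theta> T * \<eta>' S * wedge n (pt \<gamma>) S T)
            = (\<Sum>S\<in>wsets a n. \<eta>' S * (\<Sum>T\<in>wsets (a + 1) n. \<theta> T * wedge n (pt \<gamma>) S T))"
            by (subst sum.swap) (simp add: sum_distrib_left mult_ac)
          also have "\<dots> = 0" using t \<gamma> True by (intro sum.neutral) auto
          finally show ?thesis by simp
        qed (use c0[OF ab(1) \<gamma>] in simp)
      qed
      have 2: "YF_form \<delta> n a (form_vec n Ls \<theta>') (form_vec n (?p \<beta>) \<eta>) \<phi> = 0" if "length Ls = \<delta>" for Ls \<theta>'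
        unfolding \<phi>_def YF_form_sum_powers[OF that len[OF ab(2)]]
      proof (rule sum.neutral, rule ballI)
        fix \<gamma> assume \<gamma>: "\<gamma> \<in> Z"
        show "prod_list (map (\<lambda>L. lval n L (pt \<gamma>)) Ls) * ?c \<beta> \<gamma>
          * (\<Sum>T\<in>wsets (a + 1) n. \<Sum>S\<in>wsets a n. \<theta>' T * \<eta> S * wedge n (pt \<gamma>) S T) = 0"
        proof (cases "\<beta> = \<gamma>")
          case True
          have "(\<Sum>T\<in>wsets (a + 1) n. \<Sum>S\<in>wsets a n. \<theta>' T * \<eta> S * wedge n (pt \<gamma>) S T)
            = (\<Sum>T\<in>wsets (a + 1) n. \<theta>' T * (\<Sum>S\<in>wsets a n. \<eta> S * wedge n (pt \<gamma>) S T))"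
            by (simp add: sum_distrib_left mult_ac)
          also have "\<dots> = 0" using s \<gamma> True by (intro sum.neutral) auto
          finally show ?thesis by simp
        qed (use c0[OF ab(2) \<gamma>] in simp)
      qed
      have "YF_form \<delta> n a (form_vec n (?p \<alpha>) \<theta>) (form_vec n (?p \<beta>) \<eta>) v = 0"
      proof (rule H')
        show "lin_form I (YF_form \<delta> n a (form_vec n (?p \<alpha>) \<theta>) (form_vec n (?p \<beta>) \<eta>))"
          unfolding I_def by (rule YF_form_lin_form)
        show "YF_form \<delta> n a (form_vec n (?p \<alpha>) \<theta>) (form_vec n (?p \<beta>) \<eta>) \<phi> = 0" by (rule 1[OF len[OF ab(2)]])
        show "\<exists>g\<in>mpow I \<phi> 2. \<forall>x\<in>X. YF_form \<delta> n a (form_vec n (?p \<alpha>) \<theta>) (form_vec n (?p \<beta>) \<eta>) x = g x"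
          unfolding I_def a_def
          by (rule YF_form_mpow[OF \<delta> Z X(3) \<phi>_def]) (auto simp: 1[unfolded a_def] 2[unfolded a_def] len ab)
      qed
      then show ?thesis using YF_form_form_vec[OF sym len[OF ab(1)] len[OF ab(2)], where a = a and \<theta> = \<theta> and \<eta> = \<eta>] by simp
    qed
    have diag: "contract n v (?p \<alpha> @ ?p \<alpha> @ [unit_form k]) = 0" if \<alpha>: "\<alpha> \<in> lattice \<delta> n - Z" and k: "k \<le> n" for \<alpha> k
    proof -
      have "a \<le> card ({..n} - {k})" using a k by simp
      then obtain S where S: "S \<subseteq> {..n} - {k}" "card S = a" "finite S" by (rule obtain_subset_with_card_n)
      then have kS: "k \<notin> S" by blast
      have S': "S \<in> wsets a n" and T: "insert k S \<in> wsets (a + 1) n" using k kS S by (auto simp: wsets_def)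
      let ?w = "wform n a (\<lambda>T. of_bool (T = insert k S)) (\<lambda>S'. of_bool (S' = S))"
      have w: "?w l = (if l = k then wcoef (k # sorted_list_of_set S) (insert k S) else 0)" for l
        unfolding wform_unit[OF T S'] using S by (auto simp: wcoef_def)
      have "0 = contract n v ((?p \<alpha> @ ?p \<alpha>) @ [?w])" using form0[of \<alpha> \<alpha>] \<alpha> by simp
      also have "\<dots> = (\<Sum>l\<le>n. if l = k then wcoef (k # sorted_list_of_set S) (insert k S) * contract n v ((?p \<alpha> @ ?p \<alpha>) @ [unit_form k]) else 0)"
        unfolding contract_last[of n v _ ?w] w by (intro sum.cong) auto
      also have "\<dots> = wcoef (k # sorted_list_of_set S) (insert k S) * contract n v ((?p \<alpha> @ ?p \<alpha>) @ [unit_form k])"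
        using k by simp
      finally show ?thesis using S kS by (simp add: wcoef_def)
    qed
    have span: "\<exists>c b. \<forall>k\<le>n. contract n v (?p \<alpha> @ ?p \<beta> @ [unit_form k]) = c * pt \<alpha> k + b * pt \<beta> k"
      if ab: "\<alpha> \<in> lattice \<delta> n" "\<beta> \<in> lattice \<delta> n" "\<alpha> \<noteq> \<beta>" for \<alpha> \<beta>
    proof -
      define q where "q = (\<lambda>k. contract n v (?p \<alpha> @ ?p \<beta> @ [unit_form k]))"
      obtain y z where yz: "y \<le> n" "z \<le> n" "pt \<beta> y * pt \<alpha> z - pt \<beta> z * pt \<alpha> y \<noteq> 0"
        using lattice_independent[OF ab(2,1)] ab(3) \<delta> by metis
      have "\<exists>b c. \<forall>k\<le>n. q k = b * pt \<beta> k + c * pt \<alpha> k"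
      proof (rule span_from_minors[OF yz])
        fix x y z assume xyz: "x \<le> n" "y \<le> n" "z \<le> n" "distinct [x, y, z]"
        \<comment> \<open>The n - 2 indices other than \<open>x\<close>, \<open>y\<close>,
          \<open>z\<close> are split into a - 1 for \<open>col_wedge\<close> and n - a - 1 for
          \<open>row_wedge\<close>; the form then expresses the 3 x 3 determinant in these
          coordinates.\<close>
        define W where "W = sorted_list_of_set ({..n} - {x, y, z})"
        define A B where "A = take (a - 1) W" and "B = drop (a - 1) W"
        have W: "set W = {..n} - {x, y, z}" "distinct W" "length W = n - 2"
          using xyz by (auto simp: W_def card_Diff_subset)
        have AB: "A @ B = W" "length A = a - 1" using W a by (auto simp: A_def B_def)
        have A: "set A \<subseteq> {..n}" "Suc (length A) = a" using AB W a by (auto simp: A_def dest: in_set_takeD)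
        let ?w = "wform n a (row_wedge n (pt \<alpha>) B) (col_wedge n (pt \<beta>) A)"
        have w: "?w k = (-1) ^ length A * (\<Sum>i\<le>n. \<Sum>j\<le>n. pt \<beta> i * pt \<alpha> j * wcoef (k # i # j # W) {..n})" if "k \<le> n" for k
        proof -
          have "wcoef (k # i # A @ j # B) {..n} = (-1) ^ length A * wcoef (k # i # j # W) {..n}" for i j
            using wcoef_move[of "[k, i]" j A B "{..n}"] AB by simp
          then show ?thesis unfolding wform_theta_col_wedge[OF A that] by (simp add: sum_distrib_left mult_ac)
        qed
        have "0 = contract n v ((?p \<alpha> @ ?p \<beta>) @ [?w])"
          using form0[of \<alpha> \<beta> "row_wedge n (pt \<alpha>) B" "col_wedge n (pt \<beta>) A"] ab wedge_row_wedge wedge_col_wedge[OF A] by simp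
        also have "\<dots> = (\<Sum>k\<le>n. ?w k * q k)" unfolding contract_last[of n v _ ?w] by (simp add: q_def)
        also have "\<dots> = (-1) ^ length A * (\<Sum>k\<le>n. \<Sum>i\<le>n. \<Sum>j\<le>n. q k * (pt \<beta> i * pt \<alpha> j * wcoef (k # i # j # W) {..n}))"
          unfolding sum_distrib_left by (intro sum.cong refl) (simp add: w sum_distrib_left mult_ac)
        also have "\<dots> = (-1) ^ length A * (wcoef (x # y # z # W) {..n} *
            (q x * (pt \<beta> y * pt \<alpha> z - pt \<beta> z * pt \<alpha> y) + q y * (pt \<beta> z * pt \<alpha> x - pt \<beta> x * pt \<alpha> z)
              + q z * (pt \<beta> x * pt \<alpha> y - pt \<beta> y * pt \<alpha> x)))"
          by (simp only: triple_sum[OF xyz W(1)])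
        finally have e: "wcoef (x # y # z # W) {..n} *
            (q x * (pt \<beta> y * pt \<alpha> z - pt \<beta> z * pt \<alpha> y) + q y * (pt \<beta> z * pt \<alpha> x - pt \<beta> x * pt \<alpha> z)
              + q z * (pt \<beta> x * pt \<alpha> y - pt \<beta> y * pt \<alpha> x)) = 0" by (simp only: mult_eq_0_iff) simp
        have "wcoef (x # y # z # W) {..n} \<noteq> 0" using xyz W by (auto simp: wcoef_def)
        with e show "q x * (pt \<beta> y * pt \<alpha> z - pt \<beta> z * pt \<alpha> y) + q y * (pt \<beta> z * pt \<alpha> x - pt \<beta> x * pt \<alpha> z)
              + q z * (pt \<beta> x * pt \<alpha> y - pt \<beta> y * pt \<alpha> x) = 0" by (simp only: mult_eq_0_iff simp_thms)
      qed
      then show ?thesis unfolding q_def by (metis add.commute)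
    qed
    obtain vv where vv: "\<And>xs. xs \<in> I \<Longrightarrow> v xs = (\<Sum>\<gamma>\<in>Z. power_tangent (pt \<gamma>) (vv \<gamma>) xs)"
      using tensor_tangent[OF sym \<delta> Z(1,2) diag span] unfolding I_def by blast
    have "\<exists>E. (\<forall>s. prod_list (map (\<lambda>k. pt \<gamma> k + s * vv \<gamma> k) xs) = prod_list (map (pt \<gamma>) xs) + s * poly E s)
       \<and> poly E 0 = power_tangent (pt \<gamma>) (vv \<gamma>) xs" for \<gamma> xs by (rule power_path)
    then obtain E where E: "\<And>\<gamma> xs s. prod_list (map (\<lambda>k. pt \<gamma> k + s * vv \<gamma> k) xs) = prod_list (map (pt \<gamma>) xs) + s * poly (E \<gamma> xs) s"
      and E0: "\<And>\<gamma> xs. poly (E \<gamma> xs) 0 = power_tangent (pt \<gamma>) (vv \<gamma>) xs" by metis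
    define e where "e = (\<lambda>xs s. \<Sum>\<gamma>\<in>Z. poly (E \<gamma> xs) s)"
    \<comment> \<open>Every point of \<open>Z\<close> moves along its own direction, so the number
      of powers does not change.\<close>
    have "\<exists>x\<in>sums_of_powers (2 * \<delta> + 1) n r. \<forall>i\<in>I. x i = \<phi> i + s * e i s" for s
    proof (rule bexI[OF _ sums_of_powersI[OF Z(2,3), of _ n "\<lambda>\<gamma> k. pt \<gamma> k + s * vv \<gamma> k"]])
      show "\<forall>i\<in>I. (\<Sum>\<gamma>\<in>Z. powT (2 * \<delta> + 1) n (\<lambda>k. pt \<gamma> k + s * vv \<gamma> k) i) = \<phi> i + s * e i s"
        by (simp add: I_def powT_def \<phi>_def e_def E sum.distrib sum_distrib_left)
    qed
    moreover have "\<exists>P. \<forall>s. e i s = poly P s" for i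
      by (rule exI[of _ "\<Sum>\<gamma>\<in>Z. E \<gamma> i"]) (simp add: e_def poly_sum)
    ultimately show "\<exists>e. (\<forall>i\<in>tidx (2 * \<delta> + 1) n. e i 0 = v i) \<and> (\<forall>i\<in>tidx (2 * \<delta> + 1) n. \<exists>P. \<forall>s. e i s = poly P s) \<and>
        (\<forall>s. \<exists>x\<in>sums_of_powers (2 * \<delta> + 1) n r. \<forall>i\<in>tidx (2 * \<delta> + 1) n. x i = \<phi> i + s * e i s)"
      unfolding I_def[symmetric] by (intro exI[of _ e]) (auto simp: e_def E0 vv)
  qed
qed

text \<open>By definition of the closure, maximality means that every polynomial vanishing on the
  sums of powers vanishes on \<open>X\<close>.\<close>

lemma irr_component_YF_locus:
  assumes n: "n \<ge> 2" and \<delta>: "\<delta> \<ge> 1" and r: "r \<le> (\<delta> + n) choose n"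
  shows "irr_component (tidx (2 * \<delta> + 1) n) (secant_cone (2 * \<delta> + 1) n r) (YF_locus \<delta> n r)"
  unfolding irr_component_def
proof (intro conjI allI impI)
  let ?I = "tidx (2 * \<delta> + 1) n" and ?A = "sums_of_powers (2 * \<delta> + 1) n r"
  have "r \<le> card (lattice \<delta> n)" using r card_lattice_ge[where d = \<delta> and n = n] by linarith
  then obtain Z where Z: "Z \<subseteq> lattice \<delta> n" "card Z = r" "finite Z" by (rule obtain_subset_with_card_n)
  show "secant_cone (2 * \<delta> + 1) n r \<subseteq> YF_locus \<delta> n r"
    unfolding secant_cone_eq by (rule zclosure_least[OF zclosed_YF_locus sums_of_powers_subset_YF_locus])
  show "zirred ?I (secant_cone (2 * \<delta> + 1) n r)" by (rule zirred_secant_cone)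
  fix X assume X: "zirred ?I X \<and> secant_cone (2 * \<delta> + 1) n r \<subseteq> X \<and> X \<subseteq> YF_locus \<delta> n r"
  have AX: "?A \<subseteq> X" using X zclosure_upper[of ?A ?I] unfolding secant_cone_eq by blast
  have "X \<subseteq> secant_cone (2 * \<delta> + 1) n r"
    unfolding secant_cone_eq zclosure_def
  proof (rule Inter_greatest)
    fix W assume "W \<in> {W. zclosed ?I W \<and> ?A \<subseteq> W}"
    then obtain P where P: "P \<subseteq> polyfun ?I" "W = {f \<in> aff ?I. \<forall>p\<in>P. p f = 0}" and AW: "?A \<subseteq> W"
      unfolding zclosed_def by blast
    show "X \<subseteq> W"
    proof
      fix x assume x: "x \<in> X"
      have "p x = 0" if "p \<in> P" for p
      proof (rule vanishing_on_YF_locus[OF n \<delta> Z(1,3,2) _ AX _ _ _ x])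
        show "zirred ?I X" "X \<subseteq> YF_locus \<delta> n r" using X by auto
        show "p \<in> polyfun ?I" using that P by auto
        show "p y = 0" if "y \<in> ?A" for y using AW that \<open>p \<in> P\<close> unfolding P(2) by blast
      qed
      moreover have "x \<in> aff ?I" using X x unfolding zirred_def by blast
      ultimately show "x \<in> W" unfolding P(2) by blast
    qed
  qed
  then show "X = secant_cone (2 * \<delta> + 1) n r" using X by blast
qed

section \<open>The Pfaffian equations\<close>

lemma even_central_binomial:
  assumes "a > 0"
  shows "even (2 * a choose a)"
proof -
  have "2 * a choose a = (2 * a - 1 choose (a - 1)) + (2 * a - 1 choose a)"
    using assms by (intro choose_reduce_nat) auto
  also have "(2 * a - 1 choose a) = (2 * a - 1 choose (a - 1))"
    using assms binomial_symmetric[of a "2 * a - 1"] by (simp add: mult_2)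
  finally show ?thesis by simp
qed

text \<open>The rows of the pairing are those of the flattening, relabelled by complements and
  multiplied by signs, so the minors of both vanish together. The size (n choose a) r is even, and
  for a skew-symmetric matrix minors of size one more and sub-Pfaffians of size two more then vanish
  simultaneously.\<close>

lemma YF_pf_locus_eq:
  assumes n: "n = 2 * a" and a: "odd a"
  shows "YF_pf_locus \<delta> n r = YF_locus \<delta> n r"
proof -
  have half: "n div 2 = a" using n by simp
  have apos: "a > 0" using a by (auto elim: oddE)
  let ?R = "YF_rows \<delta> n a" and ?C = "YF_cols \<delta> n a" and ?k = "(n choose a) * r"
  define \<epsilon> where "\<epsilon> = (\<lambda>S'. wcoef (sorted_list_of_set ({..n} - S') @ sorted_list_of_set S') {..n})"
  have pair: "YF_pair n \<Phi> (I, S') y = \<epsilon> S' * YF_mat n \<Phi> (I, {..n} - S') y"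
    if "(I, S') \<in> ?C" "y \<in> ?C" for \<Phi> I S' y
    using YF_pair_eq_YF_mat[of S' n a "snd y" \<Phi> I "fst y"] that n by (auto simp: YF_cols_def \<epsilon>_def)
  have \<epsilon>: "\<epsilon> S' \<noteq> 0" if "S' \<in> wsets k n" for S' k
    using that finite_in_wsets[OF that] by (auto simp: \<epsilon>_def wcoef_def wsets_def)
  have compl: "{..n} - T \<in> wsets a n" if "T \<in> wsets (a + 1) n" for T
    using that finite_in_wsets[OF that] n by (auto simp: wsets_def card_Diff_subset)
  have compl': "{..n} - S \<in> wsets (a + 1) n" if "S \<in> wsets a n" for S
    using that finite_in_wsets[OF that] n by (auto simp: wsets_def card_Diff_subset)
  have "minors_vanish (?k + 1) ?R ?C (YF_mat n \<Phi>) \<longleftrightarrow> subpfaffians_vanish (?k + 2) ?C (YF_pair n \<Phi>)"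
    if \<Phi>: "\<Phi> \<in> symT (2 * \<delta> + 1) n" for \<Phi>
  proof -
    have delta: "(\<Sum>x\<in>A. (if x = z then c else 0) * f x) = c * f z" if "finite A" "z \<in> A"
      for A z c and f :: "nat list \<times> nat set \<Rightarrow> complex"
      using that by (simp add: if_distrib[of "\<lambda>x. x * _"] cong: if_cong)
    have "minors_vanish (?k + 1) ?C ?C (YF_pair n \<Phi>)" if van: "minors_vanish (?k + 1) ?R ?C (YF_mat n \<Phi>)"
    proof (rule minors_vanish_row_combinations[OF finite_YF_rows finite_YF_cols van])
      fix x assume x: "x \<in> ?C"
      obtain I S' where e: "x = (I, S')" by (cases x)
      have "(I, {..n} - S') \<in> ?R" using x compl' by (auto simp: e YF_cols_def YF_rows_def)
      then show "\<exists>q. \<forall>y\<in>?C. YF_pair n \<Phi> x y = (\<Sum>x'\<in>?R. q x' * YF_mat n \<Phi> x' y)"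
        using pair x delta[OF finite_YF_rows, of "(I, {..n} - S')"]
        by (intro exI[of _ "\<lambda>x'. if x' = (I, {..n} - S') then \<epsilon> S' else 0"]) (simp add: e)
    qed
    moreover have "minors_vanish (?k + 1) ?R ?C (YF_mat n \<Phi>)" if van: "minors_vanish (?k + 1) ?C ?C (YF_pair n \<Phi>)"
    proof (rule minors_vanish_row_combinations[OF finite_YF_cols finite_YF_cols van])
      fix x assume x: "x \<in> ?R"
      obtain I T where e: "x = (I, T)" by (cases x)
      have T: "T \<in> wsets (a + 1) n" "I \<in> slists \<delta> n" using x by (auto simp: e YF_rows_def)
      have in_C: "(I, {..n} - T) \<in> ?C" using T compl by (auto simp: YF_cols_def)
      have TT: "{..n} - ({..n} - T) = T" using T by (auto simp: wsets_def)
      show "\<exists>q. \<forall>y\<in>?C. YF_mat n \<Phi> x y = (\<Sum>x'\<in>?C. q x' * YF_pair n \<Phi> x' y)"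
      proof (rule exI[of _ "\<lambda>x'. if x' = (I, {..n} - T) then 1 / \<epsilon> ({..n} - T) else 0"], rule ballI)
        fix y assume y: "y \<in> ?C"
        show "YF_mat n \<Phi> x y = (\<Sum>x'\<in>?C. (if x' = (I, {..n} - T) then 1 / \<epsilon> ({..n} - T) else 0) * YF_pair n \<Phi> x' y)"
          unfolding delta[OF finite_YF_cols in_C] pair[OF in_C y] TT e using \<epsilon>[OF compl[OF T(1)]] by simp
      qed
    qed
    moreover have "even ?k" using even_central_binomial[OF apos] n by simp
    moreover have "YF_pair n \<Phi> p q = - YF_pair n \<Phi> q p" if "p \<in> ?C" "q \<in> ?C" for p q
      using YF_pair_sym[OF \<Phi> that] a by simp
    ultimately show ?thesis
      using subpfaffians_vanish_if_minors_vanish[of ?k ?C "YF_pair n \<Phi>"]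
        minors_vanish_if_subpfaffians_vanish[of ?k ?C "YF_pair n \<Phi>"] by blast
  qed
  then show ?thesis unfolding YF_pf_locus_def YF_locus_def half by blast
qed

theorem theorem1p3:
  fixes n \<delta> r :: nat
  assumes "n \<ge> 2" and "\<delta> \<ge> 1" and "r \<le> (\<delta> + n) choose n"
  defines "a \<equiv> n div 2" and "d \<equiv> 2 * \<delta> + 1"
  shows "irr_component (tidx d n) (secant_cone d n r) (YF_locus \<delta> n r)
    \<and> (n = 2 * a \<and> odd a \<longrightarrow>
         (\<forall>\<Phi>\<in>symT d n. \<forall>p\<in>YF_cols \<delta> n a. \<forall>q\<in>YF_cols \<delta> n a.
             YF_pair n \<Phi> p q = - YF_pair n \<Phi> q p)
       \<and> irr_component (tidx d n) (secant_cone d n r) (YF_pf_locus \<delta> n r))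
    \<and> (n = 2 * a \<and> even a \<longrightarrow>
         (\<forall>\<Phi>\<in>symT d n. \<forall>p\<in>YF_cols \<delta> n a. \<forall>q\<in>YF_cols \<delta> n a.
             YF_pair n \<Phi> p q = YF_pair n \<Phi> q p))"
proof -
  have comp: "irr_component (tidx d n) (secant_cone d n r) (YF_locus \<delta> n r)"
    unfolding d_def by (rule irr_component_YF_locus[OF assms(1-3)])
  have sym: "YF_pair n \<Phi> p q = (-1) ^ (a * a) * YF_pair n \<Phi> q p"
    if "\<Phi> \<in> symT d n" "p \<in> YF_cols \<delta> n a" "q \<in> YF_cols \<delta> n a" for \<Phi> p q
    using that by (rule YF_pair_sym)
  have odd: "YF_pair n \<Phi> p q = - YF_pair n \<Phi> q p"
    if "odd a" "\<Phi> \<in> symT d n" "p \<in> YF_cols \<delta> n a" "q \<in> YF_cols \<delta> n a" for \<Phi> p q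
    using sym[OF that(2-4)] that(1) by simp
  have even: "YF_pair n \<Phi> p q = YF_pair n \<Phi> q p"
    if "even a" "\<Phi> \<in> symT d n" "p \<in> YF_cols \<delta> n a" "q \<in> YF_cols \<delta> n a" for \<Phi> p q
    using sym[OF that(2-4)] that(1) by simp
  have pf: "irr_component (tidx d n) (secant_cone d n r) (YF_pf_locus \<delta> n r)" if "n = 2 * a" "odd a"
    using comp unfolding YF_pf_locus_eq[OF that] .
  show ?thesis
    by (intro conjI impI ballI comp, elim conjE, erule (3) odd, elim conjE, erule (1) pf, elim conjE, erule (3) even)
qed

end
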